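(* Let $p$ be an odd prime, let $K=\overline{\mathbb{F}_p}$, and let $c\in\{1,-1\}$. For $n\ge 1$ let $B_n$ denote the nonsingular projective model over $K$ of the curve $y^p+cy=x^{p^n+1}$. Then for every integer $\ell>2$ there is no Galois morphism $B_{2\ell}\longrightarrow B_\ell$.
   Context: All morphisms are non-constant and defined over $K$. A morphism $\phi:\mathcal{X}\longrightarrow\mathcal{Y}$ of nonsingular projective curves over $K$ is called Galois if the extension of function fields $K(\mathcal{X})/\phi^*K(\mathcal{Y})$ is Galois; equivalently, $\mathcal{Y}\cong \mathcal{X}/G$ (via $\phi$) for a finite subgroup $G$ of the $K$-automorphism group $\mathrm{Aut}(\mathcal{X})$. *)

theory Defs
  imports
    "HOL-Algebra.Finite_Extensions"
    "HOL-Analysis.Analysis"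
    "HOL-Computational_Algebra.Computational_Algebra"
    "HOL-Library.Poly_Mapping"
begin

section \<open>Algebraic closures of prime fields\<close>

definition alg_closure_of_Fp :: "nat \<Rightarrow> 'k::alg_closed_field itself \<Rightarrow> bool" where
  "alg_closure_of_Fp p _ \<longleftrightarrow>
     CHAR('k) = p \<and>
     (\<forall>a::'k. \<exists>q. q \<noteq> 0 \<and> (\<forall>i. Polynomial.coeff q i \<in> \<int>) \<and> poly q a = 0)"
  \<comment> \<open>In characteristic \<open>p\<close> the set \<open>\<int>\<close>, the range of \<^const>\<open>of_int\<close>, is the prime subfield.\<close>

section \<open>Projective space and its Zariski topology\<close>

definition proj_rel :: "'k::field ^ 'n \<Rightarrow> 'k ^ 'n \<Rightarrow> bool" where
  "proj_rel v w \<longleftrightarrow> v \<noteq> 0 \<and> w \<noteq> 0 \<and> (\<exists>a. a \<noteq> 0 \<and> w = a *s v)"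

lemma part_equivp_proj_rel: "part_equivp (proj_rel :: 'k::field ^ 'n \<Rightarrow> _)"
proof (rule part_equivpI)
  show "\<exists>v. proj_rel v (v :: 'k ^ 'n)"
    by (rule exI[of _ "\<chi> i. 1"]) (auto simp: proj_rel_def vec_eq_iff intro!: exI[of _ 1])
  show "symp (proj_rel :: 'k ^ 'n \<Rightarrow> _)"
  proof (rule sympI)
    fix v w :: "'k ^ 'n" assume "proj_rel v w"
    then obtain a where "v \<noteq> 0" "w \<noteq> 0" "a \<noteq> 0" "w = a *s v"
      by (auto simp: proj_rel_def)
    moreover from this have "v = inverse a *s w"
      by (simp add: vec_eq_iff)
    ultimately show "proj_rel w v"
      unfolding proj_rel_def by (metis inverse_zero_imp_zero)
  qed
  show "transp (proj_rel :: 'k ^ 'n \<Rightarrow> _)"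
    by (rule transpI) (auto simp: proj_rel_def vec_eq_iff mult.assoc[symmetric]; metis no_zero_divisors)
qed

text \<open>\<open>('k, 'n) proj\<close> is projective space of dimension \<open>CARD('n) - 1\<close> over \<open>'k\<close>.\<close>

quotient_type (overloaded) ('k, 'n) proj = "'k::field ^ 'n" / partial: proj_rel
  by (rule part_equivp_proj_rel)

type_synonym ('k, 'n) mpol = "('n \<Rightarrow>\<^sub>0 nat) \<Rightarrow>\<^sub>0 'k"

definition mpol_eval :: "('k::field, 'n::finite) mpol \<Rightarrow> 'k ^ 'n \<Rightarrow> 'k" where
  "mpol_eval F v =
     (\<Sum>m\<in>Poly_Mapping.keys F. Poly_Mapping.lookup F m * (\<Prod>i\<in>UNIV. v $ i ^ Poly_Mapping.lookup m i))"

definition homogeneous :: "nat \<Rightarrow> ('k::field, 'n::finite) mpol \<Rightarrow> bool" where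
  "homogeneous d F \<longleftrightarrow> (\<forall>m\<in>Poly_Mapping.keys F. (\<Sum>i\<in>UNIV. Poly_Mapping.lookup m i) = d)"

text \<open>
  The value of a form at a point is taken at the representative chosen by \<^const>\<open>rep_proj\<close>.
  Only its vanishing, and quotients of values of forms of equal degree, are used; these do not
  depend on the choice.
\<close>

definition form_at :: "('k::field, 'n::finite) mpol \<Rightarrow> ('k, 'n) proj \<Rightarrow> 'k" where
  "form_at F P = mpol_eval F (rep_proj P)"

definition zero_locus :: "('k::field, 'n::finite) mpol set \<Rightarrow> ('k, 'n) proj set" where
  "zero_locus S = {P. \<forall>F\<in>S. form_at F P = 0}"

definition zariski_closed :: "('k::field, 'n::finite) proj set \<Rightarrow> bool" where
  "zariski_closed Z \<longleftrightarrow> (\<exists>S. (\<forall>F\<in>S. \<exists>d. homogeneous d F) \<and> Z = zero_locus S)"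

definition zariski :: "('k::field, 'n::finite) proj topology" where
  "zariski = topology (\<lambda>U. zariski_closed (- U))"

lemma mpol_eval_superset:
  assumes "finite A" "Poly_Mapping.keys F \<subseteq> A"
  shows "mpol_eval F v =
    (\<Sum>m\<in>A. Poly_Mapping.lookup F m * (\<Prod>i\<in>UNIV. v $ i ^ Poly_Mapping.lookup m i))"
  unfolding mpol_eval_def
  by (rule sum.mono_neutral_left) (use assms in \<open>auto simp: in_keys_iff\<close>)

lemma mpol_eval_add: "mpol_eval (F + G) v = mpol_eval F v + mpol_eval G v"
proof -
  let ?A = "Poly_Mapping.keys F \<union> Poly_Mapping.keys G"
  have "Poly_Mapping.keys (F + G) \<subseteq> ?A" by (rule Poly_Mapping.keys_add)
  then show ?thesis
    by (simp add: mpol_eval_superset[of ?A] lookup_add distrib_right sum.distrib)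
qed

lemma mpol_eval_single:
  "mpol_eval (Poly_Mapping.single m a) v = a * (\<Prod>i\<in>UNIV. v $ i ^ Poly_Mapping.lookup m i)"
  by (simp add: mpol_eval_superset[of "{m}"])

lemma mpol_induct_add:
  fixes F :: "('k::field, 'n::finite) mpol"
  assumes "P 0" "\<And>m a F. P F \<Longrightarrow> P (Poly_Mapping.single m a + F)"
  shows "P F"
proof (induction F rule: update_induct)
  case const then show ?case by (rule assms(1))
next
  case (update F m a)
  have "Poly_Mapping.update m a F = Poly_Mapping.single m a + F"
    by (rule poly_mapping_eqI)
      (use update in \<open>auto simp: lookup_update lookup_add lookup_single in_keys_iff when_def\<close>)
  then show ?case using assms(2)[OF update.IH] by simp
qed

lemma mpol_eval_mult: "mpol_eval (F * G) v = mpol_eval F v * mpol_eval G v"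
proof (induction F rule: mpol_induct_add)
  case 1 then show ?case by (simp add: mpol_eval_def)
next
  case (2 m a F)
  have "mpol_eval (Poly_Mapping.single m a * G) v = mpol_eval (Poly_Mapping.single m a) v * mpol_eval G v"
  proof (induction G rule: mpol_induct_add)
    case 1 then show ?case by (simp add: mpol_eval_def)
  next
    case (2 m' b G)
    then show ?case
      by (simp add: distrib_left mpol_eval_add mult_single mpol_eval_single lookup_add
          power_add prod.distrib mult_ac)
  qed
  with 2 show ?case by (simp add: distrib_right mpol_eval_add)
qed

lemma homogeneous_mult:
  assumes "homogeneous d F" "homogeneous e G"
  shows "homogeneous (d + e) (F * G)"
  unfolding homogeneous_def
proof
  fix m assume "m \<in> Poly_Mapping.keys (F * G)"
  then obtain a b where "m = a + b" "a \<in> Poly_Mapping.keys F" "b \<in> Poly_Mapping.keys G"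
    using keys_mult[of F G] by blast
  then show "(\<Sum>i\<in>UNIV. Poly_Mapping.lookup m i) = d + e"
    using assms by (simp add: homogeneous_def lookup_add sum.distrib)
qed

lemma istopology_zariski:
  "istopology (\<lambda>U. zariski_closed (- U :: ('k::field, 'n::finite) proj set))"
  unfolding istopology_def
proof (intro conjI allI impI)
  fix U V :: "('k, 'n) proj set"
  assume "zariski_closed (- U)" "zariski_closed (- V)"
  then obtain S T where S: "\<forall>F\<in>S. \<exists>d. homogeneous d F" "- U = zero_locus S"
    and T: "\<forall>F\<in>T. \<exists>d. homogeneous d F" "- V = zero_locus T"
    unfolding zariski_closed_def by blast
  let ?R = "(\<lambda>(F, G). F * G) ` (S \<times> T)"
  have "- (U \<inter> V) = zero_locus ?R"
    unfolding Compl_Int S(2) T(2) by (auto simp: zero_locus_def form_at_def mpol_eval_mult)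
  moreover have "\<forall>F\<in>?R. \<exists>d. homogeneous d F"
    using S(1) T(1) homogeneous_mult by fastforce
  ultimately show "zariski_closed (- (U \<inter> V))"
    unfolding zariski_closed_def by blast
next
  fix \<K> :: "('k, 'n) proj set set"
  assume "\<forall>U\<in>\<K>. zariski_closed (- U)"
  then obtain S where S: "\<forall>U\<in>\<K>. (\<forall>F\<in>S U. \<exists>d. homogeneous d F) \<and> - U = zero_locus (S U)"
    unfolding zariski_closed_def by metis
  have "- \<Union>\<K> = zero_locus (\<Union>U\<in>\<K>. S U)"
  proof (rule Set.set_eqI)
    fix P
    have "P \<in> - \<Union>\<K> \<longleftrightarrow> (\<forall>U\<in>\<K>. P \<in> - U)" by blast
    also have "\<dots> \<longleftrightarrow> (\<forall>U\<in>\<K>. P \<in> zero_locus (S U))" using S by blast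
    also have "\<dots> \<longleftrightarrow> P \<in> zero_locus (\<Union>U\<in>\<K>. S U)" by (auto simp: zero_locus_def)
    finally show "P \<in> - \<Union>\<K> \<longleftrightarrow> P \<in> zero_locus (\<Union>U\<in>\<K>. S U)" .
  qed
  moreover have "\<forall>F\<in>(\<Union>U\<in>\<K>. S U). \<exists>d. homogeneous d F" using S by blast
  ultimately show "zariski_closed (- \<Union>\<K>)"
    unfolding zariski_closed_def by blast
qed

lemma openin_zariski: "openin zariski U \<longleftrightarrow> zariski_closed (- U)"
  by (simp add: zariski_def istopology_zariski topology_inverse')

lemma topspace_zariski [simp]: "topspace (zariski :: ('k::field, 'n::finite) proj topology) = UNIV"
proof -
  have "zero_locus {1} = ({} :: ('k, 'n) proj set)"
    by (simp add: zero_locus_def form_at_def mpol_eval_def)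
  moreover have "homogeneous 0 (1 :: ('k, 'n) mpol)"
    by (simp add: homogeneous_def)
  ultimately have "openin zariski (UNIV :: ('k, 'n) proj set)"
    unfolding openin_zariski zariski_closed_def by (auto intro!: exI[of _ "{1}"])
  then show ?thesis by (metis openin_subset top.extremum_uniqueI)
qed

abbreviation zariski_on :: "('k::field, 'n::finite) proj set \<Rightarrow> ('k, 'n) proj topology" where
  "zariski_on C \<equiv> subtopology zariski C"

section \<open>Projective curves\<close>

definition irreducible_in :: "'a topology \<Rightarrow> 'a set \<Rightarrow> bool" where
  "irreducible_in T Z \<longleftrightarrow> Z \<subseteq> topspace T \<and> Z \<noteq> {} \<and>
     (\<forall>A B. closedin T A \<and> closedin T B \<and> Z \<subseteq> A \<union> B \<longrightarrow> Z \<subseteq> A \<or> Z \<subseteq> B)"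

definition krull_dim :: "'a topology \<Rightarrow> enat" where
  "krull_dim T = Sup {enat n | n. \<exists>Z :: nat \<Rightarrow> 'a set.
     (\<forall>i\<le>n. closedin T (Z i) \<and> irreducible_in T (Z i)) \<and> (\<forall>i<n. Z i \<subset> Z (Suc i))}"

definition projective_curve :: "('k::field, 'n::finite) proj set \<Rightarrow> bool" where
  "projective_curve C \<longleftrightarrow>
     closedin zariski C \<and> irreducible_in zariski C \<and> krull_dim (zariski_on C) = 1"

definition vanishing_forms :: "('k::field, 'n::finite) proj set \<Rightarrow> ('k, 'n) mpol set" where
  "vanishing_forms C = {F. (\<exists>d. homogeneous d F) \<and> (\<forall>P\<in>C. form_at F P = 0)}"

text \<open>The vector of formal partial derivatives of \<open>F\<close>, evaluated at \<open>v\<close>.\<close>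

definition mpol_gradient :: "('k::field, 'n::finite) mpol \<Rightarrow> 'k ^ 'n \<Rightarrow> 'k ^ 'n" where
  "mpol_gradient F v = (\<chi> i. \<Sum>m\<in>Poly_Mapping.keys F. Poly_Mapping.lookup F m *
     (of_nat (Poly_Mapping.lookup m i) * v $ i ^ (Poly_Mapping.lookup m i - 1) *
       (\<Prod>j\<in>UNIV - {i}. v $ j ^ Poly_Mapping.lookup m j)))"

text \<open>
  Jacobian criterion: at every point the rank of the Jacobian matrix of the homogeneous ideal
  is the codimension of \<open>C\<close> in the ambient space, whose dimension is \<open>CARD('n) - 1\<close>.
\<close>

definition nonsingular :: "('k::field, 'n::finite) proj set \<Rightarrow> bool" where
  "nonsingular C \<longleftrightarrow> (\<forall>P\<in>C.
     enat (vec.dim {mpol_gradient F (rep_proj P) | F. F \<in> vanishing_forms C})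
       + krull_dim (zariski_on C) + 1 = enat CARD('n))"

section \<open>Regular functions and morphisms\<close>

definition regular_on ::
    "('k::field, 'n::finite) proj set \<Rightarrow> (('k, 'n) proj \<Rightarrow> 'k) \<Rightarrow> bool" where
  "regular_on U f \<longleftrightarrow> (\<forall>P\<in>U. \<exists>V. openin (zariski_on U) V \<and> P \<in> V \<and>
     (\<exists>d G H. homogeneous d G \<and> homogeneous d H \<and>
        (\<forall>Q\<in>V. form_at H Q \<noteq> 0 \<and> f Q = form_at G Q / form_at H Q)))"

text \<open>Here \<open>C\<close> and \<open>D\<close> are quasi-projective; only the values of \<open>\<phi>\<close> on \<open>C\<close> matter.\<close>

definition variety_morphism ::
    "('k::field, 'm::finite) proj set \<Rightarrow> ('k, 'n::finite) proj set \<Rightarrow>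
     (('k, 'm) proj \<Rightarrow> ('k, 'n) proj) \<Rightarrow> bool" where
  "variety_morphism C D \<phi> \<longleftrightarrow> continuous_map (zariski_on C) (zariski_on D) \<phi> \<and>
     (\<forall>V f. openin (zariski_on D) V \<and> regular_on V f \<longrightarrow> regular_on (C \<inter> \<phi> -` V) (f \<circ> \<phi>))"

definition isomorphic_varieties ::
    "('k::field, 'm::finite) proj set \<Rightarrow> ('k, 'n::finite) proj set \<Rightarrow> bool" where
  "isomorphic_varieties C D \<longleftrightarrow> (\<exists>\<phi> \<psi>. variety_morphism C D \<phi> \<and> variety_morphism D C \<psi> \<and>
     (\<forall>P\<in>C. \<psi> (\<phi> P) = P) \<and> (\<forall>Q\<in>D. \<phi> (\<psi> Q) = Q))"

definition birational ::
    "('k::field, 'm::finite) proj set \<Rightarrow> ('k, 'n::finite) proj set \<Rightarrow> bool" where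
  "birational C D \<longleftrightarrow> (\<exists>U V. openin (zariski_on C) U \<and> U \<noteq> {} \<and>
     openin (zariski_on D) V \<and> V \<noteq> {} \<and> isomorphic_varieties U V)"

definition nonsingular_projective_model ::
    "('k::field, 'n::finite) proj set \<Rightarrow> ('k, 'm::finite) proj set \<Rightarrow> bool" where
  "nonsingular_projective_model C A \<longleftrightarrow> projective_curve C \<and> nonsingular C \<and> birational C A"

section \<open>Function fields and Galois morphisms\<close>

definition rational_pairs ::
    "('k::field, 'n::finite) proj set \<Rightarrow> (('k, 'n) proj set \<times> (('k, 'n) proj \<Rightarrow> 'k)) set" where
  "rational_pairs C = {(U, f). openin (zariski_on C) U \<and> U \<noteq> {} \<and> regular_on U f}"

definition rational_rel ::
    "('k::field, 'n::finite) proj set \<Rightarrow> (('k, 'n) proj set \<times> (('k, 'n) proj \<Rightarrow> 'k)) rel" where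
  "rational_rel C = {((U, f), (V, g)).
     (U, f) \<in> rational_pairs C \<and> (V, g) \<in> rational_pairs C \<and> (\<forall>P\<in>U \<inter> V. f P = g P)}"

definition rational_class ::
    "('k::field, 'n::finite) proj set \<Rightarrow> ('k, 'n) proj set \<Rightarrow> (('k, 'n) proj \<Rightarrow> 'k) \<Rightarrow>
     (('k, 'n) proj set \<times> (('k, 'n) proj \<Rightarrow> 'k)) set" where
  "rational_class C U f = rational_rel C `` {(U, f)}"

definition function_field ::
    "('k::field, 'n::finite) proj set \<Rightarrow> (('k, 'n) proj set \<times> (('k, 'n) proj \<Rightarrow> 'k)) set ring" where
  "function_field C =
     \<lparr> carrier = rational_pairs C // rational_rel C,
       monoid.mult = (\<lambda>a b. \<Union>(U, f)\<in>a. \<Union>(V, g)\<in>b. rational_class C (U \<inter> V) (\<lambda>P. f P * g P)),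
       one = rational_class C C (\<lambda>_. 1),
       ring.zero = rational_class C C (\<lambda>_. 0),
       add = (\<lambda>a b. \<Union>(U, f)\<in>a. \<Union>(V, g)\<in>b. rational_class C (U \<inter> V) (\<lambda>P. f P + g P)) \<rparr>"

text \<open>
  Meaningful for dominant \<open>\<phi>\<close>, in particular for non-constant morphisms between curves: then
  \<open>C \<inter> \<phi> -` V\<close> is nonempty for every nonempty open \<open>V\<close>.
\<close>

definition pullback ::
    "('k::field, 'm::finite) proj set \<Rightarrow> (('k, 'm) proj \<Rightarrow> ('k, 'n::finite) proj) \<Rightarrow>
     (('k, 'n) proj set \<times> (('k, 'n) proj \<Rightarrow> 'k)) set \<Rightarrow>
     (('k, 'm) proj set \<times> (('k, 'm) proj \<Rightarrow> 'k)) set" where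
  "pullback C \<phi> a = (\<Union>(V, g)\<in>a. rational_class C (C \<inter> \<phi> -` V) (g \<circ> \<phi>))"

definition relative_aut :: "('a, 'b) ring_scheme \<Rightarrow> 'a set \<Rightarrow> ('a \<Rightarrow> 'a) set" where
  "relative_aut L F = {\<sigma> \<in> ring_iso L L. \<forall>x\<in>F. \<sigma> x = x}"

definition galois_extension :: "('a, 'b) ring_scheme \<Rightarrow> 'a set \<Rightarrow> bool" where
  "galois_extension L F \<longleftrightarrow> field L \<and> subfield F L \<and>
     (\<forall>x\<in>carrier L. \<not> ring.transcendental L F x) \<and>
     {x \<in> carrier L. \<forall>\<sigma>\<in>relative_aut L F. \<sigma> x = x} = F"

definition galois_morphism ::
    "('k::field, 'm::finite) proj set \<Rightarrow> ('k, 'n::finite) proj set \<Rightarrow>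
     (('k, 'm) proj \<Rightarrow> ('k, 'n) proj) \<Rightarrow> bool" where
  "galois_morphism C D \<phi> \<longleftrightarrow> variety_morphism C D \<phi> \<and> \<not> (\<exists>Q. \<forall>P\<in>C. \<phi> P = Q) \<and>
     galois_extension (function_field C) (pullback C \<phi> ` carrier (function_field D))"

section \<open>The curves \<open>B\<^sub>n\<close>\<close>

text \<open>The affine curve, embedded in the projective plane by \<open>(x, y) \<mapsto> [x : y : 1]\<close>.\<close>

definition affine_B :: "nat \<Rightarrow> 'k::field \<Rightarrow> nat \<Rightarrow> ('k, 3) proj set" where
  "affine_B p c n = {abs_proj (vector [x, y, 1]) | x y. y ^ p + c * y = x ^ (p ^ n + 1)}"

end

theory Submission
  imports Defs
begin

text \<open>
  Put \<open>q = p^(2l)\<close> and \<open>r = p^l\<close>.  A nonconstant morphism between the models yields, through the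
  birational maps to the affine curves, functions \<open>u\<close> and \<open>v\<close> in \<open>K(x, y)\<close>, where
  \<open>y^p + c y = x^(q+1)\<close>, such that \<open>v^p + c v = u^(r+1)\<close> and \<open>u\<close> is not constant.  Extracting \<open>p\<close>-th
  roots, one may assume \<open>u' \<noteq> 0\<close> for the derivation with \<open>x' = 1\<close>.  At a pole of \<open>u\<close> the equation
  forces \<open>u'\<close> to vanish to high order, so counting the zeros of \<open>u'\<close> bounds the poles of \<open>u\<close>
  (a form of the Riemann--Hurwitz inequality).  For \<open>l > 2\<close> the bound is so strong that \<open>u\<close>, times a
  polynomial in \<open>x\<close> clearing its poles, has a pole of order less than \<open>q + 1\<close> at infinity and
  therefore lies in \<open>K[x]\<close>.  Hence \<open>u\<close> is a rational function of \<open>x\<close>, and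
  \<open>v = \<mu> y + h(x)\<close>, so that \<open>u^(r+1) = \<mu> x^(q+1) + h^p + c h\<close>.  A degree comparison shows that \<open>u\<close> is
  a polynomial of degree \<open>r\<close> with constant nonzero derivative, and comparing the coefficients of
  \<open>x^(2 p^s)\<close> in the last identity gives a contradiction.
\<close>

section \<open>Polynomial evaluation along ring homomorphisms\<close>

text \<open>The function field is handled inside K((t)), through the expansion at the only infinite
  place. Monomials of \<open>y\<close>-degree below \<open>p\<close> have distinct pole orders
  there, so an identity that holds at infinity holds at every place. The degree of a divisor of
  affine zeros becomes the degree of a norm to K[x]. The number q(p-1)-2, the order of dx at
  infinity, is the canonical degree 2g-2 for the genus g = q(p-1)/2. The bound on poles reads as
  follows: a pole of \<open>u\<close> has order \<open>p e\<close>, and \<open>u'\<close> vanishes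
  there to order at least e(rp-r-2). The zeros of \<open>u'\<close> are limited by 2g-2, so the
  numerator of \<open>u\<close> has a pole of order at most p^2 (2g-2)/(rp-r-2) at infinity. One
  factor \<open>p\<close> comes from the order \<open>p e\<close>, the other from the ramification
  of \<open>x\<close> at infinity. The bound falls below q+1 as soon as r is at least p^3, and this
  is the origin of the condition l > 2. The passage to p-th roots stays with the same equation
  because c^p = c.\<close>

definition rhom :: "('a::comm_ring_1 \<Rightarrow> 'b::comm_ring_1) \<Rightarrow> bool" where
  "rhom h \<longleftrightarrow> h 0 = 0 \<and> h 1 = 1 \<and> (\<forall>a b. h (a + b) = h a + h b) \<and> (\<forall>a b. h (a * b) = h a * h b)"

lemma rhomD:
  assumes "rhom h"
  shows "h 0 = 0" "h 1 = 1" "h (a + b) = h a + h b" "h (a * b) = h a * h b"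
    "h (- a) = - h a" "h (a - b) = h a - h b" "h (a ^ n) = h a ^ n"
proof -
  show 1: "h 0 = 0" "h 1 = 1" "\<And>a b. h (a + b) = h a + h b" "\<And>a b. h (a * b) = h a * h b"
    using assms by (auto simp: rhom_def)
  have m: "h (- a) = - h a" for a
    using 1(3)[of a "- a"] 1(1) by (simp add: eq_neg_iff_add_eq_0 add.commute)
  show "h (- a) = - h a" by (rule m)
  show "h (a - b) = h a - h b" using 1(3)[of a "- b"] m by simp
  show "h (a ^ n) = h a ^ n" by (induction n) (simp_all add: 1)
qed

lemma rhom_prod: "rhom h \<Longrightarrow> h (\<Prod>i\<in>I. f i) = (\<Prod>i\<in>I. h (f i))"
  by (induction I rule: infinite_finite_induct) (simp_all add: rhomD)

lemma rhom_sum: "rhom h \<Longrightarrow> h (\<Sum>i\<in>I. f i) = (\<Sum>i\<in>I. h (f i))"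
  by (induction I rule: infinite_finite_induct) (simp_all add: rhomD)

lemma rhom_dvd: "rhom h \<Longrightarrow> a dvd b \<Longrightarrow> h a dvd h b"
  by (auto simp: dvd_def rhomD)

text \<open>Allowing any coefficient homomorphism lets evaluation be iterated: K[x, y] is evaluated
  at a pair by taking evaluation in \<open>x\<close> as the homomorphism on the
  coefficients.\<close>

definition hev :: "('a::comm_ring_1 \<Rightarrow> 'b::comm_ring_1) \<Rightarrow> 'b \<Rightarrow> 'a poly \<Rightarrow> 'b" where
  "hev h x A = poly (map_poly h A) x"

lemma hev_0 [simp]: "hev h x 0 = 0"
  by (simp add: hev_def)

lemma hev_pCons: "rhom h \<Longrightarrow> hev h x (pCons a A) = h a + x * hev h x A"
  by (cases "a = 0 \<and> A = 0") (auto simp: hev_def map_poly_pCons rhomD)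

lemma hev_add: "rhom h \<Longrightarrow> hev h x (A + B) = hev h x A + hev h x B"
  by (induction A B rule: poly_induct2) (simp_all add: hev_pCons rhomD algebra_simps)

lemma hev_smult: "rhom h \<Longrightarrow> hev h x (smult a A) = h a * hev h x A"
  by (induction A) (simp_all add: hev_pCons rhomD algebra_simps)

lemma hev_mult: "rhom h \<Longrightarrow> hev h x (A * B) = hev h x A * hev h x B"
  by (induction A) (simp_all add: hev_pCons hev_add hev_smult rhomD algebra_simps)

lemma rhom_hev: "rhom h \<Longrightarrow> rhom (hev h x)"
  unfolding rhom_def[of "hev h x"]
  by (simp add: hev_add hev_mult one_pCons hev_pCons rhomD)

lemma hev_const [simp]: "rhom h \<Longrightarrow> hev h x [:a:] = h a"
  by (simp add: hev_pCons)

lemma hev_monom: "rhom h \<Longrightarrow> hev h x (monom a n) = h a * x ^ n"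
  by (induction n) (simp_all add: monom_0 monom_Suc hev_pCons rhomD)

lemma hev_pcompose: "rhom h \<Longrightarrow> hev h x (pcompose A B) = hev h (hev h x B) A"
  by (induction A) (simp_all add: pcompose_pCons hev_pCons hev_add hev_mult rhomD)

lemma rhom_poly: "rhom (\<lambda>A. poly A a)"
  by (simp add: rhom_def)

lemma rhom_fls_const: "rhom fls_const"
  by (simp add: rhom_def fls_plus_const)

section \<open>Polynomials over algebraically closed fields\<close>

text \<open>The induction strips a common linear factor from \<open>A\<close> and \<open>B\<close>.
  The lemma turns local estimates of zeros into a divisibility, hence into a bound on
  degrees.\<close>

lemma dvd_if_order_le:
  fixes A B :: "'k::alg_closed_field poly"
  assumes "A \<noteq> 0" "B \<noteq> 0" "\<And>a. poly B a = 0 \<Longrightarrow> order a B \<le> order a A"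
  shows "B dvd A"
  using assms
proof (induction "degree B" arbitrary: A B)
  case 0
  then show ?case by (metis degree_eq_zeroE is_unit_pCons_iff pCons_0_0 unit_imp_dvd dvd_field_iff)
next
  case (Suc n)
  then obtain a where a: "poly B a = 0"
    using alg_closed_imp_poly_has_root[of B] by auto
  then obtain B' where B': "B = [:-a, 1:] * B'" by (auto simp: poly_eq_0_iff_dvd)
  have ordB: "order b B = order b [:-a, 1:] + order b B'" for b
    unfolding B' by (rule order_mult) (use Suc.prems B' in metis)
  have la: "order a [:-a, 1:] = 1" using order_power_n_n[of a 1] by simp
  have "order a A \<ge> 1"
    using Suc.prems(3)[OF a] ordB[of a] la by simp
  then have "poly A a = 0" by (metis One_nat_def Suc.prems(1) not_one_le_zero order_0I)
  then obtain A' where A': "A = [:-a, 1:] * A'" by (auto simp: poly_eq_0_iff_dvd)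
  have ordA: "order b A = order b [:-a, 1:] + order b A'" for b
    unfolding A' by (rule order_mult) (use Suc.prems A' in metis)
  have "B' \<noteq> 0" "A' \<noteq> 0" using Suc.prems A' B' by auto
  have "degree B = 1 + degree B'" unfolding B' using \<open>B' \<noteq> 0\<close> by (subst degree_mult_eq) auto
  have "B' dvd A'"
  proof (rule Suc.hyps(1))
    show "n = degree B'" using \<open>degree B = 1 + degree B'\<close> Suc.hyps(2) by simp
    fix b assume "poly B' b = 0"
    then show "order b B' \<le> order b A'"
      using Suc.prems(3)[of b] ordA[of b] ordB[of b] by (simp add: B')
  qed fact+
  then show ?case unfolding A' B' by (rule mult_dvd_mono[OF dvd_refl])
qed

text \<open>The derivative of \<open>X^p + c X - s\<close> is the nonzero constant \<open>c\<close>,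
  so the \<open>p\<close> roots are distinct. Hence exactly \<open>p\<close> points of the curve lie
  above each affine value of \<open>x\<close>.\<close>

lemma artin_schreier_roots:
  fixes c s :: "'k::alg_closed_field"
  assumes p: "prime p" "CHAR('k) = p" and c: "c \<noteq> 0"
  shows "finite {b. b ^ p + c * b = s}" "card {b. b ^ p + c * b = s} = p"
proof -
  define P where "P = monom 1 p + [:-s, c:]"
  have p2: "p \<ge> 2" using p prime_ge_2_nat by blast
  have degP: "degree P = p"
    unfolding P_def using p2 by (subst degree_add_eq_left) (auto simp: degree_monom_eq)
  then have P0: "P \<noteq> 0" using p2 by auto
  have lP: "lead_coeff P = 1"
    unfolding degP using p2 by (auto simp: P_def coeff_pCons split: nat.splits)
  have dP: "pderiv P = [:c:]"
    using p by (simp add: P_def pderiv_add pderiv_monom pderiv_pCons of_nat_eq_0_iff_char_dvd)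
  have roots: "{b. b ^ p + c * b = s} = {b. poly P b = 0}"
    by (auto simp: P_def poly_monom algebra_simps eq_neg_iff_add_eq_0)
  show "finite {b. b ^ p + c * b = s}" unfolding roots using P0 by (rule poly_roots_finite)
  obtain A where A: "size A = degree P" "P = smult (lead_coeff P) (\<Prod>x\<in>#A. [:-x, 1:])"
    using alg_closed_imp_factorization[OF P0] by blast
  then have PA: "P = (\<Prod>x\<in>#A. [:-x, 1:])" using lP by simp
  have "count A x \<le> 1" for x
  proof (rule ccontr)
    assume "\<not> count A x \<le> 1"
    then have "{#x, x#} \<subseteq># A" by (auto simp: subseteq_mset_def)
    then obtain A' where "A = {#x, x#} + A'" by (metis subset_mset.add_diff_inverse)
    then have "P = [:-x, 1:] * ([:-x, 1:] * (\<Prod>x\<in>#A'. [:-x, 1:]))" using PA by simp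
    then have "poly (pderiv P) x = 0" by (simp only: pderiv_mult poly_mult poly_add) simp
    then show False using c dP by simp
  qed
  then have "count A x = 1" if "x \<in># A" for x using that
    by (metis count_greater_eq_one_iff le_antisym)
  then have "size A = card (set_mset A)"
    by (simp add: size_multiset_overloaded_eq)
  moreover have "{b. poly P b = 0} = set_mset A"
    unfolding PA by (auto simp: poly_prod_mset prod_mset_zero_iff)
  ultimately show "card {b. b ^ p + c * b = s} = p" unfolding roots using A(1) degP by simp
qed

section \<open>Formal power series\<close>

text \<open>The iterates of 0 stabilise coefficient by coefficient. This does the work of Hensel's
  lemma in the construction of places.\<close>

lemma fps_contraction_fixpoint:
  fixes \<Phi> :: "'a::zero fps \<Rightarrow> 'a fps"
  assumes "\<And>n a b. (\<And>i. i < n \<Longrightarrow> fps_nth a i = fps_nth b i) \<Longrightarrow> fps_nth (\<Phi> a) n = fps_nth (\<Phi> b) n"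
  shows "\<exists>z. \<Phi> z = z"
proof -
  define w where "w n = (\<Phi> ^^ n) 0" for n
  have step: "fps_nth (w m) i = fps_nth (w (Suc i)) i" if "i < m" for m i
    using that
  proof (induction i arbitrary: m rule: less_induct)
    case (less i)
    then obtain m' where m: "m = Suc m'" by (cases m) auto
    have "fps_nth (\<Phi> (w m')) i = fps_nth (\<Phi> (w i)) i"
    proof (rule assms)
      fix j assume "j < i"
      then show "fps_nth (w m') j = fps_nth (w i) j"
        using less.IH[of j m'] less.IH[of j i] less.prems m by simp
    qed
    then show ?case by (simp add: w_def m)
  qed
  define z where "z = Abs_fps (\<lambda>n. fps_nth (w (Suc n)) n)"
  have "fps_nth (\<Phi> z) n = fps_nth z n" for n
  proof -
    have "fps_nth (\<Phi> z) n = fps_nth (\<Phi> (w n)) n"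
    proof (rule assms)
      fix i assume "i < n"
      then show "fps_nth z i = fps_nth (w n) i" using step[of i n] by (simp add: z_def)
    qed
    then show ?thesis by (simp add: z_def w_def)
  qed
  then show ?thesis by (auto intro: fps_ext)
qed

section \<open>Laurent series in prime characteristic\<close>

text \<open>
  The statement that the order of \<open>f\<close> is at least \<open>n\<close>; unlike \<^const>\<open>fls_subdegree\<close>, whose value
  at \<open>0\<close> is \<open>0\<close>, it treats \<open>0\<close> as having infinite order.
\<close>

definition vge :: "int \<Rightarrow> 'a::zero fls \<Rightarrow> bool" where
  "vge n f \<longleftrightarrow> (\<forall>k<n. fls_nth f k = 0)"

lemma vge_iff:
  assumes "f \<noteq> 0"
  shows "vge n f \<longleftrightarrow> n \<le> fls_subdegree f"
proof
  assume "vge n f"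
  then show "n \<le> fls_subdegree f"
    using nth_fls_subdegree_nonzero[OF assms] unfolding vge_def by (meson leI)
qed (auto simp: vge_def)

lemma vge_0 [simp]: "vge n 0"
  by (simp add: vge_def)

lemma vge_add: "vge n f \<Longrightarrow> vge n g \<Longrightarrow> vge n (f + g)"
  by (auto simp: vge_def)

lemma vge_mult:
  fixes f g :: "'a::field fls"
  assumes "vge m f" "vge n g"
  shows "vge (m + n) (f * g)"
proof (cases "f = 0 \<or> g = 0")
  case False
  then show ?thesis using assms by (simp add: vge_iff)
qed auto

lemma vge_fps [simp]: "vge 0 (fps_to_fls f)"
  by (simp add: vge_def)

lemma vge_deriv: "vge n f \<Longrightarrow> vge (n - 1) (fls_deriv f)"
  by (auto simp: vge_def)

lemma vge_deriv_0: "vge 0 f \<Longrightarrow> vge 0 (fls_deriv f)"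
  unfolding vge_def
proof (intro allI impI)
  fix k :: int assume "\<forall>k<0. fls_nth f k = 0" "k < 0"
  then show "fls_nth (fls_deriv f) k = 0" by (cases "k = -1") auto
qed

lemma fls_deriv_char_power [simp]:
  fixes f :: "'a::comm_ring_1 fls"
  assumes "CHAR('a) dvd n"
  shows "fls_deriv (f ^ n) = 0"
proof -
  have "(of_nat n :: 'a fls) = 0" using assms by (simp add: of_nat_eq_0_iff_char_dvd)
  then show ?thesis by (simp add: fls_deriv_power)
qed

lemma fls_artin_schreier_deriv:
  fixes u v :: "'a::field fls"
  assumes "CHAR('a) = p" "p dvd r" and uv: "v ^ p + fls_const c * v = u ^ (r + 1)"
  shows "fls_const c * fls_deriv v = u ^ r * fls_deriv u"
proof -
  have "fls_deriv (v ^ p + fls_const c * v) = fls_const c * fls_deriv v"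
    using assms(1) by simp
  moreover have "fls_deriv (u ^ (r + 1)) = u ^ r * fls_deriv u"
    using assms(1,2) by (simp add: mult.commute)
  ultimately show ?thesis by (metis uv)
qed

lemma fls_subdegree_power_field: "fls_subdegree (f ^ n) = int n * fls_subdegree (f :: 'a::field fls)"
proof (cases "f = 0")
  case False
  then show ?thesis by (induction n) (simp_all add: algebra_simps)
qed (simp add: power_0_left)

text \<open>At a pole \<open>v^p\<close> dominates \<open>c v\<close>, so \<open>p\<close> times the
  order of \<open>v\<close> is \<open>r + 1\<close> times that of \<open>u\<close>. As
  \<open>p\<close> and \<open>r + 1\<close> are coprime, this yields \<open>e\<close>. In
  \<open>c v' = u^r u'\<close> the large pole of \<open>u^r\<close> must then be offset by a zero of
  \<open>u'\<close>.\<close>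

lemma fls_artin_schreier_pole:
  fixes u v :: "'a::field fls"
  assumes p: "prime p" "CHAR('a) = p" "p dvd r" and c: "c \<noteq> 0"
    and uv: "v ^ p + fls_const c * v = u ^ (r + 1)" and pole: "fls_subdegree u < 0"
  obtains e :: int where "e > 0" "fls_subdegree u = - (int p * e)"
    "fls_subdegree v = - ((int r + 1) * e)" 
    "fls_deriv u \<noteq> 0 \<Longrightarrow> fls_subdegree (fls_deriv u) \<ge> e * (int r * int p - int r - 1) - 1"
proof -
  have p2: "p \<ge> 2" using p prime_ge_2_nat by blast
  have u0: "u \<noteq> 0" using pole by auto
  have sdu: "fls_subdegree (u ^ (r + 1)) = (int r + 1) * fls_subdegree u"
    by (simp add: fls_subdegree_power_field algebra_simps u0)
  have neg: "(int r + 1) * fls_subdegree u < 0" using pole by (simp add: mult_pos_neg)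
  have v0: "v \<noteq> 0"
  proof
    assume "v = 0"
    then have "u ^ (r + 1) = 0" using uv p2 by (simp add: power_0_left)
    then show False using u0 by simp
  qed
  have sdcv: "fls_subdegree (fls_const c * v) = fls_subdegree v"
    using c v0 by (simp add: fls_subdegree_mult)
  have sdvp: "fls_subdegree (v ^ p) = int p * fls_subdegree v"
    by (simp add: fls_subdegree_power_field)
  have vneg: "fls_subdegree v < 0"
  proof (rule ccontr)
    assume "\<not> fls_subdegree v < 0"
    then have "vge 0 (v ^ p)" "vge 0 (fls_const c * v)"
      using v0 c sdcv sdvp by (simp_all add: vge_iff)
    then have "vge 0 (u ^ (r + 1))" using vge_add uv by metis
    then show False using sdu neg u0 by (subst (asm) vge_iff) auto
  qed
  have "fls_subdegree (v ^ p) < fls_subdegree (fls_const c * v)"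
  proof -
    have "(int p - 1) * fls_subdegree v < 0" using vneg p2 by (simp add: mult_pos_neg)
    then show ?thesis unfolding sdcv sdvp by (simp add: algebra_simps)
  qed
  then have "fls_subdegree (v ^ p + fls_const c * v) = int p * fls_subdegree v"
    using fls_subdegree_add_eq1[of "v ^ p"] v0 sdvp by simp
  then have eq: "int p * fls_subdegree v = (int r + 1) * fls_subdegree u"
    using uv sdu by simp
  have "\<not> p dvd r + 1"
  proof
    assume "p dvd r + 1"
    then have "p dvd 1" using p(3) by (simp only: dvd_add_right_iff)
    then show False using p2 by simp
  qed
  then have "coprime p (r + 1)" using p(1) by (rule prime_imp_coprime[rotated])
  then have "coprime (int p) (int r + 1)" by (metis coprime_int_iff of_nat_1 of_nat_add)
  then have "int p dvd fls_subdegree u"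
    using eq by (metis coprime_dvd_mult_right_iff dvd_triv_left)
  then obtain k where k: "fls_subdegree u = int p * k" by (auto simp: dvd_def)
  have sdv: "fls_subdegree v = (int r + 1) * k" using eq k p2 by simp
  show ?thesis
  proof (rule that[of "- k"])
    show "- k > 0" using pole k p2 by (simp add: mult_less_0_iff)
    show "fls_subdegree u = - (int p * - k)" using k by simp
    show "fls_subdegree v = - ((int r + 1) * - k)" using sdv by simp
    assume du: "fls_deriv u \<noteq> 0"
    have d: "fls_const c * fls_deriv v = u ^ r * fls_deriv u"
      using fls_artin_schreier_deriv p uv by blast
    then have dv: "fls_deriv v \<noteq> 0" using du u0 by auto
    have "fls_subdegree (fls_deriv v) = int r * fls_subdegree u + fls_subdegree (fls_deriv u)"
      using arg_cong[OF d, of fls_subdegree] dv du u0 c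
      by (simp add: fls_subdegree_mult fls_subdegree_power_field)
    moreover have "fls_subdegree (fls_deriv v) \<ge> fls_subdegree v - 1"
      using vge_deriv[of "fls_subdegree v" v] dv v0 by (simp add: vge_iff)
    ultimately show "fls_subdegree (fls_deriv u) \<ge> - k * (int r * int p - int r - 1) - 1"
      using k sdv by (simp add: algebra_simps)
  qed
qed

lemma hev_comp: "rhom g \<Longrightarrow> rhom h \<Longrightarrow> g (hev h x A) = hev (\<lambda>a. g (h a)) (g x) A"
proof -
  assume "rhom g" "rhom h"
  then have "rhom (\<lambda>a. g (h a))" by (simp add: rhom_def)
  with \<open>rhom g\<close> \<open>rhom h\<close> show ?thesis
    by (induction A) (simp_all add: hev_pCons rhomD)
qed

lemma rhom_fps_to_fls: "rhom (fps_to_fls :: 'a::comm_ring_1 fps \<Rightarrow> 'a fls)"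
  by (simp add: rhom_def fls_times_fps_to_fls)

lemma rhom_fps_const: "rhom (fps_const :: 'a::comm_ring_1 \<Rightarrow> 'a fps)"
  by (simp add: rhom_def)

lemma rhom_fps_nth_0: "rhom (\<lambda>f :: 'a::comm_ring_1 fps. fps_nth f 0)"
  by (simp add: rhom_def)

lemma fps_X_power_dvd_iff_nth:
  "fps_X ^ n dvd (f :: 'a::field fps) \<longleftrightarrow> (\<forall>i<n. fps_nth f i = 0)"
proof
  assume "fps_X ^ n dvd f"
  then obtain g where "f = fps_X ^ n * g" by (auto simp: dvd_def)
  then show "\<forall>i<n. fps_nth f i = 0" by (simp add: fps_X_power_mult_nth)
next
  assume "\<forall>i<n. fps_nth f i = 0"
  then have "f = fps_X ^ n * fps_shift n f"
    by (intro fps_ext) (auto simp: fps_X_power_mult_nth)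
  then show "fps_X ^ n dvd f" by (metis dvd_triv_left)
qed

section \<open>Places of an Artin--Schreier curve\<close>

text \<open>
  Elements of \<open>K[x, y]\<close> are of type \<^typ>\<open>'k poly poly\<close> with \<open>y\<close> the outer variable.  A place of
  the curve \<open>y^p + c y = x^(q+1)\<close> is given by a point of the curve with coordinates in \<open>K((t))\<close>,
  and the order of a polynomial there is the order of its value at that point.
\<close>

definition pl :: "'k::field fls \<Rightarrow> 'k fls \<Rightarrow> 'k poly poly \<Rightarrow> 'k fls" where
  "pl x y F = hev (hev fls_const x) y F"

lemma rhom_pl: "rhom (pl x y)"
  unfolding pl_def by (intro rhom_hev rhom_fls_const)

lemmas pl_simps = rhomD[OF rhom_pl]

lemma pl_pCons: "pl x y (pCons A F) = hev fls_const x A + y * pl x y F"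
  by (simp add: pl_def hev_pCons rhom_hev rhom_fls_const)

lemma pl_const [simp]: "pl x y [:A:] = hev fls_const x A"
  by (simp add: pl_pCons pl_simps)

lemma pl_smult: "pl x y (smult A F) = hev fls_const x A * pl x y F"
  by (simp add: pl_def hev_smult rhom_hev rhom_fls_const)

lemma pl_monom: "pl x y (monom A n) = hev fls_const x A * y ^ n"
  by (simp add: pl_def hev_monom rhom_hev rhom_fls_const)

lemma pl_pcompose: "pl x y (pcompose F G) = pl x (pl x y G) F"
  by (simp add: pl_def hev_pcompose rhom_hev rhom_fls_const)

text \<open>At a pole of \<open>x\<close> the leading term dominates all others.\<close>

lemma fls_subdegree_hev:
  assumes "fls_subdegree x < 0" "A \<noteq> 0"
  shows "hev fls_const x A \<noteq> (0 :: 'k::field fls) \<and>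
    fls_subdegree (hev fls_const x A) = int (degree A) * fls_subdegree x"
  using assms(2)
proof (induction A)
  case (pCons a A)
  have x0: "x \<noteq> 0" using assms(1) by auto
  show ?case
  proof (cases "A = 0")
    case True
    then show ?thesis using pCons by (simp add: hev_pCons rhom_fls_const)
  next
    case False
    with pCons have IH: "hev fls_const x A \<noteq> 0"
      "fls_subdegree (hev fls_const x A) = int (degree A) * fls_subdegree x" by auto
    have s: "fls_subdegree (x * hev fls_const x A) = (int (degree A) + 1) * fls_subdegree x"
      using IH x0 by (simp add: algebra_simps)
    have neg: "(int (degree A) + 1) * fls_subdegree x < 0"
      using assms(1) by (simp add: mult_pos_neg)
    have "fls_subdegree (fls_const a + x * hev fls_const x A) = fls_subdegree (x * hev fls_const x A)"
      by (rule fls_subdegree_add_eq2) (use IH x0 s neg in auto)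
    then show ?thesis using False s neg
      by (auto simp: hev_pCons rhom_fls_const algebra_simps)
  qed
qed simp

lemma fls_deriv_hev:
  "fls_deriv (hev fls_const x A) = hev fls_const x (pderiv A) * fls_deriv (x :: 'k::field fls)"
  by (induction A) (simp_all add: hev_pCons hev_add rhom_fls_const pderiv_pCons algebra_simps)

text \<open>Splitting off the full power of \<open>X - a\<close> leaves a cofactor with nonzero
  constant term in \<open>t\<close>.\<close>

lemma hev_pole_at:
  fixes B :: "'k::field poly"
  assumes "B \<noteq> 0"
  shows "hev fls_const (fls_const a + fls_X) B \<noteq> 0"
    "fls_subdegree (hev fls_const (fls_const a + fls_X) B) = int (order a B)"
proof -
  let ?h = "hev fls_const (fls_const a + fls_X) :: 'k poly \<Rightarrow> 'k fls"
  have rh: "rhom ?h" by (rule rhom_hev[OF rhom_fls_const])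
  obtain C where C: "B = [:-a, 1:] ^ order a B * C" "\<not> [:-a, 1:] dvd C"
    using order_decomp[OF assms] by blast
  have hX: "?h [:-a, 1:] = fls_X" by (simp add: hev_pCons rhom_fls_const)
  have Ca: "poly C a \<noteq> 0" using C(2) by (simp add: poly_eq_0_iff_dvd)
  have "?h C = fps_to_fls (hev fps_const (fps_const a + fps_X) C)"
    using hev_comp[OF rhom_fps_to_fls rhom_fps_const, of "fps_const a + fps_X" C] by simp
  moreover have "fps_nth (hev fps_const (fps_const a + fps_X) C) 0 = poly C a"
    using hev_comp[OF rhom_fps_nth_0 rhom_fps_const, of "fps_const a + fps_X" C]
    by (simp add: hev_def)
  ultimately have C0: "fls_nth (?h C) 0 \<noteq> 0" "vge 0 (?h C)" using Ca by simp_all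
  then have sC: "fls_subdegree (?h C) = 0" by (intro fls_subdegree_eqI) (auto simp: vge_def)
  have hC: "?h C \<noteq> 0" using C0 by auto
  have B: "?h B = fls_X ^ order a B * ?h C"
    by (subst C(1)) (simp add: rhomD[OF rh] hX del: power_Suc)
  show "?h B \<noteq> 0" using B hC by simp
  show "fls_subdegree (?h B) = int (order a B)" unfolding B using hC sC by simp
qed

text \<open>
  The derivation of \<open>K[x, y]\<close> with \<open>x' = 1\<close> and \<open>y' = g\<close>; on the curve \<open>g = x^q / c\<close>.
\<close>

definition xyderiv :: "'k::field poly \<Rightarrow> 'k poly poly \<Rightarrow> 'k poly poly" where
  "xyderiv g F = map_poly pderiv F + smult g (pderiv F)"

lemma fls_deriv_pl:
  assumes y: "fls_deriv y = hev fls_const x g * fls_deriv x"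
  shows "fls_deriv (pl x y F) = pl x y (xyderiv g F) * fls_deriv x"
proof (induction F)
  case 0
  then show ?case by (simp add: xyderiv_def pl_simps)
next
  case (pCons A F)
  have "xyderiv g (pCons A F) = [:pderiv A:] + pCons 0 (xyderiv g F) + smult g F"
    by (cases "pderiv A = 0 \<and> map_poly pderiv F = 0")
      (auto simp: xyderiv_def pderiv_pCons map_poly_pCons smult_add_right)
  then show ?case
    by (simp add: pl_pCons pl_simps pl_smult fls_deriv_hev pCons.IH y algebra_simps)
qed

lemma degree_lessI:
  assumes "n > 0" "\<And>i. i \<ge> n \<Longrightarrow> coeff F i = 0"
  shows "degree F < n"
proof (cases "F = 0")
  case False
  then show ?thesis using assms(2)[of "degree F"] by (meson leading_coeff_0_iff not_le)
qed (use assms in simp)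

text \<open>Since \<open>g\<close> is free of \<open>y\<close>, the derivation does not raise the
  \<open>y\<close>-degree, so reduced representatives stay reduced.\<close>

lemma degree_xyderiv:
  assumes "degree F < n"
  shows "degree (xyderiv g F) < n"
  unfolding xyderiv_def
proof (rule degree_lessI)
  fix i assume "i \<ge> n"
  then have "coeff F i = 0" "coeff F (Suc i) = 0" using assms by (auto intro: coeff_eq_0)
  then show "coeff (map_poly pderiv F + smult g (pderiv F)) i = 0"
    by (simp add: coeff_map_poly coeff_pderiv)
qed (use assms in simp)

text \<open>The condition \<open>cp\<close> makes p-th roots of a solution solve the same equation.
  The condition \<open>m2\<close> makes \<open>q - q/p\<close> divisible by \<open>p\<close>, which
  controls dx at infinity.\<close>

locale AS_curve =
  fixes p q :: nat and c :: "'k::alg_closed_field" and m :: nat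
  assumes prime_p: "prime p" and char_p: "CHAR('k) = p"
    and c_nz: "c \<noteq> 0" and cp: "c ^ p = c" and q: "q = p ^ m" and m2: "m \<ge> 2"
begin

lemma p2: "p \<ge> 2" using prime_p prime_ge_2_nat by blast

lemma p_dvd_q: "p dvd q" using q m2 by (cases m) auto

definition place :: "'k fls \<Rightarrow> 'k fls \<Rightarrow> bool" where
  "place x y \<longleftrightarrow> y ^ p + fls_const c * y = x ^ (q + 1)"

definition eqn :: "'k poly poly" where
  "eqn = monom 1 p + [:- monom 1 (q + 1), [:c:]:]"

lemma pl_eqn: "place x y \<Longrightarrow> pl x y eqn = 0"
proof -
  assume "place x y"
  moreover have "pl x y eqn = y ^ p + fls_const c * y - x ^ (q + 1)"
    by (simp add: eqn_def pl_simps pl_monom pl_pCons hev_monom rhom_fls_const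
      rhomD[OF rhom_hev[OF rhom_fls_const]])
  ultimately show ?thesis by (simp add: place_def)
qed

lemma coeff_eqn: "coeff eqn p = 1" "i > p \<Longrightarrow> coeff eqn i = 0"
  using p2 by (auto simp: eqn_def coeff_pCons split: nat.splits)

text \<open>Division with remainder by \<open>eqn\<close>, which is monic in \<open>y\<close>;
  multiplying a remainder by \<open>y\<close> creates at most one term to cancel.\<close>

lemma ex_reduced: "\<exists>a. degree a < p \<and> eqn dvd F - a"
proof (induction F)
  case 0
  show ?case using p2 by (intro exI[of _ 0]) auto
next
  case (pCons A F)
  then obtain a where a: "degree a < p" "eqn dvd F - a" by blast
  let ?a = "pCons A a - smult (coeff (pCons A a) p) eqn"
  have "coeff ?a i = 0" if "i \<ge> p" for i
  proof (cases "i = p")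
    case False
    then have "coeff (pCons A a) i = 0"
      using a(1) that by (intro coeff_eq_0) (auto intro: le_less_trans[OF degree_pCons_le])
    then show ?thesis using False that coeff_eqn by simp
  qed (simp add: coeff_eqn)
  then have "degree ?a < p" using degree_lessI[OF prime_gt_0_nat[OF prime_p], of ?a] by blast
  moreover have "pCons A F - ?a = pCons 0 (F - a) + smult (coeff (pCons A a) p) eqn"
    by simp
  moreover have "eqn dvd pCons 0 (F - a)"
  proof -
    have "pCons 0 (F - a) = [:0, 1:] * (F - a)" by simp
    then show ?thesis using a(2) by (metis dvd_mult)
  qed
  ultimately have "eqn dvd pCons A F - ?a"
    by (simp only: dvd_add dvd_smult dvd_refl)
  with \<open>degree ?a < p\<close> show ?case by blast
qed

lemma place_deriv:
  assumes "place x y"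
  shows "fls_deriv y = hev fls_const x (monom (1 / c) q) * fls_deriv x"
proof -
  have "fls_const c * fls_deriv y = x ^ q * fls_deriv x"
    by (rule fls_artin_schreier_deriv) (use assms char_p p_dvd_q in \<open>auto simp: place_def\<close>)
  then have "(fls_const (1 / c) * fls_const c) * fls_deriv y = fls_const (1 / c) * x ^ q * fls_deriv x"
    by (simp only: mult.assoc)
  then show ?thesis using c_nz by (simp add: hev_monom rhom_fls_const)
qed

definition D :: "'k poly poly \<Rightarrow> 'k poly poly" where
  "D = xyderiv (monom (1 / c) q)"

lemma deriv_pl: "place x y \<Longrightarrow> fls_deriv (pl x y F) = pl x y (D F) * fls_deriv x"
  unfolding D_def by (intro fls_deriv_pl place_deriv)

lemma degree_D: "degree F < p \<Longrightarrow> degree (D F) < p"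
  unfolding D_def by (rule degree_xyderiv)

definition pt :: "'k \<Rightarrow> 'k \<Rightarrow> 'k poly poly \<Rightarrow> 'k" where
  "pt a b F = hev (\<lambda>A. poly A a) b F"

text \<open>An affine point with its expansion. The derivative of the equation in \<open>y\<close>
  is the nonzero constant \<open>c\<close>, so \<open>x - a\<close> is a uniformizer at every affine
  point.\<close>

definition local_at :: "'k \<Rightarrow> 'k \<Rightarrow> 'k fls \<Rightarrow> 'k fls \<Rightarrow> bool" where
  "local_at a b x y \<longleftrightarrow> place x y \<and> x = fls_const a + fls_X \<and>
     (\<forall>F. vge 0 (pl x y F) \<and> fls_nth (pl x y F) 0 = pt a b F)"

text \<open>
  Writing \<open>x = a + t\<close> and \<open>y = b + t s\<close>, the equation says
  \<open>c s = ((a + t)^(q+1) - a^(q+1)) / t - t^(p-1) s^p\<close>, which is contracting in \<open>s\<close>.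
\<close>

lemma ex_local_at:
  assumes ab: "b ^ p + c * b = a ^ (q + 1)"
  shows "\<exists>x y. local_at a b x y"
proof -
  define x0 where "x0 = fps_const a + fps_X"
  define F where "F = x0 ^ (q + 1) - fps_const (a ^ (q + 1))"
  define F1 where "F1 = fps_shift 1 F"
  have "fps_nth F 0 = 0" by (simp add: F_def x0_def fps_nth_power_0)
  then have F1: "F = fps_X * F1" unfolding F1_def
    by (intro fps_ext) (auto simp: fps_X_mult_nth)
  have "\<exists>\<sigma>. fps_const (1 / c) * (F1 - fps_X ^ (p - 1) * \<sigma> ^ p) = \<sigma>"
  proof (rule fps_contraction_fixpoint)
    fix n :: nat and s t :: "'k fps"
    assume "\<And>i. i < n \<Longrightarrow> fps_nth s i = fps_nth t i"
    then have "fps_X ^ n dvd t - s" by (simp add: fps_X_power_dvd_iff_nth)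
    then have 1: "fps_X ^ n dvd t ^ p - s ^ p"
      by (rule dvd_trans) (metis power_diff_sumr2 dvd_triv_left)
    have 2: "fps_X ^ 1 dvd (fps_X :: 'k fps) ^ (p - 1)" by (rule le_imp_power_dvd) (use p2 in simp)
    have "fps_X ^ (1 + n) dvd fps_X ^ (p - 1) * (t ^ p - s ^ p)"
      unfolding power_add using 2 1 by (rule mult_dvd_mono)
    then have "fps_X ^ (1 + n) dvd fps_const (1 / c) * (fps_X ^ (p - 1) * (t ^ p - s ^ p))"
      by (rule dvd_mult)
    moreover have "fps_const (1 / c) * (fps_X ^ (p - 1) * (t ^ p - s ^ p)) =
      fps_const (1 / c) * (F1 - fps_X ^ (p - 1) * s ^ p) - fps_const (1 / c) * (F1 - fps_X ^ (p - 1) * t ^ p)"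
      by (simp add: algebra_simps)
    ultimately have "fps_X ^ (1 + n) dvd
      fps_const (1 / c) * (F1 - fps_X ^ (p - 1) * s ^ p) - fps_const (1 / c) * (F1 - fps_X ^ (p - 1) * t ^ p)"
      by (simp only:)
    then have "fps_nth (fps_const (1 / c) * (F1 - fps_X ^ (p - 1) * s ^ p)
      - fps_const (1 / c) * (F1 - fps_X ^ (p - 1) * t ^ p)) n = 0"
      unfolding fps_X_power_dvd_iff_nth by (rule allE[of _ n]) linarith
    then show "fps_nth (fps_const (1 / c) * (F1 - fps_X ^ (p - 1) * s ^ p)) n =
      fps_nth (fps_const (1 / c) * (F1 - fps_X ^ (p - 1) * t ^ p)) n"
      by (simp only: fps_sub_nth right_minus_eq)
  qed
  then obtain \<sigma> where \<sigma>: "fps_const (1 / c) * (F1 - fps_X ^ (p - 1) * \<sigma> ^ p) = \<sigma>" by blast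
  have "fps_const c * \<sigma> = (fps_const c * fps_const (1 / c)) * (F1 - fps_X ^ (p - 1) * \<sigma> ^ p)"
    using \<sigma> by (metis mult.assoc)
  then have \<sigma>': "fps_const c * \<sigma> = F1 - fps_X ^ (p - 1) * \<sigma> ^ p"
    using c_nz by simp
  define y0 where "y0 = fps_const b + fps_X * \<sigma>"
  have XX: "fps_X * fps_X ^ (p - 1) = (fps_X :: 'k fps) ^ p"
    using p2 by (metis power_eq_if not_numeral_le_zero)
  have "y0 ^ p = fps_const (b ^ p) + fps_X ^ p * \<sigma> ^ p"
  proof -
    have "y0 ^ p = fps_const b ^ p + (fps_X * \<sigma>) ^ p"
      unfolding y0_def by (rule freshmans_dream) (use prime_p char_p in simp_all)
    then show ?thesis by (simp add: power_mult_distrib)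
  qed
  moreover have "fps_const c * y0 = fps_const (c * b) + fps_X * (fps_const c * \<sigma>)"
    by (simp add: y0_def algebra_simps)
  moreover have "fps_X * (fps_const c * \<sigma>) = F - fps_X ^ p * \<sigma> ^ p"
    unfolding \<sigma>' F1 XX[symmetric] by (simp add: algebra_simps)
  ultimately have "y0 ^ p + fps_const c * y0 = fps_const (b ^ p + c * b) + F"
    by (simp flip: fps_const_add)
  then have eq0: "y0 ^ p + fps_const c * y0 = x0 ^ (q + 1)" by (simp add: F_def ab)
  define x y where "x = fps_to_fls x0" and "y = fps_to_fls y0"
  have "place x y"
    unfolding place_def x_def y_def
    using arg_cong[OF eq0, of fps_to_fls]
    by (simp add: rhomD[OF rhom_fps_to_fls] del: power_Suc)
  moreover have "pl x y G = fps_to_fls (hev (hev fps_const x0) y0 G)" for G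
  proof -
    have "(\<lambda>A. fps_to_fls (hev fps_const x0 A)) = hev fls_const x"
      using hev_comp[OF rhom_fps_to_fls rhom_fps_const, of x0] by (auto simp: x_def)
    then show ?thesis
      using hev_comp[OF rhom_fps_to_fls rhom_hev[OF rhom_fps_const], of x0 y0 G]
      by (simp add: pl_def y_def)
  qed
  moreover have "fps_nth (hev (hev fps_const x0) y0 G) 0 = pt a b G" for G
  proof -
    have "(\<lambda>A. fps_nth (hev fps_const x0 A) 0) = (\<lambda>A. poly A a)"
      using hev_comp[OF rhom_fps_nth_0 rhom_fps_const, of x0] by (auto simp: hev_def x0_def)
    then show ?thesis
      using hev_comp[OF rhom_fps_nth_0 rhom_hev[OF rhom_fps_const], of x0 y0 G]
      by (simp add: pt_def y0_def)
  qed
  moreover have "x = fls_const a + fls_X" by (simp add: x_def x0_def)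
  ultimately show ?thesis unfolding local_at_def by (intro exI[of _ x] exI[of _ y]) simp
qed

text \<open>
  At infinity \<open>s = x^(q/p) / y\<close> is a uniformizer.  Substituting \<open>y = x^(q/p) / s\<close> in the equation and
  dividing by \<open>x^q\<close> gives \<open>x = s^(-p) + c s^(-1) x^(-K)\<close> with \<open>K = q - q/p\<close>; this is contracting
  for \<open>\<zeta> = 1 / (s^p x)\<close>.
\<close>

lemma ex_infinite_place:
  "\<exists>x y. place x y \<and> fls_subdegree x = - int p \<and> fls_subdegree y = - int (q + 1) \<and>
     fls_deriv x \<noteq> 0 \<and> fls_subdegree (fls_deriv x) = int q * (int p - 1) - 2"
proof -
  define q' where "q' = p ^ (m - 1)"
  have qq': "q = q' * p" using m2 by (simp add: q q'_def flip: power_Suc2)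
  have p_q': "p dvd q'" using m2 by (auto simp: q'_def intro: dvd_power)
  define K where "K = q - q'"
  have "q' > 0" using p2 by (simp add: q'_def)
  have K: "q = q' + K" "p dvd K"
    using qq' p_q' p2 by (auto simp: K_def intro: dvd_diff_nat)
  \<comment> \<open>Substituting \<open>x = 1 / (s^p \<zeta>)\<close> and multiplying by
    \<open>s^p\<close> gives \<open>1 / \<zeta> = 1 + c s^(p-1) (s^p \<zeta>)^K\<close>;
    \<open>M\<close> collects the powers of \<open>s\<close>.\<close>
  define M where "M = p - 1 + p * K"
  have "\<exists>\<zeta> :: 'k fps. inverse (1 + fps_const c * fps_X ^ M * \<zeta> ^ K) = \<zeta>"
  proof (rule fps_contraction_fixpoint)
    fix n :: nat and s t :: "'k fps"
    let ?U = "\<lambda>s. 1 + fps_const c * fps_X ^ M * s ^ K"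
    have U0: "fps_nth (?U s) 0 \<noteq> 0" for s
      using p2 by (simp add: M_def)
    assume "\<And>i. i < n \<Longrightarrow> fps_nth s i = fps_nth t i"
    then have "fps_X ^ n dvd t - s" by (simp add: fps_X_power_dvd_iff_nth)
    then have 1: "fps_X ^ n dvd t ^ K - s ^ K"
      by (rule dvd_trans) (metis power_diff_sumr2 dvd_triv_left)
    have 2: "fps_X ^ 1 dvd (fps_X :: 'k fps) ^ M"
      by (rule le_imp_power_dvd) (use p2 in \<open>simp add: M_def\<close>)
    have "fps_X ^ (1 + n) dvd fps_X ^ M * (t ^ K - s ^ K)"
      unfolding power_add using 2 1 by (rule mult_dvd_mono)
    then have "fps_X ^ (1 + n) dvd (fps_const c * inverse (?U s) * inverse (?U t)) * (fps_X ^ M * (t ^ K - s ^ K))"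
      by (rule dvd_mult)
    moreover have "(fps_const c * inverse (?U s) * inverse (?U t)) * (fps_X ^ M * (t ^ K - s ^ K)) =
      inverse (?U s) * inverse (?U t) * (?U t - ?U s)"
      by (simp add: algebra_simps)
    moreover have "\<dots> = inverse (?U s) * (inverse (?U t) * ?U t) - (inverse (?U s) * ?U s) * inverse (?U t)"
      by (simp only: algebra_simps)
    moreover have "\<dots> = inverse (?U s) - inverse (?U t)"
      by (simp only: inverse_mult_eq_1[OF U0] mult_1_left mult_1_right)
    ultimately have "fps_X ^ (1 + n) dvd inverse (?U s) - inverse (?U t)" by (simp only:)
    then show "fps_nth (inverse (?U s)) n = fps_nth (inverse (?U t)) n"
      unfolding fps_X_power_dvd_iff_nth by (auto dest: spec[of _ n])
  qed
  then obtain \<zeta> :: "'k fps" where \<zeta>: "inverse (1 + fps_const c * fps_X ^ M * \<zeta> ^ K) = \<zeta>" by blast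
  have "fps_nth (1 + fps_const c * fps_X ^ M * \<zeta> ^ K) 0 = 1" using p2 by (simp add: M_def)
  moreover define U where "U = 1 + fps_const c * fps_X ^ M * \<zeta> ^ K"
  ultimately have U0: "fps_nth U 0 = 1" by simp
  then have "inverse U * U = 1" by (intro inverse_mult_eq_1) simp
  then have \<zeta>1: "\<zeta> * (1 + fps_const c * fps_X ^ M * \<zeta> ^ K) = 1"
    using \<zeta> unfolding U_def by simp
  have \<zeta>0: "fps_nth \<zeta> 0 = 1"
    using U0 arg_cong[OF \<zeta>, of "\<lambda>f. fps_nth f 0"] unfolding U_def[symmetric] by simp
  define w where "w = fps_to_fls \<zeta>"
  have w: "w * (1 + fls_const c * fls_X ^ M * w ^ K) = 1"
    using arg_cong[OF \<zeta>1, of fps_to_fls]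
    by (simp add: w_def rhomD[OF rhom_fps_to_fls])
  have w0: "w \<noteq> 0" using w by auto
  have sw: "fls_subdegree w = 0"
    unfolding w_def using \<zeta>0 by (intro fls_subdegree_eqI) auto
  define s where "s = (fls_X :: 'k fls)"
  have s0: "s \<noteq> 0" by (simp add: s_def)
  define Z where "Z = s ^ p * w"
  have Z0: "Z \<noteq> 0" using s0 w0 by (simp add: Z_def)
  have sZ: "fls_subdegree Z = int p" using s0 w0 sw by (simp add: Z_def s_def)
  define x where "x = inverse Z"
  have "inverse w = 1 + fls_const c * s ^ M * w ^ K"
    using w w0 by (simp add: inverse_unique s_def)
  then have x1: "x = inverse (s ^ p) * (1 + fls_const c * s ^ M * w ^ K)"
    by (simp add: x_def Z_def)
  have sM: "s * s ^ M = s ^ p * (s ^ p) ^ K"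
    using p2 unfolding M_def power_mult[symmetric] power_add[symmetric] power_Suc[symmetric]
    by (rule_tac arg_cong[of _ _ "power s"]) simp
  have sM': "inverse (s ^ p) * s ^ M = inverse s * (s ^ p) ^ K"
    using sM s0 by (simp add: field_simps)
  have x2: "x = inverse s ^ p + fls_const c * inverse s * Z ^ K"
  proof -
    have "x = inverse s ^ p + fls_const c * (inverse (s ^ p) * s ^ M) * w ^ K"
      by (simp add: x1 algebra_simps power_inverse)
    then show ?thesis unfolding sM' by (simp add: Z_def power_mult_distrib mult.assoc)
  qed
  have xZ: "x * Z = 1" using Z0 by (simp add: x_def)
  define y where "y = x ^ q' * inverse s"
  have "x ^ q * Z ^ K = x ^ q' * (x * Z) ^ K" by (subst K(1)) (simp add: power_add power_mult_distrib)
  then have xq: "x ^ q * Z ^ K = x ^ q'" using xZ by simp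
  have yp: "y ^ p = x ^ q * inverse s ^ p" by (simp add: y_def qq' power_mult power_mult_distrib)
  have "x ^ q * x = x ^ q * (inverse s ^ p + fls_const c * inverse s * Z ^ K)"
    by (rule arg_cong[OF x2])
  then have xq1: "x ^ (q + 1) = x ^ q * inverse s ^ p + fls_const c * inverse s * (x ^ q * Z ^ K)"
    by (simp add: algebra_simps)
  have "place x y" unfolding place_def xq1 yp xq unfolding y_def by (simp only: mult_ac)
  moreover have sx: "fls_subdegree x = - int p" using sZ Z0 by (simp add: x_def)
  moreover have "fls_subdegree y = - int (q + 1)"
  proof -
    have "x \<noteq> 0" using Z0 by (simp add: x_def)
    then have "fls_subdegree y = int q' * fls_subdegree x - 1"
      using s0 unfolding y_def by (simp add: fls_subdegree_power_field s_def)
    then show ?thesis by (simp add: sx qq')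
  qed
  \<comment> \<open>Both \<open>p\<close> and \<open>K\<close> vanish in the field, so only the
    factor \<open>1/s\<close> contributes to the derivative.\<close>
  moreover have dx: "fls_deriv x = - (fls_const c * inverse s ^ 2 * Z ^ K)"
  proof -
    have "inverse s = fls_X_inv" by (simp add: s_def fls_inverse_X)
    then have ds: "fls_deriv (inverse s) = - (inverse s ^ 2)" by (simp only: fls_deriv_X_inv)
    have d0: "fls_deriv (inverse s ^ p) = 0" "fls_deriv (Z ^ K) = 0"
      by (rule fls_deriv_char_power, simp add: char_p K(2))+
    have "fls_deriv x = fls_deriv (inverse s ^ p + fls_const c * inverse s * Z ^ K)"
      by (rule arg_cong[OF x2])
    also have "\<dots> = fls_const c * fls_deriv (inverse s) * Z ^ K"
      by (simp only: fls_deriv_add fls_deriv_mult d0 fls_deriv_const mult_zero_right mult_zero_left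
          add_0_left add_0_right)
    finally show ?thesis unfolding ds by simp
  qed
  moreover have "fls_subdegree (fls_deriv x) = int q * (int p - 1) - 2"
  proof -
    have "int p * int K = int q * (int p - 1)"
    proof -
      have "int p * int K = int p * int q - int p * int q'"
        unfolding right_diff_distrib[symmetric] using K(1) by simp
      moreover have "int p * int q' = int q" using qq' by simp
      ultimately show ?thesis by (simp only: right_diff_distrib mult.commute mult_1_right)
    qed
    moreover have "fls_subdegree (inverse s) = - 1" by (simp add: s_def)
    moreover have "fls_subdegree (fls_deriv x) = 2 * fls_subdegree (inverse s) + int K * fls_subdegree Z"
    proof -
      have n: "fls_const c \<noteq> 0" "inverse s ^ 2 \<noteq> 0" "Z ^ K \<noteq> 0" using s0 Z0 c_nz by simp_all
      then show ?thesis
        unfolding dx fls_uminus_subdegree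
        by (simp only: fls_subdegree_mult no_zero_divisors fls_subdegree_power_field fls_const_subdegree
            add_0_left of_nat_numeral not_False_eq_True)
    qed
    ultimately show ?thesis unfolding sZ mult.commute[of "int K" "int p"] by linarith
  qed
  moreover have "fls_deriv x \<noteq> 0"
  proof -
    have n: "fls_const c \<noteq> 0" "inverse s ^ 2 \<noteq> 0" "Z ^ K \<noteq> 0" using s0 Z0 c_nz by simp_all
    then show ?thesis unfolding dx by (simp only: neg_equal_0_iff_equal no_zero_divisors not_False_eq_True)
  qed
  ultimately show ?thesis by blast
qed

end

lemma fls_subdegree_prod_nonzero:
  fixes f :: "'i \<Rightarrow> 'a::field fls"
  assumes "finite I" "\<And>i. i \<in> I \<Longrightarrow> f i \<noteq> 0"
  shows "fls_subdegree (\<Prod>i\<in>I. f i) = (\<Sum>i\<in>I. fls_subdegree (f i))"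
  using assms by (induction I rule: finite_induct) simp_all

section \<open>The place at infinity and the norm to \<open>K[x]\<close>\<close>

text \<open>One fixed expansion at infinity turns K((t)) into the ambient field for all function
  field arithmetic.\<close>

locale AS_curve_inf = AS_curve p q c m for p q :: nat and c :: "'k::alg_closed_field" and m +
  fixes xi yi :: "'k fls"
  assumes place_inf: "place xi yi"
    and sd_xi: "fls_subdegree xi = - int p" and sd_yi: "fls_subdegree yi = - int (q + 1)"
    and dxi: "fls_deriv xi \<noteq> 0" and sd_dxi: "fls_subdegree (fls_deriv xi) = int q * (int p - 1) - 2"
begin

text \<open>
  The monomials \<open>x^i y^j\<close> with \<open>j < p\<close> have distinct pole orders \<open>p i + (q + 1) j\<close>, since these
  are congruent to \<open>j\<close> modulo \<open>p\<close>.
\<close>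

lemma reduced_pole:
  assumes x: "fls_subdegree x = - int p" and y: "fls_subdegree y = - int (q + 1)"
    and "a \<noteq> 0" "degree a < p"
  shows "pl x y a \<noteq> 0 \<and> (\<exists>j. coeff a j \<noteq> 0 \<and>
    fls_subdegree (pl x y a) = - int (p * degree (coeff a j) + (q + 1) * j) \<and>
    (\<forall>i. coeff a i \<noteq> 0 \<longrightarrow> p * degree (coeff a i) + (q + 1) * i \<le> p * degree (coeff a j) + (q + 1) * j))"
  using assms(3,4)
proof (induction a)
  case (pCons A a)
  have xneg: "fls_subdegree x < 0" using x p2 by simp
  have y0: "y \<noteq> 0" using y by auto
  have hA: "A \<noteq> 0 \<Longrightarrow> hev fls_const x A \<noteq> 0"
    "A \<noteq> 0 \<Longrightarrow> fls_subdegree (hev fls_const x A) = - int (p * degree A)"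
    using fls_subdegree_hev[OF xneg, of A] x by (simp_all add: mult.commute)
  show ?case
  proof (cases "a = 0")
    case True
    with pCons have "A \<noteq> 0" by simp
    then show ?thesis using True hA by (intro conjI exI[of _ 0]) (auto simp: coeff_pCons split: nat.splits)
  next
    case False
    have deg: "Suc (degree a) < p" using pCons.prems False by simp
    obtain j where j: "pl x y a \<noteq> 0" "coeff a j \<noteq> 0"
      "fls_subdegree (pl x y a) = - int (p * degree (coeff a j) + (q + 1) * j)"
      "\<And>i. coeff a i \<noteq> 0 \<Longrightarrow> p * degree (coeff a i) + (q + 1) * i \<le> p * degree (coeff a j) + (q + 1) * j"
      using pCons.IH[OF False] deg by auto
    define W where "W = p * degree (coeff a j) + (q + 1) * Suc j"
    have yz: "y * pl x y a \<noteq> 0" using y0 j by simp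
    have yW: "fls_subdegree (y * pl x y a) = - int W"
      using y0 j(1,3) y by (simp add: W_def algebra_simps)
    have tail: "p * degree (coeff (pCons A a) i) + (q + 1) * i \<le> W"
      if h: "coeff (pCons A a) i \<noteq> 0" "i > 0" for i
    proof -
      obtain i' where i: "i = Suc i'" using h(2) gr0_conv_Suc by blast
      then show ?thesis using h j(4)[of i'] by (simp add: W_def)
    qed
    show ?thesis
    proof (cases "A = 0")
      case True
      then have "pl x y (pCons A a) = y * pl x y a" by (simp add: pl_pCons)
      moreover have "p * degree (coeff (pCons A a) i) + (q + 1) * i \<le> W"
        if "coeff (pCons A a) i \<noteq> 0" for i
        using tail[OF that] that True by (cases i) auto
      ultimately show ?thesis using j(2) yz yW
        by (intro conjI exI[of _ "Suc j"]) (auto simp: W_def)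
    next
      case A0: False
      have "j \<le> degree a" using j(2) by (rule le_degree)
      then have "Suc j < p" using deg by simp
      have "W mod p = Suc j mod p"
      proof -
        obtain k where "q = p * k" using p_dvd_q by blast
        then have "W = Suc j + p * (degree (coeff a j) + k * Suc j)"
          by (simp add: W_def algebra_simps)
        then show ?thesis by simp
      qed
      then have ne: "p * degree A \<noteq> W" using \<open>Suc j < p\<close> by auto
      consider "p * degree A < W" | "p * degree A > W" using ne by linarith
      then show ?thesis
      proof cases
        case 1
        have "pl x y (pCons A a) \<noteq> 0 \<and> fls_subdegree (pl x y (pCons A a)) = - int W"
        proof -
          have s: "fls_subdegree (hev fls_const x A + y * pl x y a) = - int W"
            unfolding yW[symmetric]
            by (rule fls_subdegree_add_eq2[OF yz]) (simp only: yW hA(2)[OF A0] neg_less_iff_less of_nat_less_iff 1)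
          moreover have "W > 0" by (simp add: W_def)
          ultimately have "hev fls_const x A + y * pl x y a \<noteq> 0" by auto
          with s show ?thesis by (simp add: pl_pCons)
        qed
        moreover have "p * degree (coeff (pCons A a) i) + (q + 1) * i \<le> W"
          if "coeff (pCons A a) i \<noteq> 0" for i
          using tail[OF that] 1 by (cases i) auto
        ultimately show ?thesis using j(2) by (intro conjI exI[of _ "Suc j"]) (auto simp: W_def)
      next
        case 2
        have "pl x y (pCons A a) \<noteq> 0 \<and> fls_subdegree (pl x y (pCons A a)) = - int (p * degree A)"
        proof -
          have s: "fls_subdegree (hev fls_const x A + y * pl x y a) = - int (p * degree A)"
            unfolding hA(2)[OF A0, symmetric]
            by (rule fls_subdegree_add_eq1[OF hA(1)[OF A0]]) (simp only: yW hA(2)[OF A0] neg_less_iff_less of_nat_less_iff 2)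
          moreover have "p * degree A > 0" using 2 by (rule order.strict_trans1[OF le0])
          ultimately have "hev fls_const x A + y * pl x y a \<noteq> 0"
            by (metis fls_zero_subdegree neg_equal_0_iff_equal not_less_iff_gr_or_eq of_nat_0_eq_iff)
          with s show ?thesis by (simp add: pl_pCons)
        qed
        moreover have "p * degree (coeff (pCons A a) i) + (q + 1) * i \<le> p * degree A"
          if "coeff (pCons A a) i \<noteq> 0" for i
        proof (cases "i = 0")
          case False
          then show ?thesis using tail[OF that] 2 by simp
        qed simp
        ultimately show ?thesis using A0 by (intro conjI exI[of _ 0]) auto
      qed
    qed
  qed
qed simp

lemma reduced_0: "degree a < p \<Longrightarrow> pl xi yi a = 0 \<Longrightarrow> a = 0"
  using reduced_pole[OF sd_xi sd_yi] by blast

text \<open>A remainder of \<open>y\<close>-degree below \<open>p\<close> that expands to 0 is 0, by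
  the distinct pole orders. So the coordinate ring embeds in K((t)); in particular
  \<open>eqn\<close> is prime.\<close>

lemma eqn_dvd_iff: "eqn dvd F \<longleftrightarrow> pl xi yi F = 0"
proof
  assume "eqn dvd F"
  then show "pl xi yi F = 0"
    using rhom_dvd[OF rhom_pl, of eqn F xi yi] pl_eqn[OF place_inf] by simp
next
  assume 0: "pl xi yi F = 0"
  obtain a where a: "degree a < p" "eqn dvd F - a" using ex_reduced by blast
  then have "pl xi yi (F - a) = 0"
    using rhom_dvd[OF rhom_pl, of eqn "F - a" xi yi] pl_eqn[OF place_inf] by simp
  then have "a = 0" using 0 a(1) by (intro reduced_0) (simp_all add: pl_simps)
  then show "eqn dvd F" using a by simp
qed

lemma transfer_0: "pl xi yi F = 0 \<Longrightarrow> place x y \<Longrightarrow> pl x y F = 0"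
  using rhom_dvd[OF rhom_pl, of eqn F x y] pl_eqn[of x y] by (simp add: eqn_dvd_iff[symmetric])

lemma transfer_eq: "pl xi yi F = pl xi yi G \<Longrightarrow> place x y \<Longrightarrow> pl x y F = pl x y G"
  using transfer_0[of "F - G" x y] by (simp add: pl_simps)

lemma obtain_reduced:
  obtains a where "degree a < p" "\<And>x y. place x y \<Longrightarrow> pl x y F = pl x y a"
proof -
  obtain a where a: "degree a < p" "eqn dvd F - a" using ex_reduced by blast
  have "pl x y F = pl x y a" if "place x y" for x y
    using transfer_0[of "F - a" x y] a(2) that by (simp add: eqn_dvd_iff pl_simps)
  with a show ?thesis using that by blast
qed

text \<open>The translations of \<open>y\<close> by these constants form the Galois group of K(x, y)
  over K(x).\<close>

definition Z :: "'k set" where "Z = {e. e ^ p + c * e = 0}"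

lemma Z: "finite Z" "card Z = p" "0 \<in> Z"
  unfolding Z_def using artin_schreier_roots[OF prime_p char_p c_nz, of 0] p2 by auto

lemma frob: "(a + b :: 'k) ^ p = a ^ p + b ^ p" "(f + g :: 'k fls) ^ p = f ^ p + g ^ p"
  by (rule freshmans_dream; simp add: prime_p char_p)+

lemma Z_add: "e \<in> Z \<Longrightarrow> d \<in> Z \<Longrightarrow> e + d \<in> Z"
proof -
  assume "e \<in> Z" "d \<in> Z"
  then have "(e ^ p + c * e) + (d ^ p + c * d) = 0" by (simp add: Z_def)
  moreover have "(e + d) ^ p + c * (e + d) = (e ^ p + c * e) + (d ^ p + c * d)"
    unfolding frob by (simp only: distrib_left add_ac)
  ultimately show ?thesis by (simp add: Z_def)
qed

lemma place_add:
  assumes "place x y" "e \<in> Z"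
  shows "place x (y + fls_const e)"
proof -
  have "fls_const e ^ p + fls_const c * fls_const e = fls_const (e ^ p + c * e)"
    by (simp only: rhomD[OF rhom_fls_const])
  also have "\<dots> = 0" using assms(2) by (simp add: Z_def)
  finally have e: "fls_const e ^ p + fls_const c * fls_const e = 0" .
  have "(y + fls_const e) ^ p + fls_const c * (y + fls_const e) =
      (y ^ p + fls_const c * y) + (fls_const e ^ p + fls_const c * fls_const e)"
    unfolding frob by (simp only: distrib_left add_ac)
  then show ?thesis using assms(1) unfolding e place_def by simp
qed

definition shift :: "'k \<Rightarrow> 'k poly poly \<Rightarrow> 'k poly poly" where
  "shift e F = pcompose F [:[:e:], 1:]"

lemma pl_shift: "pl x y (shift e F) = pl x (y + fls_const e) F"
  by (simp add: shift_def pl_pcompose pl_pCons pl_simps hev_pCons rhom_fls_const add.commute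
      rhomD[OF rhom_hev[OF rhom_fls_const]])

text \<open>The formula for pole orders as a maximum involves \<open>y\<close> only through its
  order, which adding a constant does not change.\<close>

lemma sd_shift:
  assumes "e \<in> Z"
  shows "fls_subdegree (pl xi yi (shift e F)) = fls_subdegree (pl xi yi F)"
    "pl xi yi F \<noteq> 0 \<Longrightarrow> pl xi yi (shift e F) \<noteq> 0"
proof -
  obtain a where a: "degree a < p" "\<And>x y. place x y \<Longrightarrow> pl x y F = pl x y a"
    using obtain_reduced by blast
  define y where "y = yi + fls_const e"
  have y: "place xi y" unfolding y_def using place_inf assms by (rule place_add)
  have "yi \<noteq> 0" using sd_yi by auto
  then have sy: "fls_subdegree y = - int (q + 1)"
    unfolding y_def using fls_subdegree_add_eq1[of yi "fls_const e"] sd_yi by simp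
  have s: "pl xi yi (shift e F) = pl xi y a" using a(2)[OF y] by (simp add: pl_shift y_def)
  have "fls_subdegree (pl xi y a) = fls_subdegree (pl xi yi a) \<and> (pl xi yi a \<noteq> 0 \<longrightarrow> pl xi y a \<noteq> 0)"
  proof (cases "a = 0")
    case False
    let ?w = "\<lambda>i. p * degree (coeff a i) + (q + 1) * i"
    obtain j where j: "coeff a j \<noteq> 0" "fls_subdegree (pl xi yi a) = - int (?w j)"
      "\<forall>i. coeff a i \<noteq> 0 \<longrightarrow> ?w i \<le> ?w j"
      using reduced_pole[OF sd_xi sd_yi False a(1)] by blast
    obtain j' where j': "coeff a j' \<noteq> 0" "fls_subdegree (pl xi y a) = - int (?w j')"
      "\<forall>i. coeff a i \<noteq> 0 \<longrightarrow> ?w i \<le> ?w j'"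
      using reduced_pole[OF sd_xi sy False a(1)] by blast
    have "?w j = ?w j'" using j(1,3) j'(1,3) by (intro antisym) blast+
    then show ?thesis using j(2) j'(2) reduced_pole[OF sd_xi sy False a(1)] by presburger
  qed (simp add: pl_simps)
  then show "fls_subdegree (pl xi yi (shift e F)) = fls_subdegree (pl xi yi F)"
    "pl xi yi F \<noteq> 0 \<Longrightarrow> pl xi yi (shift e F) \<noteq> 0"
    using s a(2)[OF place_inf] by auto
qed

lemma degree_shift: "degree (shift e F) = degree F"
  by (simp add: shift_def degree_pcompose)

text \<open>As a polynomial in \<open>y\<close>, the difference of \<open>a\<close> and its value at
  \<open>y = 0\<close> has the \<open>p\<close> elements of \<open>Z\<close> as roots but degree
  below \<open>p\<close>.\<close>

lemma shift_invariant:
  assumes "degree a < p" "\<And>e. e \<in> Z \<Longrightarrow> shift e a = a"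
  shows "a = [:coeff a 0:]"
proof -
  let ?b = "a - [:coeff a 0:]"
  have "poly ?b [:e:] = 0" if "e \<in> Z" for e
  proof -
    have "poly a [:e:] = poly (shift e a) 0" by (simp add: shift_def poly_pcompose)
    also have "\<dots> = poly a 0" by (simp only: assms(2)[OF that])
    finally show ?thesis by (simp only: poly_diff poly_0_coeff_0 poly_pCons poly_0 mult_zero_right
        add_0_right diff_self)
  qed
  then have sub: "(\<lambda>e. [:e:]) ` Z \<subseteq> {z. poly ?b z = 0}" by auto
  have c: "card ((\<lambda>e. [:e:]) ` Z) = p"
    using card_image[of "\<lambda>e. [:e:]" Z] Z(2) by (auto simp: inj_on_def)
  have "degree ?b < p"
    using assms(1) by (rule degree_diff_less) (simp add: prime_gt_0_nat[OF prime_p])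
  show ?thesis
  proof (rule ccontr)
    assume "a \<noteq> [:coeff a 0:]"
    then have b: "?b \<noteq> 0" unfolding right_minus_eq .
    have "card ((\<lambda>e. [:e:]) ` Z) \<le> card {z. poly ?b z = 0}"
      using sub poly_roots_finite[OF b] by (rule card_mono[rotated])
    also have "\<dots> \<le> degree ?b" using b by (rule card_poly_roots_bound)
    finally show False using \<open>degree ?b < p\<close> unfolding c by linarith
  qed
qed

text \<open>\<open>N\<close> is the product of all conjugates, which lies in K[x] by invariance, and
  \<open>H\<close> is the product of the nontrivial ones. All \<open>p\<close> conjugates have the
  same order at infinity, where \<open>x\<close> has pole order \<open>p\<close>; this gives the
  degree of \<open>N\<close>. So \<open>N\<close> measures the affine zeros of
  \<open>F\<close>.\<close>

lemma ex_norm: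
  "\<exists>N H. pl xi yi [:N:] = pl xi yi F * pl xi yi H \<and>
     (pl xi yi F \<noteq> 0 \<longrightarrow> N \<noteq> 0 \<and> pl xi yi H \<noteq> 0 \<and> int (degree N) = - fls_subdegree (pl xi yi F))"
proof -
  define G where "G = (\<Prod>e\<in>Z. shift e F)"
  define H where "H = (\<Prod>e\<in>Z - {0}. shift e F)"
  have GH: "G = F * H"
    unfolding G_def H_def prod.remove[OF Z(1,3)] by (simp add: shift_def)
  obtain a where a: "degree a < p" "\<And>x y. place x y \<Longrightarrow> pl x y G = pl x y a"
    using obtain_reduced by blast
  have "shift d a = a" if d: "d \<in> Z" for d
  proof -
    have bij: "bij_betw (\<lambda>e. d + e) Z Z"
    proof -
      have inj: "inj_on (\<lambda>e. d + e) Z" by simp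
      moreover have "(\<lambda>e. d + e) ` Z \<subseteq> Z" using d Z_add by blast
      ultimately have "(\<lambda>e. d + e) ` Z = Z" by (rule endo_inj_surj[OF Z(1), rotated])
      then show ?thesis unfolding bij_betw_def using inj by blast
    qed
    have pd: "place xi (yi + fls_const d)" using place_inf d by (rule place_add)
    have "pl xi (yi + fls_const d) G = (\<Prod>e\<in>Z. pl xi (yi + fls_const (d + e)) F)"
      unfolding G_def by (simp add: rhom_prod[OF rhom_pl] pl_shift add.assoc flip: fls_plus_const)
    also have "\<dots> = (\<Prod>e\<in>Z. pl xi (yi + fls_const e) F)"
      by (rule prod.reindex_bij_betw[OF bij])
    also have "\<dots> = pl xi yi G"
      unfolding G_def by (simp add: rhom_prod[OF rhom_pl] pl_shift)
    finally have "pl xi yi (shift d a - a) = 0"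
      using a(2)[OF pd] a(2)[OF place_inf] by (simp add: pl_simps pl_shift)
    moreover have "degree (shift d a - a) < p"
      using a(1) degree_diff_le_max[of "shift d a" a] by (simp add: degree_shift)
    ultimately have "shift d a - a = 0" by (intro reduced_0)
    then show ?thesis by simp
  qed
  then have aN: "a = [:coeff a 0:]" using a(1) by (intro shift_invariant)
  define N where "N = coeff a 0"
  have N: "pl xi yi [:N:] = pl xi yi G" unfolding N_def using aN a(2)[OF place_inf] by simp
  have "N \<noteq> 0 \<and> pl xi yi H \<noteq> 0 \<and> int (degree N) = - fls_subdegree (pl xi yi F)" if F: "pl xi yi F \<noteq> 0"
  proof -
    have nz: "pl xi yi (shift e F) \<noteq> 0" if "e \<in> Z" for e using sd_shift(2)[OF that F] .
    have "pl xi yi G = (\<Prod>e\<in>Z. pl xi yi (shift e F))"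
      unfolding G_def by (rule rhom_prod[OF rhom_pl])
    then have G0: "pl xi yi G \<noteq> 0" and
      "fls_subdegree (pl xi yi G) = (\<Sum>e\<in>Z. fls_subdegree (pl xi yi (shift e F)))"
      using nz Z(1) by (simp_all add: fls_subdegree_prod_nonzero)
    then have sG: "fls_subdegree (pl xi yi G) = int p * fls_subdegree (pl xi yi F)"
      using sd_shift(1) Z(2) by simp
    have N0: "N \<noteq> 0" using N G0 by auto
    have "fls_subdegree (pl xi yi [:N:]) = - (int (degree N) * int p)"
      using fls_subdegree_hev[of xi N] sd_xi p2 N0 by simp
    then have "int p * int (degree N) = int p * - fls_subdegree (pl xi yi F)"
      using N sG by (simp add: mult.commute)
    then have "int p = 0 \<or> int (degree N) = - fls_subdegree (pl xi yi F)"
      by (simp only: mult_cancel_left)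
    then have "int (degree N) = - fls_subdegree (pl xi yi F)"
      using prime_gt_0_nat[OF prime_p] by simp
    moreover have "pl xi yi H \<noteq> 0" using G0 unfolding GH pl_simps by simp
    ultimately show ?thesis using N0 by blast
  qed
  moreover have "pl xi yi [:N:] = pl xi yi F * pl xi yi H" unfolding N unfolding GH pl_simps ..
  ultimately show ?thesis by blast
qed

text \<open>At \<open>x = a\<close> a nonzero polynomial of \<open>y\<close>-degree below
  \<open>p\<close> cannot have all \<open>p\<close> ordinates above \<open>a\<close> as
  roots.\<close>

lemma divide_linear:
  assumes "degree F < p" "\<And>b. b ^ p + c * b = a ^ (q + 1) \<Longrightarrow> pt a b F = 0"
  shows "\<exists>G. F = smult [:-a, 1:] G"
proof -
  let ?Fa = "map_poly (\<lambda>A. poly A a) F"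
  have "{b. b ^ p + c * b = a ^ (q + 1)} \<subseteq> {b. poly ?Fa b = 0}"
    using assms(2) by (auto simp: pt_def hev_def)
  moreover have "degree ?Fa < p" using assms(1) map_poly_degree_leq[of "\<lambda>A. poly A a" F] by simp
  ultimately have "?Fa = 0"
    using artin_schreier_roots[OF prime_p char_p c_nz, of "a ^ (q + 1)"]
      card_mono[of "{b. poly ?Fa b = 0}" "{b. b ^ p + c * b = a ^ (q + 1)}"]
      poly_roots_finite[of ?Fa] card_poly_roots_bound[of ?Fa] by linarith
  then have "coeff ?Fa i = 0" for i by simp
  then have "poly (coeff F i) a = 0" for i by (simp add: coeff_map_poly)
  then have "[:[:-a, 1:]:] dvd F" by (simp add: const_poly_dvd_iff poly_eq_0_iff_dvd)
  then show ?thesis by (auto simp: dvd_def)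
qed

lemma local_hev:
  assumes "local_at a b x y" "B \<noteq> 0"
  shows "hev fls_const x B \<noteq> 0" "fls_subdegree (hev fls_const x B) = int (order a B)"
proof -
  have "x = fls_const a + fls_X" using assms(1) unfolding local_at_def by blast
  then show "hev fls_const x B \<noteq> 0" "fls_subdegree (hev fls_const x B) = int (order a B)"
    using hev_pole_at[OF assms(2), of a] by simp_all
qed

text \<open>A form of the integral closedness of the affine coordinate ring. One linear factor of
  \<open>B\<close> is removed at a time, and the hypothesis survives because orders are
  additive.\<close>

lemma divide_poly:
  assumes "degree F < p" "B \<noteq> 0"
    "\<And>a b x y. local_at a b x y \<Longrightarrow> vge (int (order a B)) (pl x y F)"
  shows "\<exists>G. degree G < p \<and> F = smult B G"
  using assms
proof (induction "degree B" arbitrary: F B)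
  case 0
  then obtain k where k: "B = [:k:]" "k \<noteq> 0" by (metis degree_eq_zeroE pCons_0_0)
  then have "B * [:1 / k:] = 1" by (simp add: one_pCons)
  then have "F = smult B (smult [:1 / k:] F)" by (simp only: smult_smult smult_1_left)
  moreover have "degree (smult [:1 / k:] F) < p" using 0 k by simp
  ultimately show ?case by blast
next
  case (Suc n)
  then obtain a where a: "poly B a = 0"
    using alg_closed_imp_poly_has_root[of B] by auto
  then obtain B' where B': "B = [:-a, 1:] * B'" by (auto simp: poly_eq_0_iff_dvd)
  have lin0: "[:-a, 1:] \<noteq> 0" by simp
  have B'0: "B' \<noteq> 0" using Suc.prems(2) B' by auto
  have "pt a b F = 0" if b: "b ^ p + c * b = a ^ (q + 1)" for b
  proof -
    obtain x y where l: "local_at a b x y" using ex_local_at[OF b] by blast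
    have "order a B > 0" using a Suc.prems(2) by (simp add: order_gt_0_iff)
    then have "fls_nth (pl x y F) 0 = 0" using Suc.prems(3)[OF l] unfolding vge_def by simp
    then show ?thesis using l unfolding local_at_def by metis
  qed
  then obtain F' where F': "F = smult [:-a, 1:] F'" using divide_linear[OF Suc.prems(1)] by blast
  have "degree F = degree F'" unfolding F' by simp
  then have F'p: "degree F' < p" using Suc.prems(1) by simp
  have "\<exists>G. degree G < p \<and> F' = smult B' G"
  proof (rule Suc.hyps(1))
    have "degree B = 1 + degree B'" unfolding B' using B'0 by (subst degree_mult_eq) auto
    then show "n = degree B'" using Suc.hyps(2) by simp
    fix a' b x y assume l: "local_at a' b x y"
    show "vge (int (order a' B')) (pl x y F')"
    proof (cases "pl x y F' = 0")
      case False
      let ?L = "hev fls_const x [:-a, 1:]"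
      have "pl x y F = ?L * pl x y F'" by (simp only: F' pl_smult)
      moreover have "?L \<noteq> 0" "fls_subdegree ?L = int (order a' [:-a, 1:])"
        using local_hev[OF l lin0] .
      moreover have "order a' B = order a' [:-a, 1:] + order a' B'"
        unfolding B' by (rule order_mult) (use lin0 B'0 in \<open>metis no_zero_divisors\<close>)
      ultimately show ?thesis using Suc.prems(3)[OF l] False by (simp add: vge_iff)
    qed simp
  qed fact+
  then obtain G where "degree G < p" "F' = smult B' G" by blast
  then show ?case unfolding F' B' by (intro exI[of _ G]) simp
qed

text \<open>A term containing \<open>y\<close> has a pole of order at least \<open>q + 1\<close>,
  and such poles do not cancel.\<close>

lemma in_Kx:
  assumes "degree a < p" "- fls_subdegree (pl xi yi a) \<le> int q"
  shows "a = [:coeff a 0:]"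
proof (cases "a = 0")
  case False
  obtain j where j: "fls_subdegree (pl xi yi a) = - int (p * degree (coeff a j) + (q + 1) * j)"
    "\<And>i. coeff a i \<noteq> 0 \<Longrightarrow> p * degree (coeff a i) + (q + 1) * i \<le> p * degree (coeff a j) + (q + 1) * j"
    using reduced_pole[OF sd_xi sd_yi False assms(1)] by blast
  have "coeff a i = 0" if "i > 0" for i
  proof (rule ccontr)
    assume "coeff a i \<noteq> 0"
    moreover have "q + 1 \<le> (q + 1) * i" using that mult_le_mono2[of 1 i "q + 1"] by simp
    ultimately have "q + 1 \<le> p * degree (coeff a j) + (q + 1) * j" using j(2)[of i] by linarith
    then show False using j(1) assms(2) by linarith
  qed
  then show ?thesis by (intro poly_eqI) (auto simp: coeff_pCons split: nat.splits)
qed simp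

end

section \<open>Solutions of \<open>v^p + c v = u^(r+1)\<close> in the function field\<close>

text \<open>Clearing denominators gives the relation the polynomial form in which it can pass from
  one place or point to another.\<close>

lemma fraction_relation:
  fixes A B C E k :: "'a::field"
  assumes "B \<noteq> 0" "E \<noteq> 0" "p > 0"
  shows "(C / E) ^ p + k * (C / E) = (A / B) ^ n \<longleftrightarrow>
    C ^ p * B ^ n + k * C * E ^ (p - 1) * B ^ n - A ^ n * E ^ p = 0"
proof -
  have Ep: "E ^ p = E * E ^ (p - 1)" using assms(3) by (metis power_eq_if not_gr_zero)
  have 1: "(C / E) ^ p = C ^ p / E ^ p" by (rule power_divide)
  have "E ^ (p - 1) \<noteq> 0" using assms(2) by simp
  then have "k * C * E ^ (p - 1) / (E * E ^ (p - 1)) = k * (C / E)" by simp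
  then have 2: "k * (C / E) = k * C * E ^ (p - 1) / E ^ p" by (simp only: Ep)
  have "(C / E) ^ p + k * (C / E) = (C ^ p + k * C * E ^ (p - 1)) / E ^ p"
    unfolding 1 2 by (rule add_divide_distrib[symmetric])
  then have "(C / E) ^ p + k * (C / E) = (A / B) ^ n \<longleftrightarrow>
    (C ^ p + k * C * E ^ (p - 1)) / E ^ p = A ^ n / B ^ n"
    by (simp only: power_divide)
  also have "\<dots> \<longleftrightarrow> (C ^ p + k * C * E ^ (p - 1)) * B ^ n = A ^ n * E ^ p"
    by (rule frac_eq_eq) (use assms in simp_all)
  finally show ?thesis by (simp only: distrib_right right_minus_eq)
qed

lemma order_power:
  fixes P :: "'a::idom poly"
  assumes "P \<noteq> 0"
  shows "order a (P ^ n) = n * order a P"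
  using assms by (induction n) (simp_all add: order_mult)

context AS_curve_inf
begin

section \<open>Fractions with denominators in K[x], and their derivatives\<close>

lemma relation_transfer:
  assumes "(pl xi yi C / pl xi yi [:E:]) ^ p + fls_const c * (pl xi yi C / pl xi yi [:E:])
      = (pl xi yi A / pl xi yi [:B:]) ^ n"
    and "pl xi yi [:B:] \<noteq> 0" "pl xi yi [:E:] \<noteq> 0"
    and xy: "place x y" "pl x y [:B:] \<noteq> 0" "pl x y [:E:] \<noteq> 0"
  shows "(pl x y C / pl x y [:E:]) ^ p + fls_const c * (pl x y C / pl x y [:E:])
      = (pl x y A / pl x y [:B:]) ^ n"
proof -
  have p0: "p > 0" by (rule prime_gt_0_nat[OF prime_p])
  define R where "R = C ^ p * [:B:] ^ n + [:[:c:]:] * C * [:E:] ^ (p - 1) * [:B:] ^ n - A ^ n * [:E:] ^ p"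
  have cc: "pl x' y' [:[:c:]:] = fls_const c" for x' y' by (simp add: rhom_fls_const)
  have R: "pl x' y' R = pl x' y' C ^ p * pl x' y' [:B:] ^ n
      + fls_const c * pl x' y' C * pl x' y' [:E:] ^ (p - 1) * pl x' y' [:B:] ^ n
      - pl x' y' A ^ n * pl x' y' [:E:] ^ p" for x' y'
    unfolding R_def pl_simps cc ..
  have "pl xi yi R = 0"
    unfolding R using assms(1) unfolding fraction_relation[OF assms(2,3) p0] .
  then have "pl x y R = 0" using xy(1) by (rule transfer_0)
  then show ?thesis unfolding R fraction_relation[OF xy(2,3) p0] .
qed

lemma inf_const_nz: "B \<noteq> 0 \<Longrightarrow> pl xi yi [:B:] \<noteq> 0"
  and sd_inf_const: "B \<noteq> 0 \<Longrightarrow> fls_subdegree (pl xi yi [:B:]) = - int (p * degree B)"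
  using fls_subdegree_hev[of xi B] sd_xi p2 by (simp_all add: mult.commute)

text \<open>The numerator of \<open>(A/B)'\<close> over \<open>B^2\<close> for the derivation with
  \<open>x' = 1\<close>; as \<open>B\<close> is free of \<open>y\<close>, its derivative is
  \<open>pderiv B\<close>.\<close>

definition wronski :: "'k poly poly \<Rightarrow> 'k poly \<Rightarrow> 'k poly poly" where
  "wronski A B = smult B (D A) - smult (pderiv B) A"

lemma deriv_fraction:
  assumes "place x y" "pl x y [:B:] \<noteq> 0"
  shows "fls_deriv (pl x y A / pl x y [:B:]) * pl x y [:B:] ^ 2 = pl x y (wronski A B) * fls_deriv x"
proof -
  define u where "u = pl x y A / pl x y [:B:]"
  have "u * pl x y [:B:] = pl x y A" using assms(2) by (simp add: u_def)
  then have "fls_deriv (u * pl x y [:B:]) = pl x y (D A) * fls_deriv x"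
    using deriv_pl[OF assms(1), of A] by simp
  then have "u * fls_deriv (pl x y [:B:]) + fls_deriv u * pl x y [:B:] = pl x y (D A) * fls_deriv x"
    by (simp only: fls_deriv_mult)
  moreover have "fls_deriv (pl x y [:B:]) = pl x y [:pderiv B:] * fls_deriv x"
    unfolding pl_const by (rule fls_deriv_hev)
  ultimately have "fls_deriv u * pl x y [:B:] =
      pl x y (D A) * fls_deriv x - u * (pl x y [:pderiv B:] * fls_deriv x)"
    by (simp add: algebra_simps)
  then have "fls_deriv u * pl x y [:B:] * pl x y [:B:] =
      (pl x y (D A) * fls_deriv x - u * (pl x y [:pderiv B:] * fls_deriv x)) * pl x y [:B:]"
    by (rule arg_cong)
  also have "\<dots> = (pl x y [:B:] * pl x y (D A) - pl x y [:pderiv B:] * (u * pl x y [:B:])) * fls_deriv x"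
    by (simp only: algebra_simps)
  also have "\<dots> = pl x y (wronski A B) * fls_deriv x"
    using \<open>u * pl x y [:B:] = pl x y A\<close>
    by (simp only: wronski_def pl_simps pl_smult pl_const)
  finally show ?thesis unfolding u_def by (simp only: power2_eq_square mult.assoc)
qed

lemma degree_wronski:
  assumes "degree A < p"
  shows "degree (wronski A B) < p"
  unfolding wronski_def
  by (rule degree_diff_less)
    (use assms degree_D[OF assms] in \<open>simp_all add: degree_smult_eq\<close>)

lemma local_deriv_x: "local_at a b x y \<Longrightarrow> fls_deriv x = 1"
proof -
  assume "local_at a b x y"
  then have "x = fls_const a + fls_X" unfolding local_at_def by blast
  then show ?thesis by simp
qed

text \<open>
  At a finite pole the equation \<open>v^p + c v = u^(r+1)\<close> forces \<open>u'\<close> to vanish to high order, so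
  \<open>u'\<close> is regular on the affine curve.  Comparing its zeros, counted through the norm to
  \<open>K[x]\<close>, with its pole at infinity is the Riemann--Hurwitz inequality, and it bounds the poles
  of \<open>u\<close>.
\<close>

lemma pole_bound:
  fixes A C :: "'k poly poly" and B E :: "'k poly" and r :: nat
  defines "u \<equiv> pl xi yi A / pl xi yi [:B:]"
  assumes nz: "B \<noteq> 0" "E \<noteq> 0" and r: "p dvd r" "r > 0" and p3: "p > 2"
    and rel: "(pl xi yi C / pl xi yi [:E:]) ^ p + fls_const c * (pl xi yi C / pl xi yi [:E:]) = u ^ (r + 1)"
    and degA: "degree A < p"
    and min: "\<And>a A' B'. A = smult [:-a, 1:] A' \<Longrightarrow> B = [:-a, 1:] * B' \<Longrightarrow> False"
    and du: "fls_deriv u \<noteq> 0"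
  obtains G where "degree G < p" "wronski A B = smult (B ^ 2) G" "G \<noteq> 0"
    "\<And>a. poly B a = 0 \<Longrightarrow> \<exists>b. b ^ p + c * b = a ^ (q + 1) \<and> pt a b G = 0"
    "(int r * int p - int r - 2) * - fls_subdegree (pl xi yi A) \<le> int p * (int p * (int q * (int p - 1) - 2))"
proof -
  \<comment> \<open>A pole of order \<open>p e\<close> makes \<open>u'\<close> vanish to order at
    least \<open>e (wt + 1) - 1\<close>, which is at least \<open>e wt\<close>. The weaker bound is
    proportional to the pole order and can be summed over all poles.\<close>
  define wt where "wt = int r * int p - int r - 2"
  have "r \<ge> 2" using dvd_imp_le[OF r] p2 by linarith
  have "int r * 3 \<le> int r * int p" using p3 by (intro mult_left_mono) auto
  then have X1: "wt \<ge> 1" using \<open>r \<ge> 2\<close> unfolding wt_def by linarith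
  then have X0: "wt \<ge> 0" by simp
  have localrel: "hev fls_const x B \<noteq> 0" "fls_subdegree (hev fls_const x B) = int (order a B)"
      "(pl x y C / pl x y [:E:]) ^ p + fls_const c * (pl x y C / pl x y [:E:])
         = (pl x y A / pl x y [:B:]) ^ (r + 1)"
    if l: "local_at a b x y" for a b x y
  proof -
    show *: "hev fls_const x B \<noteq> 0" "fls_subdegree (hev fls_const x B) = int (order a B)"
      using local_hev[OF l nz(1)] .
    have "place x y" using l unfolding local_at_def by blast
    then show "(pl x y C / pl x y [:E:]) ^ p + fls_const c * (pl x y C / pl x y [:E:])
         = (pl x y A / pl x y [:B:]) ^ (r + 1)"
      using rel unfolding u_def
      by (intro relation_transfer[where x = x and y = y] inf_const_nz nz)
        (simp_all add: * local_hev[OF l nz(2)])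
  qed
  have pole: "\<exists>e>0. fls_subdegree w = - (int p * e) \<and> (fls_deriv w \<noteq> 0 \<longrightarrow>
      fls_subdegree (fls_deriv w) \<ge> e * wt + (e - 1))"
    if vw: "v ^ p + fls_const c * v = w ^ (r + 1)" "fls_subdegree w < 0" for v w :: "'k fls"
  proof -
    obtain e :: int where e: "e > 0" "fls_subdegree w = - (int p * e)"
      "fls_deriv w \<noteq> 0 \<Longrightarrow> fls_subdegree (fls_deriv w) \<ge> e * (int r * int p - int r - 1) - 1"
      using fls_artin_schreier_pole[OF prime_p char_p r(1) c_nz vw] by metis
    have eq: "e * (int r * int p - int r - 1) - 1 = e * wt + (e - 1)"
      by (simp add: wt_def algebra_simps)
    show ?thesis
      by (intro exI[of _ e] conjI impI) (rule e(1), rule e(2), erule e(3)[unfolded eq])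
  qed
  \<comment> \<open>\<open>u'\<close> is regular at every affine place, even at the poles of
    \<open>u\<close>, so \<open>B^2 u'\<close> vanishes at least to the order of
    \<open>B^2\<close>.\<close>
  have wr: "vge (int (order a (B ^ 2))) (pl x y (wronski A B))" if l: "local_at a b x y" for a b x y
  proof -
    let ?w = "pl x y A / pl x y [:B:]"
    have "vge 0 (fls_deriv ?w)"
    proof (cases "?w = 0 \<or> fls_subdegree ?w \<ge> 0")
      case True
      then have "vge 0 ?w" by (cases "?w = 0") (simp_all only: vge_0 vge_iff simp_thms not_False_eq_True)
      then show ?thesis by (rule vge_deriv_0)
    next
      case False
      then obtain e where "e > 0" "fls_deriv ?w \<noteq> 0 \<longrightarrow> fls_subdegree (fls_deriv ?w) \<ge> e * wt + (e - 1)"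
        using pole[OF localrel(3)[OF l]] unfolding not_le de_Morgan_disj by blast
      moreover have "e * wt \<ge> 0" using X0 \<open>e > 0\<close> by simp
      ultimately have "fls_deriv ?w \<noteq> 0 \<Longrightarrow> fls_subdegree (fls_deriv ?w) \<ge> 0" by linarith
      then show ?thesis by (cases "fls_deriv ?w = 0") (simp_all only: vge_0 vge_iff not_False_eq_True)
    qed
    moreover have "vge (int (order a (B ^ 2))) (pl x y [:B:] ^ 2)"
    proof -
      have "order a (B ^ 2) = order a B + order a B"
        unfolding power2_eq_square by (rule order_mult) (use nz in simp)
      then show ?thesis using localrel(1,2)[OF l] by (simp add: vge_iff power2_eq_square)
    qed
    ultimately have "vge (0 + int (order a (B ^ 2))) (fls_deriv ?w * pl x y [:B:] ^ 2)"
      by (rule vge_mult)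
    moreover have "place x y" using l unfolding local_at_def by blast
    ultimately show ?thesis
      using deriv_fraction[of x y B A] localrel(1)[OF l] local_deriv_x[OF l] by simp
  qed
  have B2: "B ^ 2 \<noteq> 0" using nz by simp
  have "\<exists>G. degree G < p \<and> wronski A B = smult (B ^ 2) G"
    by (rule divide_poly[OF degree_wronski[OF degA] B2]) (rule wr)
  then obtain G where G: "degree G < p" "wronski A B = smult (B ^ 2) G" by blast
  have dG: "fls_deriv (pl x y A / pl x y [:B:]) = pl x y G * fls_deriv x"
    if "place x y" "pl x y [:B:] \<noteq> 0" for x y
  proof -
    have "fls_deriv (pl x y A / pl x y [:B:]) * pl x y [:B:] ^ 2 =
        (pl x y G * fls_deriv x) * pl x y [:B:] ^ 2"
      unfolding deriv_fraction[OF that] G(2) pl_smult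
      by (simp add: rhomD[OF rhom_hev[OF rhom_fls_const]])
    then show ?thesis using that(2) by simp
  qed
  have uG: "fls_deriv u = pl xi yi G * fls_deriv xi"
    unfolding u_def by (rule dG[OF place_inf inf_const_nz[OF nz(1)]])
  then have iG: "pl xi yi G \<noteq> 0" using du by auto
  obtain N H where N: "pl xi yi [:N:] = pl xi yi G * pl xi yi H" "N \<noteq> 0"
    "int (degree N) = - fls_subdegree (pl xi yi G)"
    using ex_norm[of G] iG by blast
  \<comment> \<open>Minimality of the fraction yields a point above \<open>a\<close> where
    \<open>A\<close> does not vanish. There \<open>u\<close> has a pole of order exactly
    \<open>order a B\<close>, which is therefore divisible by \<open>p\<close>.\<close>
  have root: "\<exists>b x y. b ^ p + c * b = a ^ (q + 1) \<and> local_at a b x y \<and> (\<exists>e>0. int (order a B) = int p * e \<and>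
      (pl x y G \<noteq> 0 \<longrightarrow> fls_subdegree (pl x y G) \<ge> e * wt + (e - 1)))" if a: "poly B a = 0" for a
  proof -
    have "\<exists>b. b ^ p + c * b = a ^ (q + 1) \<and> pt a b A \<noteq> 0"
    proof (rule ccontr)
      assume "\<not> ?thesis"
      then obtain A' where "A = smult [:-a, 1:] A'" using divide_linear[OF degA] by blast
      moreover obtain B' where "B = [:-a, 1:] * B'" using a by (auto simp: poly_eq_0_iff_dvd)
      ultimately show False by (rule min)
    qed
    then obtain b where b: "b ^ p + c * b = a ^ (q + 1)" "pt a b A \<noteq> 0" by blast
    obtain x y where l: "local_at a b x y" using ex_local_at[OF b(1)] by blast
    then have "vge 0 (pl x y A) \<and> fls_nth (pl x y A) 0 = pt a b A"
      unfolding local_at_def by blast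
    then have A0: "vge 0 (pl x y A)" "fls_nth (pl x y A) 0 \<noteq> 0" using b(2) by simp_all
    then have sA: "fls_subdegree (pl x y A) = 0" by (intro fls_subdegree_eqI) (auto simp: vge_def)
    have A00: "pl x y A \<noteq> 0" using A0 by auto
    have sw: "fls_subdegree (pl x y A / pl x y [:B:]) = - int (order a B)"
      using localrel(1,2)[OF l] sA A00 by (simp add: fls_divide_subdegree)
    moreover have "order a B > 0" using a nz(1) by (simp add: order_gt_0_iff)
    ultimately obtain e where e: "e > 0" "fls_subdegree (pl x y A / pl x y [:B:]) = - (int p * e)"
      "fls_deriv (pl x y A / pl x y [:B:]) \<noteq> 0 \<longrightarrow>
        fls_subdegree (fls_deriv (pl x y A / pl x y [:B:])) \<ge> e * wt + (e - 1)"
      using pole[OF localrel(3)[OF l]] by (metis neg_less_0_iff_less of_nat_0_less_iff)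
    have pxy: "place x y" using l unfolding local_at_def by blast
    have "fls_deriv (pl x y A / pl x y [:B:]) = pl x y G"
      using dG[OF pxy] localrel(1)[OF l] local_deriv_x[OF l] by simp
    then have "\<exists>e>0. int (order a B) = int p * e \<and>
      (pl x y G \<noteq> 0 \<longrightarrow> fls_subdegree (pl x y G) \<ge> e * wt + (e - 1))"
      using e sw by (intro exI[of _ e]) simp
    with b(1) l show ?thesis by blast
  qed
  \<comment> \<open>At such a point \<open>N\<close> vanishes to order at least \<open>e wt\<close>
    while \<open>B\<close> has order \<open>p e\<close>; the power \<open>p\<close> on
    \<open>N\<close> avoids dividing by \<open>p\<close>.\<close>
  have "B ^ nat wt dvd N ^ p"
  proof (rule dvd_if_order_le)
    show "N ^ p \<noteq> 0" "B ^ nat wt \<noteq> 0" using N(2) nz by simp_all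
    fix a assume "poly (B ^ nat wt) a = 0"
    then have "poly B a = 0" by (simp add: poly_power)
    then obtain b x y e where l: "local_at a b x y" and e: "e > 0" "int (order a B) = int p * e"
      "pl x y G \<noteq> 0 \<longrightarrow> fls_subdegree (pl x y G) \<ge> e * wt + (e - 1)"
      using root by blast
    have pxy: "place x y" using l unfolding local_at_def by blast
    have NGH: "pl x y [:N:] = pl x y G * pl x y H"
      using transfer_eq[OF _ pxy, of "[:N:]" "G * H"] N(1) by (simp only: pl_simps)
    have hN: "pl x y [:N:] \<noteq> 0" "fls_subdegree (pl x y [:N:]) = int (order a N)"
      using local_hev[OF l N(2)] by simp_all
    then have G0: "pl x y G \<noteq> 0" "pl x y H \<noteq> 0" using NGH by auto
    have "vge 0 (pl x y H)" using l unfolding local_at_def by blast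
    then have "fls_subdegree (pl x y H) \<ge> 0" using G0 by (simp add: vge_iff)
    moreover have "int (order a N) = fls_subdegree (pl x y G) + fls_subdegree (pl x y H)"
      using hN NGH G0 by simp
    ultimately have "int (order a N) \<ge> e * wt" using e G0 by linarith
    then have "int p * int (order a N) \<ge> int p * (e * wt)" by (intro mult_left_mono) auto
    then have "int (p * order a N) \<ge> int (nat wt * order a B)"
      using e(2) X0 by (simp add: mult_ac)
    then show "order a (B ^ nat wt) \<le> order a (N ^ p)"
      unfolding order_power[OF nz(1)] order_power[OF N(2)] by (simp only: of_nat_le_iff)
  qed
  then have "degree (B ^ nat wt) \<le> degree (N ^ p)" using N(2) by (intro dvd_imp_degree_le) simp_all
  then have "int (nat wt * degree B) \<le> int (p * degree N)"
    unfolding degree_power_eq[OF N(2)] degree_power_eq[OF nz(1)] of_nat_le_iff .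
  then have dB: "wt * int (degree B) \<le> int p * int (degree N)"
    unfolding of_nat_mult nat_0_le[OF X0] .
  \<comment> \<open>This \<open>g\<close> is not the genus but the canonical degree, twice the genus
    minus 2.\<close>
  define g where "g = int q * (int p - 1) - 2"
  have sdu: "fls_subdegree (fls_deriv u) = - int (degree N) + g"
    unfolding uG using iG dxi N(3) sd_dxi by (simp add: g_def)
  have A0: "pl xi yi A \<noteq> 0" using du by (auto simp: u_def)
  have su: "fls_subdegree (pl xi yi A) = fls_subdegree u - int p * int (degree B)"
    unfolding u_def using A0 inf_const_nz[OF nz(1)] sd_inf_const[OF nz(1)]
    by (simp add: fls_divide_subdegree)
  \<comment> \<open>At infinity \<open>A\<close> has the pole of \<open>u\<close> together with the
    contribution \<open>p deg B\<close> of the denominator. A pole of \<open>u\<close> itself lowers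
    the number of zeros left for \<open>u'\<close>, which outweighs its own contribution.\<close>
  have bound: "wt * - fls_subdegree (pl xi yi A) \<le> int p * (int p * g)"
  proof (cases "fls_subdegree u < 0")
    case True
    then obtain e where e: "e > 0" "fls_subdegree u = - (int p * e)"
      "fls_subdegree (fls_deriv u) \<ge> e * wt + (e - 1)"
      using pole[OF rel] du by auto
    then have "int (degree N) \<le> g - e * wt" using sdu by linarith
    then have "int p * int (degree N) \<le> int p * (g - e * wt)" by (intro mult_left_mono) auto
    then have "wt * int (degree B) \<le> int p * (g - e * wt)" using dB by linarith
    then have 1: "int p * (wt * int (degree B)) \<le> int p * (int p * (g - e * wt))"
      by (intro mult_left_mono) auto
    have "1 * (int p * (e * wt)) \<le> int p * (int p * (e * wt))"
      using p2 e(1) X0 by (intro mult_right_mono) auto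
    with 1 show ?thesis unfolding su e(2) by (simp add: algebra_simps)
  next
    case False
    then have "vge 0 u" using du by (cases "u = 0") (auto simp: vge_iff)
    then have "vge 0 (fls_deriv u)" by (rule vge_deriv_0)
    then have "int (degree N) \<le> g" using du sdu by (simp add: vge_iff)
    then have "int p * int (degree N) \<le> int p * g" by (intro mult_left_mono) auto
    then have "wt * int (degree B) \<le> int p * g" using dB by linarith
    then have 1: "int p * (wt * int (degree B)) \<le> int p * (int p * g)"
      by (intro mult_left_mono) auto
    have "wt * - fls_subdegree (pl xi yi A) \<le> wt * (int p * int (degree B))"
      using False X0 unfolding su by (intro mult_left_mono) auto
    with 1 show ?thesis by (simp add: mult_ac)
  qed
  show ?thesis
  proof (rule that[of G])
    show "degree G < p" "wronski A B = smult (B ^ 2) G" by fact+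
    show "G \<noteq> 0" using iG by (auto simp: pl_simps)
    show "(int r * int p - int r - 2) * - fls_subdegree (pl xi yi A)
        \<le> int p * (int p * (int q * (int p - 1) - 2))"
      using bound by (simp only: wt_def g_def)
    fix a assume a: "poly B a = 0"
    obtain b x y e where b: "b ^ p + c * b = a ^ (q + 1)" and l: "local_at a b x y" and e: "e > 0"
      "pl x y G \<noteq> 0 \<longrightarrow> fls_subdegree (pl x y G) \<ge> e * wt + (e - 1)"
      using root[OF a] by blast
    show "\<exists>b. b ^ p + c * b = a ^ (q + 1) \<and> pt a b G = 0"
    proof (intro exI conjI)
      show "b ^ p + c * b = a ^ (q + 1)" by (rule b)
      have "1 * 1 \<le> e * wt" using e(1) X1 by (intro mult_mono) auto
      then have "vge 1 (pl x y G)" using e by (cases "pl x y G = 0") (auto simp: vge_iff)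
      then have "fls_nth (pl x y G) 0 = 0" unfolding vge_def by simp
      then show "pt a b G = 0" using l unfolding local_at_def by metis
    qed
  qed
qed

end

section \<open>The polynomial identity\<close>

lemma coeff_char_power:
  fixes P :: "'a::{comm_ring_1} poly"
  assumes p: "prime p" "CHAR('a) = p" and r: "r = p ^ l"
  shows "coeff (P ^ r) n = (if r dvd n then coeff P (n div r) ^ r else 0)"
proof (induction P arbitrary: n)
  case 0
  have "r > 0" using r prime_gt_0_nat[OF p(1)] by simp
  then show ?case by (simp add: power_0_left)
next
  case (pCons a P)
  have r0: "r > 0" using r prime_gt_0_nat[OF p(1)] by simp
  have "pCons a P ^ r = ([:a:] + monom 1 1 * P) ^ r"
    by (simp add: monom_altdef)
  also have "\<dots> = [:a:] ^ r + (monom 1 1 * P) ^ r"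
    by (rule freshmans_dream') (use p r in simp_all)
  also have "\<dots> = [:a ^ r:] + monom 1 r * P ^ r"
    by (simp add: power_mult_distrib monom_power poly_const_pow)
  finally have eq: "coeff (pCons a P ^ r) n = coeff [:a ^ r:] n + coeff (monom 1 r * P ^ r) n"
    by simp
  show ?case
  proof (cases "n < r")
    case True
    then show ?thesis unfolding eq using r0
      by (cases "n = 0") (auto simp: coeff_monom_mult coeff_pCons power_0_left dest: dvd_imp_le split: nat.splits)
  next
    case False
    then have "n = (n - r) + r" by simp
    then obtain k where k: "n = k + r" by blast
    have "coeff (monom 1 r * P ^ r) n = coeff (P ^ r) k" by (simp add: coeff_monom_mult k)
    moreover have "coeff [:a ^ r:] n = 0" using r0 k by (auto simp: coeff_pCons split: nat.splits)
    ultimately show ?thesis unfolding eq using r0 by (simp add: pCons.IH k)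
  qed
qed

text \<open>
  After translating a root of \<open>P\<close> to \<open>0\<close>, only \<open>x\<close> and exponents divisible by \<open>p\<close> occur in \<open>P\<close>,
  and among the exponents \<open>2 p^s\<close> only \<open>2 p^l\<close> occurs in \<open>P^(r+1)\<close>.  Comparing the
  coefficients \<open>b s\<close> of \<open>x^(2 p^s)\<close> in \<open>h\<close> gives \<open>b s = 0\<close> for \<open>s < l\<close> but \<open>b s \<noteq> 0\<close> for all
  \<open>s \<ge> l\<close>.
\<close>

lemma artin_schreier_poly_contradiction:
  fixes P h :: "'k::alg_closed_field poly"
  assumes p: "prime p" "CHAR('k) = p" "p > 2" and r: "r = p ^ l" "l > 0" and q: "q = r ^ 2"
    and c: "c \<noteq> 0" and dP: "pderiv P = [:\<gamma>:]" "\<gamma> \<noteq> 0" and degP: "degree P = r"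
    and eq: "P ^ (r + 1) = smult \<mu> (monom 1 (q + 1)) + h ^ p + smult c h"
  shows False
proof -
  have r0: "r > 0" "p dvd r" using r prime_gt_0_nat[OF p(1)] by auto
  obtain t where t: "poly P t = 0" using alg_closed_imp_poly_has_root[of P] degP r0 by auto
  define P1 where "P1 = pcompose P [:t, 1:]"
  define h1 where "h1 = pcompose h [:t, 1:]"
  define a where "a i = coeff P1 i" for i
  define M where "M = pcompose (monom 1 (q + 1)) [:t, 1:]"
  have ptpow: "pcompose (F ^ n) G = pcompose F G ^ n" for F G :: "'k poly" and n
    by (induction n) (simp_all add: pcompose_1 pcompose_mult)
  have eq1: "P1 ^ r * P1 = smult \<mu> M + h1 ^ p + smult c h1"
    using arg_cong[OF eq, of "\<lambda>F. pcompose F [:t, 1:]"]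
    by (simp add: P1_def h1_def M_def ptpow pcompose_add pcompose_smult pcompose_mult mult.commute)
  have a0: "a 0 = 0" using t by (simp add: a_def P1_def pcompose_coeff_0)
  have "pderiv P1 = [:\<gamma>:]" by (simp add: P1_def pderiv_pcompose dP pderiv_pCons)
  then have da: "of_nat (Suc i) * a (Suc i) = (if i = 0 then \<gamma> else 0)" for i
    using coeff_pderiv[of P1 i] by (auto simp: a_def coeff_pCons split: nat.splits)
  have a1: "a 1 = \<gamma>" using da[of 0] by simp
  have ai: "i = 1 \<or> p dvd i" if "a i \<noteq> 0" for i
  proof (cases i)
    case (Suc j)
    have "p dvd Suc j" if "j \<noteq> 0"
    proof -
      have "(of_nat (Suc j) :: 'k) = 0" using da[of j] that \<open>a i \<noteq> 0\<close> Suc by simp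
      then show ?thesis using of_nat_eq_0_iff_char_dvd p(2) by blast
    qed
    then show ?thesis using Suc by auto
  qed simp
  have "degree P1 = r" by (simp add: P1_def degree_pcompose degP)
  then have ar: "a r \<noteq> 0" and abig: "\<And>i. i > r \<Longrightarrow> a i = 0"
    using r0 by (auto simp: a_def coeff_eq_0)
  have coefPr: "coeff (P1 ^ r) n = (if r dvd n then a (n div r) ^ r else 0)" for n
    unfolding a_def by (rule coeff_char_power[OF p(1,2) r(1)])
  \<comment> \<open>In \<open>2 p^s = r i' + j\<close> with \<open>j \<le> r\<close>, the left side
    is too small if \<open>s < l\<close>. Otherwise \<open>r\<close> divides \<open>j\<close>, so
    \<open>j = r\<close> and \<open>i' = 2 p^(s-l) - 1\<close>. If \<open>s > l\<close>, this is
    prime to \<open>p\<close>, so \<open>ai\<close> forces \<open>i' = 1\<close>, which is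
    impossible.\<close>
  have coeff_lhs: "coeff (P1 ^ r * P1) (2 * p ^ s) = (if s = l then \<gamma> ^ r * a r else 0)" for s
  proof -
    have zero: "coeff (P1 ^ r) i * coeff P1 (2 * p ^ s - i) = 0"
      if "i \<le> 2 * p ^ s" and ne: "\<not> (s = l \<and> i = r)" for i
    proof (rule ccontr)
      assume nz: "coeff (P1 ^ r) i * coeff P1 (2 * p ^ s - i) \<noteq> 0"
      then have "coeff (P1 ^ r) i \<noteq> 0" by auto
      then obtain i' where i': "i = r * i'" "a i' \<noteq> 0"
        using r0 by (auto simp: coefPr dvd_def power_0_left split: if_splits)
      define j where "j = 2 * p ^ s - i"
      have j: "a j \<noteq> 0" using nz by (auto simp: a_def j_def)
      have sum: "2 * p ^ s = r * i' + j" using that i' by (simp add: j_def)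
      have i'1: "i' \<ge> 1" using i'(2) a0 by (cases i') auto
      have j1: "j \<ge> 1" using j a0 by (cases j) auto
      have jr: "j \<le> r" using j abig by (meson not_le)
      show False
      proof (cases "s < l")
        case True
        have "2 * p ^ s < p ^ Suc s" using p by simp
        also have "\<dots> \<le> p ^ l" using True p by (intro power_increasing) auto
        also have "\<dots> \<le> r * i'" using i'1 r by simp
        finally show False using sum by simp
      next
        case False
        then have "s = (s - l) + l" by simp
        then have ps: "p ^ s = p ^ (s - l) * r" using r(1) by (metis power_add)
        then have "r dvd r * i' + j" using sum by (metis dvd_triv_right dvd_mult)
        then have "r dvd j" using dvd_add_right_iff[of r "r * i'" j] by simp
        then have jeq: "j = r" using jr j1 dvd_imp_le[of r j] by simp
        have "r * (2 * p ^ (s - l)) = r * (i' + 1)" using sum ps jeq by (simp add: mult.commute)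
        then have ii: "2 * p ^ (s - l) = i' + 1" using r0 by (simp only: mult_cancel1) simp
        show False
        proof (cases "s = l")
          case True
          then show False using ii i' ne by simp
        next
          case ne': False
          then have pp: "p dvd i' + 1" using False ii by (metis dvd_mult dvd_power le_neq_implies_less not_less zero_less_diff)
          have "\<not> p dvd i'"
          proof
            assume "p dvd i'"
            then have "p dvd 1" using pp dvd_add_right_iff by blast
            then show False using p by simp
          qed
          then have "i' = 1" using ai i' by blast
          then have "p ^ (s - l) = 1" using ii by linarith
          then show False using ne' False p by simp
        qed
      qed
    qed
    show ?thesis
    proof (cases "s = l")
      case False
      then show ?thesis unfolding coeff_mult using zero by (simp add: sum.neutral)
    next
      case True
      have "r \<in> {..2 * p ^ s}" using True r by simp
      then have "coeff (P1 ^ r * P1) (2 * p ^ s) =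
          coeff (P1 ^ r) r * coeff P1 (2 * p ^ s - r) +
          (\<Sum>i\<in>{..2 * p ^ s} - {r}. coeff (P1 ^ r) i * coeff P1 (2 * p ^ s - i))"
        unfolding coeff_mult by (subst sum.remove[of _ r]) auto
      also have "(\<Sum>i\<in>{..2 * p ^ s} - {r}. coeff (P1 ^ r) i * coeff P1 (2 * p ^ s - i)) = 0"
        by (rule sum.neutral) (use zero in auto)
      also have "2 * p ^ s - r = r" using True r by simp
      finally show ?thesis using True r0 a1 by (simp add: coefPr a_def[symmetric])
    qed
  qed
  have q_odd: "odd q" "q > 1" "p dvd q"
  proof -
    have "odd p" using p prime_odd_nat by blast
    then show "odd q" using q r by simp
    show "p dvd q" unfolding q power2_eq_square using r0(2) by (rule dvd_mult)
    then show "q > 1" using p q r0 dvd_imp_le[of p q] by simp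
  qed
  \<comment> \<open>\<open>(x + t)^(q+1) = (x^q + t^q) (x + t)\<close> involves only the exponents
    0, 1, \<open>q\<close> and \<open>q + 1\<close>.\<close>
  have coeff_M: "coeff M (2 * p ^ s) = 0" for s
  proof -
    have "[:t, 1:] ^ q = [:t:] ^ q + monom 1 1 ^ q"
    proof -
      have t1: "[:t, 1:] = [:t:] + monom 1 1" by (simp add: monom_altdef)
      have "q = p ^ (l * 2)" using q r by (simp add: power_mult)
      then have "([:t:] + monom 1 1) ^ q = [:t:] ^ q + monom 1 1 ^ q"
        by (intro freshmans_dream') (simp_all add: p)
      then show ?thesis unfolding t1 .
    qed
    moreover have "M = [:t, 1:] ^ q * [:t, 1:]"
      by (simp add: M_def monom_altdef ptpow pcompose_pCons mult.commute)
    ultimately have M: "M = [:t ^ q * t, t ^ q:] + monom t q + monom 1 (q + 1)"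
      by (simp add: poly_const_pow monom_power algebra_simps monom_altdef pCons_one smult_monom)
    have "2 * p ^ s \<noteq> q" using q_odd by auto
    moreover have "2 * p ^ s \<noteq> q + 1"
    proof
      assume s: "2 * p ^ s = q + 1"
      show False
      proof (cases s)
        case 0
        then show False using s q_odd by simp
      next
        case (Suc s')
        then have "p dvd q + 1" by (subst s[symmetric]) simp
        then have "p dvd 1" using q_odd(3) dvd_add_right_iff by blast
        then show False using p by simp
      qed
    qed
    moreover have "2 * p ^ s > 1"
    proof -
      have "p ^ s \<ge> 1" using p(3) by (intro one_le_power) linarith
      then show ?thesis by linarith
    qed
    ultimately show ?thesis unfolding M
    proof -
      define n where "n = 2 * p ^ s"
      assume "2 * p ^ s \<noteq> q" "2 * p ^ s \<noteq> q + 1" "1 < 2 * p ^ s"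
      then have n: "n \<noteq> q" "n \<noteq> q + 1" "1 < n" by (simp_all add: n_def)
      then obtain k where "n = Suc (Suc k)" by (metis less_imp_Suc_add plus_1_eq_Suc add_Suc)
      then have "coeff [:t ^ q * t, t ^ q:] n = 0" by simp
      then show "coeff ([:t ^ q * t, t ^ q:] + monom t q + monom 1 (q + 1)) (2 * p ^ s) = 0"
        using n unfolding n_def[symmetric] by simp
    qed
  qed
  define b where "b s = coeff h1 (2 * p ^ s)" for s
  have coeff_hp: "coeff (h1 ^ p) (2 * p ^ s) = (if s = 0 then 0 else b (s - 1) ^ p)" for s
  proof (cases s)
    case 0
    have "\<not> p dvd 2" using p by (auto dest: dvd_imp_le)
    then show ?thesis using 0 coeff_char_power[OF p(1,2), of p 1 h1 2] by simp
  next
    case (Suc s')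
    then have "2 * p ^ s = p * (2 * p ^ s')" by simp
    then show ?thesis using coeff_char_power[OF p(1,2), of p 1 h1 "2 * p ^ s"] p Suc
      by (simp add: b_def)
  qed
  have rec: "(if s = l then \<gamma> ^ r * a r else 0) = (if s = 0 then 0 else b (s - 1) ^ p) + c * b s" for s
    using arg_cong[OF eq1, of "\<lambda>F. coeff F (2 * p ^ s)"]
    by (simp only: coeff_lhs coeff_add coeff_smult coeff_M coeff_hp b_def) simp
  have low: "b s = 0" if "s < l" for s
    using that
  proof (induction s)
    case 0
    then show ?case using rec[of 0] c by simp
  next
    case (Suc s)
    then show ?case using rec[of "Suc s"] c p by (simp add: power_0_left)
  qed
  have bl: "b l \<noteq> 0"
  proof -
    have "b (l - 1) = 0" using low r(2) by simp
    then have "\<gamma> ^ r * a r = c * b l" using rec[of l] r(2) p by (simp add: power_0_left)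
    then show ?thesis using dP(2) ar by auto
  qed
  \<comment> \<open>Beyond \<open>l\<close> the recursion is \<open>c b(s) = - b(s-1)^p\<close>, so
    nonvanishing propagates.\<close>
  have high: "b (l + k) \<noteq> 0" for k
  proof (induction k)
    case (Suc k)
    then show ?case using rec[of "l + Suc k"] by auto
  qed (simp add: bl)
  have "degree h1 < 2 * p ^ (l + degree h1)"
  proof -
    have "degree h1 < 2 ^ degree h1" by simp
    also have "\<dots> \<le> p ^ degree h1" using p by (intro power_mono) auto
    also have "\<dots> \<le> p ^ (l + degree h1)" using p by (intro power_increasing) auto
    finally show ?thesis by simp
  qed
  then have "b (l + degree h1) = 0" by (simp add: b_def coeff_eq_0)
  then show False using high by blast
qed

text \<open>
  Here \<open>u = A / B\<close> and \<open>u' = G\<close>.  Orders at the infinite place of \<open>K(x)\<close> in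
  \<open>c h' = u^r u' - \<mu> x^q\<close> force \<open>deg u = r\<close> and \<open>G\<close> constant; then \<open>u\<close> has no finite poles and
  the polynomial case applies.
\<close>

lemma artin_schreier_rational_contradiction:
  fixes A B H E G :: "'k::alg_closed_field poly"
  assumes p: "prime p" "CHAR('k) = p" "p > 2" and r: "r = p ^ l" "l > 0" and q: "q = r ^ 2"
    and c: "c \<noteq> 0" and nz: "B \<noteq> 0" "E \<noteq> 0" "G \<noteq> 0"
    and eq: "H ^ p * B ^ (r + 1) + smult c (H * E ^ (p - 1) * B ^ (r + 1))
      + smult \<mu> (monom 1 (q + 1)) * E ^ p * B ^ (r + 1) = A ^ (r + 1) * E ^ p"
    and wronskian: "B * pderiv A - pderiv B * A = B ^ 2 * G"
    and roots: "\<And>a. poly B a = 0 \<Longrightarrow> poly G a = 0"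
  shows False
proof -
  have p0: "p > 0" by (rule prime_gt_0_nat[OF p(1)])
  have r0: "r > 0" "p dvd r" using r p0 by auto
  have rp: "r \<ge> p" using r0 dvd_imp_le by blast
  \<comment> \<open>The expansion of K(x) at its infinite place, with parameter \<open>1/x\<close>:
    orders are negated degrees.\<close>
  define x where "x = (fls_X_inv :: 'k fls)"
  define ev where "ev = hev fls_const x"
  have rh: "rhom ev" unfolding ev_def by (rule rhom_hev[OF rhom_fls_const])
  note ev_simps = rhomD[OF rh]
  have sx: "fls_subdegree x = - 1" by (simp add: x_def)
  have x0: "x \<noteq> 0" using sx by auto
  have dx: "fls_deriv x = - (x ^ 2)" by (simp add: x_def)
  have ev_nz: "ev F \<noteq> 0" "fls_subdegree (ev F) = - int (degree F)" if "F \<noteq> 0" for F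
    using fls_subdegree_hev[of x F] sx that by (simp_all add: ev_def)
  have ev_sm: "ev (smult a F) = fls_const a * ev F" for a F
    by (simp add: ev_def hev_smult rhom_fls_const)
  define u where "u = ev A / ev B"
  define h where "h = ev H / ev E"
  have main: "ev H ^ p * ev B ^ (r + 1) + fls_const c * (ev H * ev E ^ (p - 1) * ev B ^ (r + 1))
      + fls_const \<mu> * x ^ (q + 1) * ev E ^ p * ev B ^ (r + 1) = ev A ^ (r + 1) * ev E ^ p"
  proof -
    have "ev (monom 1 (q + 1)) = x ^ (q + 1)" by (simp add: ev_def hev_monom rhom_fls_const)
    then show ?thesis using arg_cong[OF eq, of ev] by (simp only: ev_simps ev_sm)
  qed
  have EE: "ev E * ev E ^ (p - 1) = ev E ^ p" using p0 by (metis power_eq_if not_gr_zero)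
  have hE: "ev H = h * ev E" and uB: "u * ev B = ev A"
    using ev_nz(1)[OF nz(1)] ev_nz(1)[OF nz(2)] by (simp_all add: u_def h_def)
  have k1: "ev H ^ p = h ^ p * ev E ^ p" unfolding hE by (rule power_mult_distrib)
  have k2: "ev H * ev E ^ (p - 1) = h * ev E ^ p" unfolding hE EE[symmetric] by (rule mult.assoc)
  have k3: "ev A ^ (r + 1) = u ^ (r + 1) * ev B ^ (r + 1)"
    unfolding uB[symmetric] by (rule power_mult_distrib)
  have "(h ^ p + fls_const c * h + fls_const \<mu> * x ^ (q + 1)) * (ev E ^ p * ev B ^ (r + 1))
      = u ^ (r + 1) * (ev E ^ p * ev B ^ (r + 1))"
    using main unfolding k1 k2 k3 by (simp only: distrib_left distrib_right mult_ac)
  moreover have nzEB: "ev E ^ p * ev B ^ (r + 1) \<noteq> 0"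
    using ev_nz(1)[OF nz(1)] ev_nz(1)[OF nz(2)] by simp
  ultimately have "h ^ p + fls_const c * h + fls_const \<mu> * x ^ (q + 1) = u ^ (r + 1)"
    unfolding mult_right_cancel[OF nzEB] by blast
  then have rel: "h ^ p + fls_const c * h = u ^ (r + 1) - fls_const \<mu> * x ^ (q + 1)"
    by (simp only: eq_diff_eq)
  have du: "fls_deriv u = ev G * fls_deriv x"
  proof -
    have d: "fls_deriv (ev F) = ev (pderiv F) * fls_deriv x" for F
      unfolding ev_def by (rule fls_deriv_hev)
    have "fls_deriv (u * ev B) = fls_deriv (ev A)" by (simp only: uB)
    then have "fls_deriv u * ev B = (ev (pderiv A) - u * ev (pderiv B)) * fls_deriv x"
      by (simp add: d algebra_simps)
    then have "fls_deriv u * ev B * ev B = (ev (pderiv A) - u * ev (pderiv B)) * fls_deriv x * ev B"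
      by (rule arg_cong)
    also have "\<dots> = (ev B * ev (pderiv A) - ev (pderiv B) * (u * ev B)) * fls_deriv x"
      by (simp only: algebra_simps)
    also have "\<dots> = ev (B ^ 2 * G) * fls_deriv x"
      unfolding uB wronskian[symmetric] by (simp only: ev_simps)
    also have "\<dots> = (ev G * fls_deriv x) * ev B * ev B"
      by (simp only: ev_simps power2_eq_square mult_ac)
    finally show ?thesis using ev_nz(1)[OF nz(1)] by simp
  qed
  define g where "g = int (degree G)"
  define N where "N = - fls_subdegree u"
  have sdx: "fls_subdegree (fls_deriv x) = - 2" "fls_deriv x \<noteq> 0"
    using x0 sx unfolding dx by (simp_all add: fls_subdegree_power_field)
  have sdu: "fls_subdegree (fls_deriv u) = - g - 2" "fls_deriv u \<noteq> 0"
    unfolding du using ev_nz[OF nz(3)] sdx by (simp_all add: g_def)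
  have u0: "u \<noteq> 0" using sdu(2) by auto
  have Ng: "N \<ge> g + 1"
    using vge_deriv[of "- N" u] u0 sdu by (simp add: vge_iff N_def)
  have g0: "g \<ge> 0" by (simp add: g_def)
  have N1: "N \<ge> 1" using Ng g0 by simp
  have su: "fls_subdegree (u ^ (r + 1)) = - ((int r + 1) * N)"
    by (simp only: fls_subdegree_power_field N_def) simp
  have sxq: "fls_subdegree (fls_const \<mu> * x ^ (q + 1)) = - (int q + 1)" "fls_const \<mu> * x ^ (q + 1) \<noteq> 0"
    if "\<mu> \<noteq> 0"
    using that x0 sx by (simp_all add: fls_subdegree_power_field)
  have qr: "int q = int r * int r" by (simp add: q power2_eq_square)
  have q1: "int q + 1 = (int r + 1) * (int r - 1) + 2" by (simp add: qr algebra_simps)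
  \<comment> \<open>Since \<open>q = r^2\<close>, the number \<open>q + 1\<close> is congruent to 2
    modulo \<open>r + 1\<close>.\<close>
  have ne: "(int r + 1) * N \<noteq> int q + 1"
  proof
    assume "(int r + 1) * N = int q + 1"
    then have "(int r + 1) * (N - (int r - 1)) = 2" using q1 by (simp add: algebra_simps)
    then have "int r + 1 dvd 2" by (metis dvd_triv_left)
    then have "int r + 1 \<le> 2" by (rule zdvd_imp_le) simp
    then show False using rp p(3) by linarith
  qed
  define M where "M = - fls_subdegree h"
  have lhs: "M > 0 \<and> fls_subdegree (h ^ p + fls_const c * h) = - (int p * M)"
    if neg: "fls_subdegree (h ^ p + fls_const c * h) < 0"
  proof -
    have h0: "h \<noteq> 0" using neg p0 by (auto simp: power_0_left)
    have s1: "fls_subdegree (h ^ p) = - (int p * M)" by (simp add: fls_subdegree_power_field M_def)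
    have s2: "fls_subdegree (fls_const c * h) = - M" using h0 c by (simp add: M_def)
    have M0: "M > 0"
    proof (rule ccontr)
      assume "\<not> M > 0"
      then have "fls_subdegree h \<ge> 0" by (simp add: M_def)
      then have "int p * fls_subdegree h \<ge> 0" by simp
      then have hv: "vge 0 (h ^ p)" using h0 by (subst vge_iff) (simp_all add: fls_subdegree_power_field)
      have "vge 0 (fls_const c * h)"
        using h0 c s2 \<open>\<not> M > 0\<close> by (subst vge_iff) simp_all
      note hv = hv this
      then have "vge 0 (h ^ p + fls_const c * h)" by (intro vge_add)
      moreover have "h ^ p + fls_const c * h \<noteq> 0" using neg by auto
      ultimately show False using neg by (simp add: vge_iff)
    qed
    have "1 * M < int p * M" using M0 p(3) by (intro mult_strict_right_mono) auto
    then have "fls_subdegree (h ^ p) < fls_subdegree (fls_const c * h)" unfolding s1 s2 by simp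
    then show ?thesis using fls_subdegree_add_eq1[of "h ^ p" "fls_const c * h"] h0 s1 M0 by simp
  qed
  \<comment> \<open>If \<open>x^(q+1)\<close> dominated the right side, \<open>p\<close> would
    divide \<open>q + 1\<close>, because a pole of \<open>h^p + c h\<close> has order divisible by
    \<open>p\<close>.\<close>
  have not_q: "\<not> (\<mu> \<noteq> 0 \<and> (int r + 1) * N < int q + 1)"
  proof
    assume a: "\<mu> \<noteq> 0 \<and> (int r + 1) * N < int q + 1"
    then have "fls_subdegree (u ^ (r + 1) - fls_const \<mu> * x ^ (q + 1)) = - (int q + 1)"
      using fls_subdegree_diff_eq2[of "fls_const \<mu> * x ^ (q + 1)" "u ^ (r + 1)"] sxq su by simp
    then have "int p * M = int q + 1" using lhs unfolding rel by simp
    then have "int p dvd int q + 1" by (metis dvd_triv_left)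
    moreover have "int p dvd int q" using r0(2) by (simp add: qr)
    ultimately have "int p dvd 1" by (simp only: dvd_add_right_iff)
    then show False using p(3) by simp
  qed
  have "fls_subdegree (u ^ (r + 1) - fls_const \<mu> * x ^ (q + 1)) = - ((int r + 1) * N)"
  proof (cases "\<mu> = 0")
    case False
    then have "int q + 1 < (int r + 1) * N" using not_q ne by linarith
    then show ?thesis
      using fls_subdegree_diff_eq1[of "u ^ (r + 1)" "fls_const \<mu> * x ^ (q + 1)"] sxq[OF False] su u0 by simp
  next
    case True
    then show ?thesis using su by simp
  qed
  moreover have "(int r + 1) * N > 0" using N1 by (intro mult_pos_pos) auto
  ultimately have M: "M > 0" "int p * M = (int r + 1) * N" using lhs unfolding rel by simp_all
  \<comment> \<open>\<open>T\<close> is the pole order of \<open>u^r u'\<close>; the summand 2 comes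
    from \<open>x' = - x^2\<close>. The pole of \<open>h'\<close> is smaller, so
    \<open>u^r u'\<close> must be cancelled by \<open>\<mu> x^q x'\<close>, which forces
    \<open>T = q + 2\<close>.\<close>
  define T where "T = int r * N + g + 2"
  have "3 * M \<le> int p * M" using p(3) M(1) by (intro mult_right_mono) auto
  moreover have "1 * N \<le> int r * N" using N1 r0 by (intro mult_right_mono) auto
  ultimately have "3 * M \<le> 2 * (int r * N)" using M(2) by (simp add: algebra_simps)
  then have MT: "M + 1 < T" using N1 g0 \<open>1 * N \<le> int r * N\<close> unfolding T_def by linarith
  have hd: "fls_const c * fls_deriv h = u ^ r * fls_deriv u - fls_const \<mu> * (x ^ q * fls_deriv x)"
  proof -
    have "p dvd q" using r0(2) by (simp add: q power2_eq_square)
    have "fls_deriv (h ^ p + fls_const c * h) = fls_const c * fls_deriv h"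
      using p(2) by simp
    moreover have "fls_deriv (u ^ (r + 1)) = u ^ r * fls_deriv u"
      using p(2) r0(2) by (simp add: mult.commute)
    moreover have "fls_deriv (fls_const \<mu> * x ^ (q + 1)) = fls_const \<mu> * (x ^ q * fls_deriv x)"
      using p(2) \<open>p dvd q\<close> by (simp add: mult.commute)
    ultimately show ?thesis using arg_cong[OF rel, of fls_deriv] by (simp only: fls_deriv_sub)
  qed
  have s1: "fls_subdegree (u ^ r * fls_deriv u) = - T" "u ^ r * fls_deriv u \<noteq> 0"
    using u0 sdu by (simp_all add: fls_subdegree_power_field N_def T_def)
  have hv: "vge (- M - 1) (fls_const c * fls_deriv h)"
  proof -
    have "h \<noteq> 0" using M(1) by (auto simp: M_def)
    then have "vge (- M) h" by (simp add: vge_iff M_def)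
    then have "vge (0 + (- M - 1)) (fls_const c * fls_deriv h)"
      by (intro vge_mult vge_deriv) (simp add: vge_def)
    then show ?thesis by simp
  qed
  have not_big: "\<not> (\<exists>w. w \<noteq> 0 \<and> fls_const c * fls_deriv h = w \<and> fls_subdegree w \<le> - T)"
    using hv MT by (auto simp: vge_iff)
  have l0: "\<mu> \<noteq> 0"
  proof
    assume "\<mu> = 0"
    then have "fls_const c * fls_deriv h = u ^ r * fls_deriv u" using hd by simp
    then show False using not_big s1 by auto
  qed
  have s2: "fls_subdegree (fls_const \<mu> * (x ^ q * fls_deriv x)) = - (int q + 2)"
    "fls_const \<mu> * (x ^ q * fls_deriv x) \<noteq> 0"
    using l0 x0 sdx sx by (simp_all add: fls_subdegree_power_field)
  have "T = int q + 2"
  proof (rule ccontr)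
    assume "T \<noteq> int q + 2"
    then consider "- T < - (int q + 2)" | "- (int q + 2) < - T" by linarith
    then have "fls_subdegree (fls_const c * fls_deriv h) \<le> - T"
    proof cases
      case 1
      then show ?thesis unfolding hd using fls_subdegree_diff_eq1[OF s1(2)] s1 s2 by simp
    next
      case 2
      then show ?thesis unfolding hd using fls_subdegree_diff_eq2[OF s2(2)] s1 s2 by simp
    qed
    moreover from this have "fls_const c * fls_deriv h \<noteq> 0" using MT M(1) by (intro notI) simp
    ultimately show False using not_big by blast
  qed
  then have rNg: "int r * N + g = int r * int r" by (simp add: T_def qr)
  \<comment> \<open>This gives \<open>N \<ge> r\<close>, after which \<open>r N + g = r^2\<close>
    leaves only \<open>N = r\<close> and \<open>g = 0\<close>.\<close>
  have "(int r + 1) * N > int q + 1" using not_q l0 ne by linarith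
  then have "(int r + 1) * N > (int r + 1) * (int r - 1)" using q1 by linarith
  then have "N > int r - 1" by (simp add: mult_less_cancel_left)
  then have "int r * int r \<le> int r * N" by (intro mult_left_mono) auto
  then have g: "g = 0" and "int r * N = int r * int r" using rNg g0 by linarith+
  then have N: "N = int r" using r0 by simp
  obtain \<gamma> where G: "G = [:\<gamma>:]" "\<gamma> \<noteq> 0"
    using g nz(3) by (metis g_def degree_eq_zeroE of_nat_eq_0_iff pCons_0_0)
  have "degree B = 0"
  proof (rule ccontr)
    assume "degree B \<noteq> 0"
    then obtain a where "poly B a = 0" using alg_closed_imp_poly_has_root[of B] by auto
    then show False using roots[of a] G by simp
  qed
  then obtain \<beta> where B: "B = [:\<beta>:]" "\<beta> \<noteq> 0" using nz(1) by (metis degree_eq_zeroE pCons_0_0)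
  define P where "P = smult (1 / \<beta>) A"
  have A: "A = smult \<beta> P" using B by (simp add: P_def)
  have dP: "pderiv P = [:\<gamma>:]"
  proof -
    have "smult (\<beta> * \<beta>) (pderiv P) = [:\<gamma> * (\<beta> * \<beta>):]"
      using wronskian B G by (simp add: A pderiv_smult pderiv_pCons power2_eq_square)
    then have "smult (1 / (\<beta> * \<beta>)) (smult (\<beta> * \<beta>) (pderiv P)) = [:\<gamma>:]"
      using B(2) by simp
    then show ?thesis using B(2) by simp
  qed
  have A0: "A \<noteq> 0" using u0 by (auto simp: u_def ev_simps)
  have "fls_subdegree u = - int (degree A)"
    unfolding u_def using ev_nz[OF A0] ev_nz[OF nz(1)] B by (simp add: fls_divide_subdegree)
  then have degP: "degree P = r" using N B by (simp add: N_def P_def)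
  have eqP: "H ^ p + smult c (H * E ^ (p - 1)) + smult \<mu> (monom 1 (q + 1)) * E ^ p = P ^ (r + 1) * E ^ p"
  proof -
    have "B ^ (r + 1) * (H ^ p + smult c (H * E ^ (p - 1)) + smult \<mu> (monom 1 (q + 1)) * E ^ p)
        = B ^ (r + 1) * (P ^ (r + 1) * E ^ p)"
    proof -
      have "A = B * P" by (simp add: A B)
      then have "A ^ (r + 1) = B ^ (r + 1) * P ^ (r + 1)" by (simp only: power_mult_distrib)
      then show ?thesis using eq by (simp only: distrib_left mult_smult_right mult_ac)
    qed
    moreover have nzB: "B ^ (r + 1) \<noteq> 0" using nz(1) by simp
    ultimately show ?thesis unfolding mult_left_cancel[OF nzB] by blast
  qed
  \<comment> \<open>\<open>H/E\<close> satisfies a monic equation over K[x]. At a pole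
    \<open>a\<close> every term except \<open>H^p\<close> would be divisible by \<open>X - a\<close>
    to the power \<open>p * order a H + 1\<close>.\<close>
  have "E dvd H"
  proof (cases "H = 0")
    case False
    show ?thesis
    proof (rule dvd_if_order_le[OF False nz(2)])
      fix a
      show "order a E \<le> order a H"
      proof (rule ccontr)
        assume "\<not> order a E \<le> order a H"
        then have less: "order a H + 1 \<le> order a E" by simp
        let ?L = "[:-a, 1:] ^ (p * order a H + 1)"
        have oE: "order a (E ^ n) = n * order a E" for n by (rule order_power[OF nz(2)])
        have "p * order a H + 1 \<le> p * order a E"
        proof -
          have "p * (order a H + 1) \<le> p * order a E" using less by (rule mult_le_mono2)
          then show ?thesis using p0 by (simp add: distrib_left)
        qed
        then have "?L dvd E ^ p" unfolding order_divides oE by blast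
        have "order a (H * E ^ (p - 1)) = order a H + (p - 1) * order a E"
          using False nz(2) oE by (subst order_mult) simp_all
        moreover have "(p - 1) * (order a H + 1) \<le> (p - 1) * order a E"
          using less by (rule mult_le_mono2)
        moreover have "p * order a H + 1 \<le> order a H + (p - 1) * (order a H + 1)"
          using p(3) by (cases p) auto
        ultimately have "p * order a H + 1 \<le> order a (H * E ^ (p - 1))" by linarith
        then have "?L dvd H * E ^ (p - 1)" unfolding order_divides by blast
        then have "?L dvd P ^ (r + 1) * E ^ p - smult c (H * E ^ (p - 1)) - smult \<mu> (monom 1 (q + 1)) * E ^ p"
          by (intro dvd_diff dvd_mult[OF \<open>?L dvd E ^ p\<close>] dvd_smult[OF \<open>?L dvd H * E ^ (p - 1)\<close>])
        also have "\<dots> = H ^ p" unfolding eqP[symmetric] by simp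
        finally have "H ^ p = 0 \<or> p * order a H + 1 \<le> order a (H ^ p)"
          unfolding order_divides .
        then show False using order_power[OF False, of a p] False by simp
      qed
    qed
  qed simp
  then obtain h0 where h0: "H = E * h0" by (auto simp: dvd_def)
  have "E ^ p * (h0 ^ p + smult c h0 + smult \<mu> (monom 1 (q + 1))) = E ^ p * P ^ (r + 1)"
  proof -
    have "E * E ^ (p - 1) = E ^ p" using p0 by (metis power_eq_if not_gr_zero)
    then have "H * E ^ (p - 1) = E ^ p * h0" unfolding h0 by (metis mult.assoc mult.commute)
    then show ?thesis using eqP unfolding h0
      by (simp only: power_mult_distrib distrib_left mult_smult_left mult_smult_right mult_ac)
  qed
  moreover have nzE: "E ^ p \<noteq> 0" using nz(2) by simp
  ultimately have "h0 ^ p + smult c h0 + smult \<mu> (monom 1 (q + 1)) = P ^ (r + 1)"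
    unfolding mult_left_cancel[OF nzE] by blast
  then have "P ^ (r + 1) = smult \<mu> (monom 1 (q + 1)) + h0 ^ p + smult c h0"
    by (simp only: add_ac)
  then show False
    by (rule artin_schreier_poly_contradiction[OF p r q c dP G(2) degP])
qed

section \<open>Reduction to rational functions in \<open>x\<close>\<close>

text \<open>Only exponents divisible by \<open>p\<close> survive, and the coefficients have p-th
  roots in \<open>K\<close>.\<close>

lemma pderiv_0_imp_char_power:
  fixes A :: "'k::alg_closed_field poly"
  assumes p: "prime p" "CHAR('k) = p" and "pderiv A = 0"
  shows "\<exists>\<alpha>. A = \<alpha> ^ p"
proof -
  have p0: "p > 0" by (rule prime_gt_0_nat[OF p(1)])
  obtain g :: "'k \<Rightarrow> 'k" where g: "\<And>z. g z ^ p = z"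
    using nth_root_exists[OF p0] by metis
  define \<alpha> where "\<alpha> = (\<Sum>i\<le>degree A. monom (g (coeff A (p * i))) i)"
  have ca: "coeff \<alpha> i = (if i \<le> degree A then g (coeff A (p * i)) else 0)" for i
    by (simp add: \<alpha>_def coeff_sum)
  have "coeff A n = coeff (\<alpha> ^ p) n" for n
  proof (cases "p dvd n")
    case True
    then obtain i where i: "n = p * i" by (auto simp: dvd_def)
    have "coeff (\<alpha> ^ p) n = coeff \<alpha> i ^ p"
      using coeff_char_power[OF p, of p 1 \<alpha> n] p0 i by simp
    also have "\<dots> = coeff A n"
    proof (cases "i \<le> degree A")
      case False
      moreover have "i \<le> n" using i p0 by simp
      ultimately have "coeff A n = 0" by (intro coeff_eq_0) simp
      then show ?thesis using False p0 by (simp add: ca power_0_left)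
    qed (simp add: ca g i)
    finally show ?thesis by simp
  next
    case False
    then obtain j where j: "n = Suc j" by (cases n) auto
    have "of_nat n * coeff A n = 0" using assms(3) coeff_pderiv[of A j] j by simp
    moreover have "(of_nat n :: 'k) \<noteq> 0" using False p(2) of_nat_eq_0_iff_char_dvd by blast
    ultimately have "coeff A n = 0" by simp
    then show ?thesis using coeff_char_power[OF p, of p 1 \<alpha> n] False by simp
  qed
  then have "A = \<alpha> ^ p" by (rule poly_eqI)
  then show ?thesis by blast
qed

lemma char_power_inj:
  fixes a b :: "'a::idom"
  assumes "prime p" "CHAR('a) = p" "a ^ p = b ^ p"
  shows "a = b"
proof -
  have "a ^ p = ((a - b) + b) ^ p" by simp
  also have "\<dots> = (a - b) ^ p + b ^ p" by (rule freshmans_dream) (use assms in simp_all)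
  finally have "(a - b) ^ p = 0" using assms(3) by simp
  then show ?thesis using power_not_zero[of "a - b" p] by auto
qed

context AS_curve_inf
begin

text \<open>The function field inside K((t)). Denominators in K[x] suffice, since multiplying by
  conjugates turns any denominator into its norm.\<close>

definition LL :: "'k fls set" where
  "LL = {pl xi yi A / pl xi yi [:B:] | A B. B \<noteq> 0}"

lemma LL_fraction:
  assumes "pl xi yi H \<noteq> 0"
  shows "pl xi yi G / pl xi yi H \<in> LL"
proof -
  obtain N K where N: "pl xi yi [:N:] = pl xi yi H * pl xi yi K" "N \<noteq> 0" "pl xi yi K \<noteq> 0"
    using ex_norm[of H] assms by blast
  have "pl xi yi (G * K) / pl xi yi [:N:] = pl xi yi G / pl xi yi H"
    unfolding N(1) pl_simps using N(3) by simp
  then show ?thesis unfolding LL_def using N(2) by (metis (mono_tags, lifting) mem_Collect_eq)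
qed

text \<open>
  If \<open>y^d\<close> has top coefficient \<open>L\<close> in \<open>a\<close>, then \<open>a' = 0\<close> forces \<open>L' = 0\<close>; the top term can then be
  traded for a \<open>p\<close>-th power because \<open>y - x^(q+1)/c = - y^p/c\<close>.
\<close>

lemma reduced_char_power:
  "degree a < p \<Longrightarrow> fls_deriv (pl xi yi a) = 0 \<Longrightarrow> \<exists>g. pl xi yi a = pl xi yi g ^ p"
proof (induction "degree a" arbitrary: a rule: less_induct)
  case less
  define d where "d = degree a"
  have "pl xi yi (D a) = 0" using less.prems(2) dxi unfolding deriv_pl[OF place_inf] by simp
  then have "D a = 0" using degree_D[OF less.prems(1)] by (intro reduced_0)
  \<comment> \<open>In top \<open>y\<close>-degree the derivation acts on the coefficient alone,
    because differentiating a power of \<open>y\<close> lowers the degree.\<close>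
  then have "coeff (D a) d = 0" by simp
  moreover have "coeff a (Suc d) = 0" unfolding d_def by (rule coeff_eq_0) simp
  ultimately have "pderiv (coeff a d) = 0" by (simp add: D_def xyderiv_def coeff_map_poly coeff_pderiv)
  then obtain \<alpha> where \<alpha>: "coeff a d = \<alpha> ^ p"
    using pderiv_0_imp_char_power[OF prime_p char_p] by blast
  show ?case
  proof (cases "d = 0")
    case True
    then have "a = [:\<alpha> ^ p:]" using \<alpha> unfolding d_def by (metis degree_0_id coeff_pCons_0 degree_eq_zeroE)
    then have "pl xi yi a = pl xi yi [:\<alpha>:] ^ p"
      by (simp only: pl_const rhomD[OF rhom_hev[OF rhom_fls_const]])
    then show ?thesis by blast
  next
    case False
    \<comment> \<open>\<open>T\<close> is monic in \<open>y\<close>, so a multiple of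
      \<open>T^d\<close> removes the top term, and on the curve it equals
      \<open>- y^p / c\<close>.\<close>
    define T where "T = [:- monom (1 / c) (q + 1), 1:]"
    define b where "b = a - smult (coeff a d) (T ^ d)"
    have degT: "degree (T ^ d) = d" "coeff (T ^ d) d = 1"
    proof -
      have "T \<noteq> 0" "degree T = 1" "lead_coeff T = 1" by (simp_all add: T_def)
      then show "degree (T ^ d) = d" by (simp add: degree_power_eq)
      then show "coeff (T ^ d) d = 1" using lead_coeff_power[of T d] \<open>lead_coeff T = 1\<close> by simp
    qed
    have "degree b < d"
    proof (rule degree_lessI)
      fix i assume "i \<ge> d"
      then consider "i = d" | "i > d" by linarith
      then show "coeff b i = 0"
      proof cases
        case 2
        then have "coeff a i = 0" "coeff (T ^ d) i = 0"
          using degT by (auto intro!: coeff_eq_0 simp: d_def)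
        then show ?thesis by (simp add: b_def)
      qed (simp add: b_def degT)
    qed (use False in simp)
    obtain \<kappa> where \<kappa>: "\<kappa> ^ p = (- (1 / c)) ^ d"
      using nth_root_exists[OF prime_gt_0_nat[OF prime_p]] by metis
    have T: "pl xi yi T = fls_const (- (1 / c)) * yi ^ p"
    proof -
      have "pl xi yi T = yi - fls_const (1 / c) * xi ^ (q + 1)"
        by (simp add: T_def pl_pCons pl_simps hev_monom rhom_fls_const
            rhomD[OF rhom_hev[OF rhom_fls_const]])
      also have "xi ^ (q + 1) = yi ^ p + fls_const c * yi" using place_inf by (simp add: place_def)
      also have "yi - fls_const (1 / c) * (yi ^ p + fls_const c * yi) =
          yi - (fls_const (1 / c) * fls_const c) * yi - fls_const (1 / c) * yi ^ p"
        by (simp only: algebra_simps)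
      also have "fls_const (1 / c) * fls_const c = 1" using c_nz by simp
      finally show ?thesis by simp
    qed
    define W where "W = monom (smult \<kappa> \<alpha>) d"
    have W: "pl xi yi (smult (coeff a d) (T ^ d)) = pl xi yi W ^ p"
    proof -
      have "pl xi yi (smult (coeff a d) (T ^ d)) =
          hev fls_const xi \<alpha> ^ p * (fls_const ((- (1 / c)) ^ d) * (yi ^ d) ^ p)"
        unfolding pl_smult pl_simps T \<alpha> rhomD(7)[OF rhom_hev[OF rhom_fls_const]]
        by (simp only: power_mult_distrib fls_const_power power_commutes mult.commute flip: power_mult)
      also have "\<dots> = (hev fls_const xi \<alpha> * (fls_const \<kappa> * yi ^ d)) ^ p"
        unfolding \<kappa>[symmetric] fls_const_power by (simp only: power_mult_distrib)
      also have "hev fls_const xi \<alpha> * (fls_const \<kappa> * yi ^ d) = pl xi yi W"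
        by (simp add: W_def pl_monom hev_smult rhom_fls_const mult_ac)
      finally show ?thesis .
    qed
    have ab: "pl xi yi a = pl xi yi b + pl xi yi W ^ p"
      unfolding b_def W[symmetric] pl_simps by simp
    have "fls_deriv (pl xi yi W ^ p) = 0" by (rule fls_deriv_char_power) (simp add: char_p)
    then have "fls_deriv (pl xi yi b) = 0" using less.prems(2) unfolding ab by simp
    moreover have "degree b < degree a" using \<open>degree b < d\<close> by (simp add: d_def)
    ultimately obtain g where "pl xi yi b = pl xi yi g ^ p"
      using less.hyps[of b] less.prems(1) by (meson order.strict_trans)
    then have "pl xi yi a = pl xi yi (g + W) ^ p" unfolding ab pl_simps frob by simp
    then show ?thesis by blast
  qed
qed

text \<open>Multiplying by \<open>B^p\<close>, whose derivative is 0, reduces the claim to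
  polynomials.\<close>

lemma LL_char_power:
  assumes "w \<in> LL" "fls_deriv w = 0"
  shows "\<exists>w1\<in>LL. w = w1 ^ p"
proof -
  obtain A B where w: "w = pl xi yi A / pl xi yi [:B:]" and B: "B \<noteq> 0"
    using assms(1) unfolding LL_def by blast
  have B0: "pl xi yi [:B:] \<noteq> 0" by (rule inf_const_nz[OF B])
  have pp: "pl xi yi [:B:] * pl xi yi [:B:] ^ (p - 1) = pl xi yi [:B:] ^ p"
    using prime_gt_0_nat[OF prime_p] by (metis power_eq_if not_gr_zero)
  have "pl xi yi A = w * pl xi yi [:B:]" using w B0 by simp
  then have wB: "pl xi yi (A * [:B:] ^ (p - 1)) = w * pl xi yi [:B:] ^ p"
    unfolding pl_simps pp[symmetric] by (simp only: mult.assoc)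
  have "fls_deriv (pl xi yi [:B:] ^ p) = 0" by (rule fls_deriv_char_power) (simp add: char_p)
  then have d0: "fls_deriv (pl xi yi (A * [:B:] ^ (p - 1))) = 0"
    unfolding wB fls_deriv_mult assms(2) by simp
  obtain a where a: "degree a < p" "pl xi yi (A * [:B:] ^ (p - 1)) = pl xi yi a"
    using obtain_reduced place_inf by metis
  then obtain g where "pl xi yi a = pl xi yi g ^ p" using reduced_char_power d0 by metis
  then have "w * pl xi yi [:B:] ^ p = pl xi yi g ^ p" using a(2) wB by simp
  then have "w = (pl xi yi g / pl xi yi [:B:]) ^ p" using B0 by (simp add: power_divide field_simps)
  moreover have "pl xi yi g / pl xi yi [:B:] \<in> LL" unfolding LL_def using B by blast
  ultimately show ?thesis by blast
qed

text \<open>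
  Taking \<open>p\<close>-th roots of a solution with \<open>u' = 0\<close> divides the order of \<open>u - \<kappa>\<close> by \<open>p\<close>, so the
  descent ends.
\<close>

lemma separable_solution:
  assumes r: "p dvd r"
    and "u \<in> LL" "v \<in> LL" "v ^ p + fls_const c * v = u ^ (r + 1)" "fls_subdegree (u - fls_const \<kappa>) \<noteq> 0"
  shows "\<exists>u1\<in>LL. \<exists>v1\<in>LL. v1 ^ p + fls_const c * v1 = u1 ^ (r + 1) \<and> fls_deriv u1 \<noteq> 0"
  using assms(2-)
proof (induction "nat \<bar>fls_subdegree (u - fls_const \<kappa>)\<bar>" arbitrary: u v \<kappa> rule: less_induct)
  case less
  show ?case
  proof (cases "fls_deriv u = 0")
    case True
    have "fls_const c * fls_deriv v = u ^ r * fls_deriv u"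
      by (rule fls_artin_schreier_deriv[OF char_p r less.prems(3)])
    then have "fls_deriv v = 0" using True c_nz by simp
    then obtain v1 where v1: "v1 \<in> LL" "v = v1 ^ p" using LL_char_power less.prems(2) by blast
    obtain u1 where u1: "u1 \<in> LL" "u = u1 ^ p" using LL_char_power less.prems(1) True by blast
    have chf: "CHAR('k fls) = p" using char_p by simp
    \<comment> \<open>The two sides agree after raising to the power \<open>p\<close>, by
      \<open>c^p = c\<close>, and the Frobenius map is injective.\<close>
    have rel: "v1 ^ p + fls_const c * v1 = u1 ^ (r + 1)"
    proof (rule char_power_inj[OF prime_p chf])
      have "(v1 ^ p + fls_const c * v1) ^ p = v ^ p + fls_const (c ^ p) * v"
        unfolding frob power_mult_distrib v1(2) fls_const_power ..
      also have "\<dots> = u ^ (r + 1)" using less.prems(3) by (simp only: cp)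
      also have "\<dots> = (u1 ^ (r + 1)) ^ p" unfolding u1(2) by (simp only: mult.commute flip: power_mult)
      finally show "(v1 ^ p + fls_const c * v1) ^ p = (u1 ^ (r + 1)) ^ p" .
    qed
    obtain \<kappa>1 where \<kappa>1: "\<kappa>1 ^ p = \<kappa>"
      using nth_root_exists[OF prime_gt_0_nat[OF prime_p]] by metis
    have "u1 ^ p = (u1 - fls_const \<kappa>1) ^ p + fls_const \<kappa>1 ^ p"
      using frob(2)[of "u1 - fls_const \<kappa>1" "fls_const \<kappa>1"] by simp
    then have "u - fls_const \<kappa> = (u1 - fls_const \<kappa>1) ^ p"
      unfolding u1(2) \<kappa>1[symmetric] fls_const_power by simp
    then have s: "fls_subdegree (u - fls_const \<kappa>) = int p * fls_subdegree (u1 - fls_const \<kappa>1)"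
      by (simp only: fls_subdegree_power_field)
    then have n0: "fls_subdegree (u1 - fls_const \<kappa>1) \<noteq> 0" using less.prems(4) by auto
    have "1 * \<bar>fls_subdegree (u1 - fls_const \<kappa>1)\<bar> < int p * \<bar>fls_subdegree (u1 - fls_const \<kappa>1)\<bar>"
      using n0 p2 by (intro mult_strict_right_mono) auto
    then have "nat \<bar>fls_subdegree (u1 - fls_const \<kappa>1)\<bar> < nat \<bar>fls_subdegree (u - fls_const \<kappa>)\<bar>"
      unfolding s abs_mult by simp
    then show ?thesis using less.hyps u1(1) v1(1) rel n0 by blast
  qed (use less.prems in blast)
qed

text \<open>\<open>X^p + c X\<close> already has \<open>p\<close> roots in \<open>K\<close>, so
  K((t)) contains no others.\<close>

lemma artin_schreier_const:
  assumes "\<delta> ^ p + fls_const c * \<delta> = 0"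
  shows "\<exists>d\<in>Z. \<delta> = fls_const d"
proof -
  define P where "P = monom (1 :: 'k fls) p + [:0, fls_const c:]"
  have degP: "degree P = p"
    unfolding P_def using p2 by (subst degree_add_eq_left) (auto simp: degree_monom_eq)
  have P0: "P \<noteq> 0"
  proof
    assume "P = 0"
    then show False using degP p2 by simp
  qed
  have root: "poly P z = z ^ p + fls_const c * z" for z
    by (simp add: P_def poly_monom mult.commute)
  have sub: "fls_const ` Z \<subseteq> {z. poly P z = 0}"
  proof clarify
    fix d assume "d \<in> Z"
    then have "d ^ p + c * d = 0" by (simp add: Z_def)
    then have "fls_const (d ^ p + c * d) = 0" by simp
    then show "poly P (fls_const d) = 0" unfolding root by (simp only: rhomD[OF rhom_fls_const])
  qed
  have "inj_on fls_const Z"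
  proof (rule inj_onI)
    fix a b assume "fls_const a = fls_const b"
    then have "fls_nth (fls_const a) 0 = fls_nth (fls_const b) 0" by simp
    then show "a = b" by simp
  qed
  then have cZ: "card (fls_const ` Z) = p" using Z(2) by (simp add: card_image)
  have fin: "finite {z. poly P z = 0}" using P0 by (rule poly_roots_finite)
  have "card {z. poly P z = 0} \<le> p" using card_poly_roots_bound[OF P0] degP by simp
  then have "card (fls_const ` Z) = card {z. poly P z = 0}"
    using card_mono[OF fin sub] unfolding cZ by (rule antisym[rotated])
  then have "fls_const ` Z = {z. poly P z = 0}" by (rule card_subset_eq[OF fin sub])
  moreover have "poly P \<delta> = 0" unfolding root by (rule assms)
  ultimately have "\<delta> \<in> fls_const ` Z" by simp
  then show ?thesis by blast
qed

text \<open>\<open>Z\<close> has prime order, so any nonzero \<open>e\<close> generates it.\<close>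

lemma shift_invariant_single:
  assumes "degree a < p" "e \<in> Z" "e \<noteq> 0" "shift e a = a"
  shows "a = [:coeff a 0:]"
proof -
  have sh: "shift (d + e) a = shift e (shift d a)" for d
    by (simp add: shift_def pcompose_assoc[symmetric] pcompose_pCons)
  have inv: "shift (of_nat n * e) a = a \<and> of_nat n * e \<in> Z" for n
  proof (induction n)
    case 0
    then show ?case using Z(3) by (simp add: shift_def)
  next
    case (Suc n)
    have "of_nat (Suc n) * e = of_nat n * e + e" by (simp add: algebra_simps)
    then show ?case using Suc sh[of "of_nat n * e"] assms(2,4) Z_add by simp
  qed
  have "inj_on (\<lambda>n. of_nat n * e) {..<p}"
  proof (rule inj_onI)
    fix n m assume nm: "n \<in> {..<p}" "m \<in> {..<p}" "of_nat n * e = of_nat m * e"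
    have "n \<le> m \<Longrightarrow> n = m" if "n \<in> {..<p}" "m \<in> {..<p}" "(of_nat n :: 'k) = of_nat m" for n m
    proof -
      assume "n \<le> m"
      then have "(of_nat (m - n) :: 'k) = 0" using that(3) by (simp add: of_nat_diff)
      then have "p dvd m - n" using of_nat_eq_0_iff_char_dvd char_p by blast
      then show "n = m" using that \<open>n \<le> m\<close> by (auto dest: dvd_imp_le)
    qed
    note * = this
    have nm': "(of_nat n :: 'k) = of_nat m" using nm(3) unfolding mult_right_cancel[OF assms(3)] .
    show "n = m"
    proof (cases "n \<le> m")
      case True
      then show ?thesis by (rule *[OF nm(1,2) nm'])
    next
      case False
      then have "m \<le> n" by simp
      then have "m = n" by (rule *[OF nm(2,1) nm'[symmetric]])
      then show ?thesis by simp
    qed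
  qed
  then have "card ((\<lambda>n. of_nat n * e) ` {..<p}) = p" by (simp add: card_image)
  moreover have "(\<lambda>n. of_nat n * e) ` {..<p} \<subseteq> Z" using inv by blast
  ultimately have img: "(\<lambda>n. of_nat n * e) ` {..<p} = Z" using Z(1,2) card_subset_eq by metis
  have "shift d a = a" if "d \<in> Z" for d
  proof -
    have "d \<in> (\<lambda>n. of_nat n * e) ` {..<p}" using that img by simp
    then obtain n where "d = of_nat n * e" by blast
    then show ?thesis using inv by simp
  qed
  then show ?thesis using assms(1) by (intro shift_invariant)
qed

text \<open>
  The pole bound puts the numerator of \<open>u\<close> into \<open>K[x]\<close>.  As \<open>u\<close> is then fixed by the translations
  \<open>y \<mapsto> y + e\<close>, \<open>v\<close> changes by constants under them and hence is \<open>\<mu> y + h\<close> with \<open>h\<close> in \<open>K(x)\<close>.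
\<close>

lemma no_separable_solution:
  assumes p3: "p > 2" and r: "r = p ^ l" "l \<ge> 3" and q: "q = r ^ 2"
    and u: "u \<in> LL" and v: "v \<in> LL" and rel: "v ^ p + fls_const c * v = u ^ (r + 1)"
    and du: "fls_deriv u \<noteq> 0"
  shows False
proof -
  have p0: "p > 0" by (rule prime_gt_0_nat[OF prime_p])
  have rdvd: "p dvd r" "r > 0" using r p0 by auto
  \<comment> \<open>A denominator of least degree excludes a common linear factor of
    \<open>A\<close> and \<open>B\<close>, as \<open>pole_bound\<close> requires.\<close>
  define n where "n = (LEAST n. \<exists>A B. B \<noteq> 0 \<and> degree B = n \<and> u = pl xi yi A / pl xi yi [:B:])"
  have "\<exists>n A B. B \<noteq> 0 \<and> degree B = n \<and> u = pl xi yi A / pl xi yi [:B:]"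
    using u unfolding LL_def by blast
  then have "\<exists>A B. B \<noteq> 0 \<and> degree B = n \<and> u = pl xi yi A / pl xi yi [:B:]"
    unfolding n_def by (rule LeastI_ex)
  then obtain A1 B where B: "B \<noteq> 0" "degree B = n" and uA1: "u = pl xi yi A1 / pl xi yi [:B:]"
    by blast
  obtain A where A: "degree A < p" "pl xi yi A1 = pl xi yi A"
    using obtain_reduced place_inf by metis
  have uA: "u = pl xi yi A / pl xi yi [:B:]" using uA1 A(2) by simp
  have min: False if AB: "A = smult [:-a, 1:] A'" "B = [:-a, 1:] * B'" for a A' B'
  proof -
    have B': "B' \<noteq> 0" using AB(2) B(1) by auto
    have "hev fls_const xi [:-a, 1:] \<noteq> 0" using inf_const_nz[of "[:-a, 1:]"] by simp
    moreover have "pl xi yi A = hev fls_const xi [:-a, 1:] * pl xi yi A'"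
      unfolding AB(1) by (rule pl_smult)
    moreover have "pl xi yi [:B:] = hev fls_const xi [:-a, 1:] * pl xi yi [:B':]"
      unfolding AB(2) pl_const by (rule hev_mult[OF rhom_fls_const])
    ultimately have "u = pl xi yi A' / pl xi yi [:B':]" unfolding uA by simp
    then have "n \<le> degree B'" unfolding n_def using B' by (intro Least_le) blast
    moreover have "degree B = 1 + degree B'" unfolding AB(2) using B' by (subst degree_mult_eq) auto
    ultimately show False using B(2) by simp
  qed
  obtain C1 E where E: "E \<noteq> 0" and vC1: "v = pl xi yi C1 / pl xi yi [:E:]"
    using v unfolding LL_def by blast
  obtain C where C: "degree C < p" "pl xi yi C1 = pl xi yi C"
    using obtain_reduced place_inf by metis
  have vC: "v = pl xi yi C / pl xi yi [:E:]" using vC1 C(2) by simp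
  have rel': "(pl xi yi C / pl xi yi [:E:]) ^ p + fls_const c * (pl xi yi C / pl xi yi [:E:])
      = (pl xi yi A / pl xi yi [:B:]) ^ (r + 1)"
    using rel unfolding uA vC .
  obtain G where G: "degree G < p" "wronski A B = smult (B ^ 2) G" "G \<noteq> 0"
    "\<And>a. poly B a = 0 \<Longrightarrow> \<exists>b. b ^ p + c * b = a ^ (q + 1) \<and> pt a b G = 0"
    "(int r * int p - int r - 2) * - fls_subdegree (pl xi yi A) \<le> int p * (int p * (int q * (int p - 1) - 2))"
    by (rule pole_bound[OF B(1) E rdvd p3 rel' A(1)]) (use min du uA in blast)+
  have "- fls_subdegree (pl xi yi A) \<le> int q"
  proof (rule ccontr)
    define w where "w = - fls_subdegree (pl xi yi A)"
    define t where "t = int r * int p - int r - 2"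
    assume "\<not> - fls_subdegree (pl xi yi A) \<le> int q"
    then have w: "w \<ge> int q + 1" by (simp add: w_def)
    define P where "P = int p"
    have P3: "P \<ge> 3" using p3 by (simp add: P_def)
    \<comment> \<open>With \<open>l \<ge> 3\<close> this makes \<open>t\<close> at least
      \<open>p^2 (p - 1)\<close>; then \<open>w \<ge> q + 1\<close> violates the pole bound by the
      margin \<open>2 p^2\<close>.\<close>
    have "p ^ 3 \<le> r" unfolding r(1) using r(2) p0 by (intro power_increasing) auto
    then have rP: "P ^ 3 \<le> int r" unfolding P_def by (metis of_nat_le_iff of_nat_power)
    have "P ^ 3 * (P - 1) \<le> int r * (P - 1)" using rP P3 by (intro mult_right_mono) auto
    moreover have "t = int r * (P - 1) - 2" by (simp add: t_def P_def algebra_simps)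
    moreover have "P ^ 3 * (P - 1) = P ^ 2 * (P - 1) + P ^ 2 * (P - 1) * (P - 1)"
      by (simp add: power2_eq_square power3_eq_cube algebra_simps)
    moreover have "3 * 1 \<le> P ^ 2 * (P - 1) * (P - 1)"
    proof -
      have "3 * 1 * 1 * 1 \<le> P * P * (P - 1) * (P - 1)" using P3 by (intro mult_mono) auto
      then show ?thesis by (simp add: power2_eq_square)
    qed
    ultimately have t: "t \<ge> P ^ 2 * (P - 1)" by linarith
    have "P ^ 2 * (P - 1) \<ge> 0" using P3 by simp
    then have t0: "t \<ge> 0" using t by linarith
    have "P ^ 2 * (P - 1) * int q \<le> t * int q" using t by (intro mult_right_mono) auto
    also have "\<dots> \<le> t * w" using t0 w by (intro mult_left_mono) auto
    also have "\<dots> \<le> P * (P * (int q * (P - 1) - 2))" using G(5) by (simp only: w_def t_def P_def)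
    also have "\<dots> = P ^ 2 * (P - 1) * int q - 2 * P ^ 2" by (simp add: power2_eq_square algebra_simps)
    finally have "2 * P ^ 2 \<le> 0" by simp
    moreover have "3 * 3 \<le> P * P" using P3 by (intro mult_mono) auto
    ultimately show False by (simp add: power2_eq_square)
  qed
  then obtain A0 where A0: "A = [:A0:]" using in_Kx[OF A(1)] by blast
  define G0 where "G0 = coeff G 0"
  have wA: "wronski A B = [:B * pderiv A0 - pderiv B * A0:]"
    by (simp add: wronski_def A0 D_def xyderiv_def map_poly_pCons pderiv_pCons)
  have G0: "G = [:G0:]"
  proof (rule poly_eqI)
    fix i
    show "coeff G i = coeff [:G0:] i"
    proof (cases i)
      case (Suc j)
      have "coeff (smult (B ^ 2) G) i = 0" unfolding G(2)[symmetric] wA Suc by simp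
      then show ?thesis using B(1) Suc by simp
    qed (simp add: G0_def)
  qed
  have wronskian: "B * pderiv A0 - pderiv B * A0 = B ^ 2 * G0"
    using arg_cong[OF G(2), of "\<lambda>F. coeff F 0"] unfolding wA G0 by simp
  have rootsG: "poly G0 a = 0" if a: "poly B a = 0" for a
    using G(4)[OF a] unfolding G0 by (auto simp: pt_def rhom_poly)
  have "Z \<noteq> {0}"
  proof
    assume "Z = {0}"
    then have "card Z = 1" by (simp only: card.empty card_insert_disjoint finite.emptyI empty_iff not_False_eq_True One_nat_def)
    then show False using Z(2) p2 by linarith
  qed
  then obtain e where e: "e \<in> Z" "e \<noteq> 0" using Z(3) by blast
  define y where "y = yi + fls_const e"
  have y: "place xi y" unfolding y_def using place_inf e(1) by (rule place_add)
  have cst: "pl xi y [:F:] = pl xi yi [:F:]" for F by simp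
  \<comment> \<open>The conjugate of \<open>v\<close> under \<open>y \<mapsto> y + e\<close>; it
    solves the same equation because \<open>u\<close> lies in K(x).\<close>
  define v' where "v' = pl xi y C / pl xi yi [:E:]"
  have relv': "v' ^ p + fls_const c * v' = u ^ (r + 1)"
  proof -
    have "(pl xi y C / pl xi y [:E:]) ^ p + fls_const c * (pl xi y C / pl xi y [:E:])
        = (pl xi y A / pl xi y [:B:]) ^ (r + 1)"
      by (rule relation_transfer[OF rel' inf_const_nz[OF B(1)] inf_const_nz[OF E] y])
        (use inf_const_nz[OF B(1)] inf_const_nz[OF E] cst in simp_all)
    then show ?thesis unfolding v'_def uA A0 cst .
  qed
  have "v' ^ p = (v' - v) ^ p + v ^ p" using frob(2)[of "v' - v" v] by simp
  then have "(v' - v) ^ p + fls_const c * (v' - v) =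
      (v' ^ p + fls_const c * v') - (v ^ p + fls_const c * v)"
    by (simp add: algebra_simps)
  then have "(v' - v) ^ p + fls_const c * (v' - v) = 0" unfolding rel relv' by simp
  then obtain d where d: "d \<in> Z" "v' - v = fls_const d" using artin_schreier_const by blast
  have "v' = v + fls_const d" using d(2) by (simp add: diff_eq_eq add.commute)
  then have "v' * pl xi yi [:E:] = v * pl xi yi [:E:] + fls_const d * pl xi yi [:E:]"
    by (simp only: distrib_right)
  then have "pl xi y C = pl xi yi C + pl xi yi [:smult d E:]"
    unfolding v'_def vC using inf_const_nz[OF E] by (simp add: hev_smult rhom_fls_const)
  then have "pl xi yi (shift e C - (C + [:smult d E:])) = 0"
    unfolding pl_simps pl_shift y_def[symmetric] by simp
  moreover have "degree (shift e C - (C + [:smult d E:])) < p"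
    using C(1) p0 by (intro degree_diff_less degree_add_less) (simp_all add: degree_shift)
  ultimately have "shift e C - (C + [:smult d E:]) = 0" by (intro reduced_0)
  then have shC: "shift e C = C + [:smult d E:]" by simp
  \<comment> \<open>Under the translation \<open>\<mu> y\<close> changes by \<open>d\<close>,
    exactly as \<open>v\<close> does, so \<open>v - \<mu> y\<close> is invariant.\<close>
  define \<mu> where "\<mu> = d / e"
  define C' where "C' = C - [:0, smult \<mu> E:]"
  have "shift e [:0, smult \<mu> E:] = [:smult d E:] + [:0, smult \<mu> E:]"
    using e(2) by (simp add: shift_def pcompose_pCons \<mu>_def)
  then have "shift e C' = C'"
    unfolding C'_def using shC unfolding shift_def pcompose_diff by simp
  moreover have "degree C' < p"
    unfolding C'_def using C(1) p2 by (intro degree_diff_less) (auto intro: order.strict_trans1[OF degree_pCons_le])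
  ultimately have "C' = [:coeff C' 0:]" using e by (intro shift_invariant_single)
  then obtain H where H: "C' = [:H:]" by blast
  have CH: "C = [:H, smult \<mu> E:]" using H unfolding C'_def by (simp add: diff_eq_eq)
  \<comment> \<open>Both \<open>d\<close> and \<open>e\<close> satisfy \<open>z^p = - c z\<close>.
    That the ratio is fixed by Frobenius makes \<open>\<mu> y\<close> contribute
    \<open>\<mu> x^(q+1)\<close> to the equation.\<close>
  have \<mu>p: "\<mu> ^ p = \<mu>"
  proof -
    have "d ^ p = - c * d" "e ^ p = - c * e"
      using d(1) e(1) by (simp_all add: Z_def eq_neg_iff_add_eq_0)
    then show ?thesis using c_nz by (simp add: \<mu>_def power_divide)
  qed
  define ev where "ev = hev fls_const xi"
  have rh: "rhom ev" unfolding ev_def by (rule rhom_hev[OF rhom_fls_const])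
  note ev_simps = rhomD[OF rh]
  have ev_nz: "ev F \<noteq> 0" if "F \<noteq> 0" for F
    using inf_const_nz[OF that] by (simp add: ev_def)
  have ev_sm: "ev (smult a F) = fls_const a * ev F" for a F
    by (simp add: ev_def hev_smult rhom_fls_const)
  define h where "h = ev H / ev E"
  have vh: "v = h + fls_const \<mu> * yi"
  proof -
    have "v = (ev H + yi * ev (smult \<mu> E)) / ev E"
      unfolding vC CH by (simp add: pl_pCons pl_simps ev_def)
    also have "\<dots> = h + fls_const \<mu> * yi"
      unfolding ev_sm h_def add_divide_distrib using ev_nz[OF E] by simp
    finally show ?thesis .
  qed
  have "v ^ p + fls_const c * v = (h ^ p + fls_const c * h) + fls_const \<mu> * (yi ^ p + fls_const c * yi)"
  proof -
    have "v ^ p = h ^ p + fls_const (\<mu> ^ p) * yi ^ p"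
      unfolding vh frob power_mult_distrib fls_const_power ..
    then show ?thesis unfolding \<mu>p by (simp add: vh algebra_simps)
  qed
  then have relh: "h ^ p + fls_const c * h + fls_const \<mu> * xi ^ (q + 1) = u ^ (r + 1)"
    using rel place_inf unfolding place_def by simp
  have EE: "ev E * ev E ^ (p - 1) = ev E ^ p" using p0 by (metis power_eq_if not_gr_zero)
  have hE: "ev H = h * ev E" using ev_nz[OF E] by (simp add: h_def)
  have uB: "ev A0 = u * ev B" using ev_nz[OF B(1)] unfolding uA A0 by (simp add: ev_def)
  have k1: "ev H ^ p = h ^ p * ev E ^ p" unfolding hE by (rule power_mult_distrib)
  have k2: "ev H * ev E ^ (p - 1) = h * ev E ^ p" unfolding hE EE[symmetric] by (rule mult.assoc)
  have k3: "ev A0 ^ (r + 1) = u ^ (r + 1) * ev B ^ (r + 1)" unfolding uB by (rule power_mult_distrib)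
  have km: "ev (monom 1 (q + 1)) = xi ^ (q + 1)" by (simp add: ev_def hev_monom rhom_fls_const)
  let ?L = "H ^ p * B ^ (r + 1) + smult c (H * E ^ (p - 1) * B ^ (r + 1))
      + smult \<mu> (monom 1 (q + 1)) * E ^ p * B ^ (r + 1)"
  have "ev ?L = (h ^ p + fls_const c * h + fls_const \<mu> * xi ^ (q + 1)) * (ev E ^ p * ev B ^ (r + 1))"
    unfolding ev_simps ev_sm km k1 k2 by (simp only: distrib_left distrib_right mult_ac)
  also have "\<dots> = ev (A0 ^ (r + 1) * E ^ p)" unfolding relh ev_simps k3 by (simp only: mult_ac)
  finally have "ev (?L - A0 ^ (r + 1) * E ^ p) = 0" unfolding ev_simps(6) by simp
  then have "?L - A0 ^ (r + 1) * E ^ p = 0" using ev_nz by blast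
  then have eq: "?L = A0 ^ (r + 1) * E ^ p" by simp
  have "G0 \<noteq> 0" using G(3) G0 by auto
  then show False
    using r by (intro artin_schreier_rational_contradiction[OF prime_p char_p p3 r(1) _ q c_nz B(1) E _ eq wronskian rootsG]) simp_all
qed

lemma no_solution:
  assumes p3: "p > 2" and r: "r = p ^ l" "l \<ge> 3" and q: "q = r ^ 2"
    and u: "u \<in> LL" and v: "v \<in> LL" and rel: "v ^ p + fls_const c * v = u ^ (r + 1)"
  shows "\<exists>\<kappa>. u = fls_const \<kappa>"
proof (rule ccontr)
  assume nc: "\<nexists>\<kappa>. u = fls_const \<kappa>"
  \<comment> \<open>The descent needs a nonzero order to divide by \<open>p\<close>; if
    \<open>u\<close> has order 0, subtracting its constant term provides one.\<close>
  have "\<exists>\<kappa>. fls_subdegree (u - fls_const \<kappa>) \<noteq> 0"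
  proof (cases "fls_subdegree u = 0")
    case True
    define w where "w = u - fls_const (fls_nth u 0)"
    have "w \<noteq> 0" using nc by (auto simp: w_def)
    moreover have "fls_nth w 0 = 0" by (simp add: w_def)
    ultimately have "fls_subdegree w \<noteq> 0" by (metis nth_fls_subdegree_nonzero)
    then show ?thesis unfolding w_def by blast
  next
    case False
    then show ?thesis by (intro exI[of _ 0]) simp
  qed
  then obtain \<kappa> where \<kappa>: "fls_subdegree (u - fls_const \<kappa>) \<noteq> 0" by blast
  have "p dvd r" using r by simp
  then obtain u1 v1 where "u1 \<in> LL" "v1 \<in> LL" "v1 ^ p + fls_const c * v1 = u1 ^ (r + 1)" "fls_deriv u1 \<noteq> 0"
    using separable_solution[OF _ u v rel \<kappa>] by blast
  then show False using no_separable_solution[OF p3 r q] by blast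
qed

end

section \<open>Projective space\<close>

lemma proj_rel_refl: "v \<noteq> 0 \<Longrightarrow> proj_rel v v"
  unfolding proj_rel_def by (auto intro!: exI[of _ 1])

lemma rep_abs_proj:
  assumes "v \<noteq> 0"
  obtains a where "a \<noteq> 0" "rep_proj (abs_proj v) = a *s v"
proof -
  have "proj_rel v (rep_proj (abs_proj v))"
    using Quotient3_rep_abs[OF Quotient3_proj proj_rel_refl[OF assms]]
      part_equivp_symp[OF part_equivp_proj_rel] by blast
  then show ?thesis using that unfolding proj_rel_def by blast
qed

lemma rep_proj_nz: "rep_proj P \<noteq> 0"
  using Quotient3_rep_reflp[OF Quotient3_proj, of P] unfolding proj_rel_def by blast

lemma proj_eqI:
  assumes "rep_proj Q = a *s rep_proj P" "a \<noteq> 0"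
  shows "P = Q"
proof -
  have "proj_rel (rep_proj P) (rep_proj Q)"
    unfolding proj_rel_def using assms rep_proj_nz by blast
  then have "abs_proj (rep_proj P) = abs_proj (rep_proj Q)"
    using Quotient3_rel_abs[OF Quotient3_proj] by blast
  then show ?thesis by (simp add: Quotient3_abs_rep[OF Quotient3_proj])
qed

lemma mpol_eval_scale:
  fixes F :: "('k::field, 'n::finite) mpol"
  assumes "homogeneous d F"
  shows "mpol_eval F (a *s v) = a ^ d * mpol_eval F v"
  unfolding mpol_eval_def sum_distrib_left
proof (rule sum.cong[OF refl])
  fix m assume "m \<in> Poly_Mapping.keys F"
  then have d: "(\<Sum>i\<in>UNIV. Poly_Mapping.lookup m i) = d" using assms by (simp add: homogeneous_def)
  have "(\<Prod>i\<in>UNIV. (a *s v) $ i ^ Poly_Mapping.lookup m i) =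
      a ^ d * (\<Prod>i\<in>UNIV. v $ i ^ Poly_Mapping.lookup m i)"
    by (simp add: power_mult_distrib prod.distrib d flip: power_sum)
  then show "Poly_Mapping.lookup F m * (\<Prod>i\<in>UNIV. (a *s v) $ i ^ Poly_Mapping.lookup m i) =
      a ^ d * (Poly_Mapping.lookup F m * (\<Prod>i\<in>UNIV. v $ i ^ Poly_Mapping.lookup m i))"
    by (simp add: mult_ac)
qed

section \<open>Coordinate forms and closed points\<close>

definition coord :: "'n \<Rightarrow> ('k::field, 'n::finite) mpol" where
  "coord i = Poly_Mapping.single (Poly_Mapping.single i 1) 1"

lemma prod_single_power:
  fixes v :: "'k::field ^ 'n::finite"
  shows "(\<Prod>j\<in>UNIV. v $ j ^ Poly_Mapping.lookup (Poly_Mapping.single i (Suc 0)) j) = v $ i"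
proof -
  have "(\<Prod>j\<in>UNIV. v $ j ^ Poly_Mapping.lookup (Poly_Mapping.single i (Suc 0)) j) = (\<Prod>j\<in>UNIV. if j = i then v $ i else 1)"
    by (rule prod.cong) (auto simp: lookup_single when_def)
  then show ?thesis by simp
qed

lemma sum_single: "(\<Sum>j\<in>(UNIV :: 'n::finite set). Poly_Mapping.lookup (Poly_Mapping.single i (Suc 0)) j) = 1"
proof -
  have "(\<Sum>j\<in>(UNIV :: 'n set). Poly_Mapping.lookup (Poly_Mapping.single i (Suc 0)) j) = (\<Sum>j\<in>UNIV. if j = i then 1 else 0)"
    by (rule sum.cong) (auto simp: lookup_single when_def)
  then show ?thesis by simp
qed

lemma mpol_eval_coord: "mpol_eval (coord i) v = v $ i"
  by (simp add: coord_def mpol_eval_single prod_single_power)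

lemma homogeneous_coord: "homogeneous 1 (coord i)"
  by (simp add: homogeneous_def coord_def sum_single)

lemma closedin_zariski: "closedin zariski Z \<longleftrightarrow> zariski_closed Z"
  by (simp add: closedin_def openin_zariski double_compl Compl_eq_Diff_UNIV[symmetric])

text \<open>A point is cut out by the 2 by 2 minors of its coordinates against those of a variable
  point.\<close>

lemma closedin_zariski_point: "closedin zariski {P :: ('k::field, 'n::finite) proj}"
proof -
  define v where "v = rep_proj P"
  define F :: "'n \<Rightarrow> 'n \<Rightarrow> ('k, 'n) mpol" where
    "F i j = Poly_Mapping.single (Poly_Mapping.single j 1) (v $ i) + Poly_Mapping.single (Poly_Mapping.single i 1) (- v $ j)" for i j
  have ev: "mpol_eval (F i j) w = v $ i * w $ j - v $ j * w $ i" for i j w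
    by (simp add: F_def mpol_eval_add mpol_eval_single prod_single_power)
  have hom: "homogeneous 1 (F i j)" for i j
    unfolding homogeneous_def
  proof
    fix m assume "m \<in> Poly_Mapping.keys (F i j)"
    then have "m \<in> Poly_Mapping.keys (Poly_Mapping.single (Poly_Mapping.single j (1::nat)) (v $ i))
        \<union> Poly_Mapping.keys (Poly_Mapping.single (Poly_Mapping.single i (1::nat)) (- v $ j))"
      unfolding F_def by (rule subsetD[OF Poly_Mapping.keys_add])
    then have "m = Poly_Mapping.single j 1 \<or> m = Poly_Mapping.single i 1"
      by (simp split: if_splits)
    then show "(\<Sum>i\<in>UNIV. Poly_Mapping.lookup m i) = 1" by (auto simp: sum_single)
  qed
  have "{P} = zero_locus {F i j | i j. True}"
  proof
    show "{P} \<subseteq> zero_locus {F i j | i j. True}"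
      by (auto simp: zero_locus_def form_at_def ev v_def)
    show "zero_locus {F i j | i j. True} \<subseteq> {P}"
    proof
      fix Q assume "Q \<in> zero_locus {F i j | i j. True}"
      then have "mpol_eval (F i j) (rep_proj Q) = 0" for i j
        unfolding zero_locus_def form_at_def by blast
      then have eq: "v $ i * rep_proj Q $ j = v $ j * rep_proj Q $ i" for i j
        unfolding ev by (simp only: right_minus_eq)
      have "v \<noteq> 0" unfolding v_def by (rule rep_proj_nz)
      then obtain i where i: "v $ i \<noteq> 0" by (auto simp: vec_eq_iff)
      define a where "a = rep_proj Q $ i / v $ i"
      have Q: "rep_proj Q = a *s v"
      proof (unfold vec_eq_iff, intro allI)
        fix j
        have "rep_proj Q $ j = v $ j * rep_proj Q $ i / v $ i"
          using eq[of i j] i by (metis nonzero_mult_div_cancel_left)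
        then show "rep_proj Q $ j = (a *s v) $ j" by (simp add: a_def mult.commute)
      qed
      moreover have "a \<noteq> 0"
      proof
        assume "a = 0"
        then have "rep_proj Q = 0" using Q by simp
        then show False using rep_proj_nz by blast
      qed
      ultimately have "P = Q" unfolding v_def by (rule proj_eqI)
      then show "Q \<in> {P}" by simp
    qed
  qed
  moreover have "\<forall>G\<in>{F i j | i j. True}. \<exists>d. homogeneous d G"
    using hom by (intro ballI) (elim CollectE exE conjE, metis)
  ultimately show ?thesis unfolding closedin_zariski zariski_closed_def
    by (intro exI[of _ "{F i j | i j. True}"] conjI)
qed

section \<open>Irreducible spaces and regular functions\<close>

lemma irreducible_inD:
  assumes "irreducible_in T C" "closedin T A" "closedin T B" "C \<subseteq> A \<union> B"
  shows "C \<subseteq> A \<or> C \<subseteq> B"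
  using assms unfolding irreducible_in_def by metis

lemma irreducible_open_meet:
  assumes "irreducible_in T C" "openin (subtopology T C) U" "openin (subtopology T C) V"
    and "U \<noteq> {}" "V \<noteq> {}"
  shows "U \<inter> V \<noteq> {}"
proof
  assume dis: "U \<inter> V = {}"
  obtain O1 O2 where O: "openin T O1" "openin T O2" "U = O1 \<inter> C" "V = O2 \<inter> C"
    using assms(2,3) unfolding openin_subtopology by blast
  have Ct: "C \<subseteq> topspace T" using assms(1) unfolding irreducible_in_def by blast
  have "closedin T (topspace T - O1)" "closedin T (topspace T - O2)" using O(1,2) by auto
  moreover have "C \<subseteq> (topspace T - O1) \<union> (topspace T - O2)" using dis O(3,4) Ct by blast
  ultimately have "C \<subseteq> topspace T - O1 \<or> C \<subseteq> topspace T - O2"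
    by (intro irreducible_inD[OF assms(1)])
  then show False using assms(4,5) O(3,4) by blast
qed

lemma krull_dim_geI:
  assumes "\<And>i. i \<le> n \<Longrightarrow> closedin T (Z i) \<and> irreducible_in T (Z i)" "\<And>i. i < n \<Longrightarrow> Z i \<subset> Z (Suc i)"
  shows "enat n \<le> krull_dim T"
  unfolding krull_dim_def
proof (rule Sup_upper, rule CollectI, intro exI conjI)
  show "enat n = enat n" ..
  show "\<forall>i\<le>n. closedin T (Z i) \<and> irreducible_in T (Z i)" using assms(1) by simp
  show "\<forall>i<n. Z i \<subset> Z (Suc i)" using assms(2) by simp
qed

section \<open>Regular functions and morphisms on open subsets\<close>

lemma regular_on_subset:
  assumes "regular_on U f" "W \<subseteq> U"
  shows "regular_on W f"
  unfolding regular_on_def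
proof
  fix P assume "P \<in> W"
  then obtain V d G H where V: "openin (zariski_on U) V" "P \<in> V" "homogeneous d G" "homogeneous d H"
    "\<forall>Q\<in>V. form_at H Q \<noteq> 0 \<and> f Q = form_at G Q / form_at H Q"
    using assms unfolding regular_on_def by (metis subsetD)
  have "openin (zariski_on W) (V \<inter> W)"
  proof -
    obtain O1 where "openin zariski O1" "V = O1 \<inter> U"
      using V(1) unfolding openin_subtopology by blast
    then have "V \<inter> W = O1 \<inter> W" using assms(2) by blast
    then show ?thesis unfolding openin_subtopology using \<open>openin zariski O1\<close> by blast
  qed
  then show "\<exists>V. openin (zariski_on W) V \<and> P \<in> V \<and> (\<exists>d G H. homogeneous d G \<and> homogeneous d H \<and>
      (\<forall>Q\<in>V. form_at H Q \<noteq> 0 \<and> f Q = form_at G Q / form_at H Q))"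
    using V(2-5) \<open>P \<in> W\<close> by (intro exI[of _ "V \<inter> W"] conjI exI[of _ d] exI[of _ G] exI[of _ H]) auto
qed

lemma zariski_on_mono:
  assumes "openin (zariski_on C) W" "W \<subseteq> U" "U \<subseteq> C"
  shows "openin (zariski_on U) W"
proof -
  obtain O1 where "openin zariski O1" "W = O1 \<inter> C"
    using assms(1) unfolding openin_subtopology by blast
  then show ?thesis using assms unfolding openin_subtopology by blast
qed

lemma zariski_on_trans:
  assumes "openin (zariski_on V) W" "openin (zariski_on A) V"
  shows "openin (zariski_on A) W"
proof -
  obtain O1 O2 where "openin zariski O1" "V = O1 \<inter> A" "openin zariski O2" "W = O2 \<inter> V"
    using assms unfolding openin_subtopology by blast
  then have "openin zariski (O2 \<inter> O1)" "W = (O2 \<inter> O1) \<inter> A" by auto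
  then show ?thesis unfolding openin_subtopology by blast
qed

lemma morphism_maps:
  assumes "variety_morphism C D \<phi>" "P \<in> C"
  shows "\<phi> P \<in> D"
  using assms continuous_map_image_subset_topspace unfolding variety_morphism_def by fastforce

lemma morphism_preimage:
  assumes "variety_morphism C D \<phi>" "openin (zariski_on D) V"
  shows "openin (zariski_on C) (C \<inter> \<phi> -` V)"
proof -
  have "continuous_map (zariski_on C) (zariski_on D) \<phi>"
    using assms(1) unfolding variety_morphism_def by blast
  then have "openin (zariski_on C) {x \<in> topspace (zariski_on C). \<phi> x \<in> V}"
    using assms(2) by (rule openin_continuous_map_preimage)
  moreover have "{x \<in> topspace (zariski_on C). \<phi> x \<in> V} = C \<inter> \<phi> -` V" by auto
  ultimately show ?thesis by simp
qed

lemma morphism_regular: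
  assumes "variety_morphism C D \<phi>" "openin (zariski_on D) V" "regular_on V f"
  shows "regular_on (C \<inter> \<phi> -` V) (f \<circ> \<phi>)"
  using assms unfolding variety_morphism_def by blast

text \<open>
  Otherwise a point, the closure of the image and \<open>D\<close> form a chain of irreducible closed sets of
  length \<open>2\<close>.
\<close>

lemma curve_image_meets_open:
  assumes C: "projective_curve C" and D: "projective_curve D" and \<phi>: "variety_morphism C D \<phi>"
    and nonconst: "\<not> (\<exists>Q. \<forall>P\<in>C. \<phi> P = Q)" and U: "openin (zariski_on D) U" "U \<noteq> {}"
  shows "C \<inter> \<phi> -` U \<noteq> {}"
proof
  assume empty: "C \<inter> \<phi> -` U = {}"
  have Cc: "closedin zariski C" "irreducible_in zariski C"
    and Dc: "closedin zariski D" "irreducible_in zariski D" "krull_dim (zariski_on D) = 1"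
    using C D unfolding projective_curve_def by auto
  have maps: "\<phi> ` C \<subseteq> D" using morphism_maps[OF \<phi>] by blast
  have cont: "continuous_map (zariski_on C) (zariski_on D) \<phi>"
    using \<phi> unfolding variety_morphism_def by blast
  define Z where "Z = (zariski_on D) closure_of (\<phi> ` C)"
  have Zc: "closedin (zariski_on D) Z" unfolding Z_def by (rule closedin_closure_of)
  have "C \<noteq> {}" using Cc(2) unfolding irreducible_in_def by blast
  then obtain P1 where P1: "P1 \<in> C" by blast
  then obtain P2 where P2: "P2 \<in> C" "\<phi> P2 \<noteq> \<phi> P1" using nonconst by metis
  have sub: "\<phi> ` C \<subseteq> Z" unfolding Z_def by (rule closure_of_subset) (use maps in simp)
  have ZD: "Z \<subseteq> D" using closedin_subset[OF Zc] by simp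
  have "closedin (zariski_on D) (D - U)" using U(1) openin_closedin_eq[of "zariski_on D" U] by simp
  moreover have "\<phi> ` C \<subseteq> D - U" using maps empty by blast
  ultimately have "Z \<subseteq> D - U" unfolding Z_def by (rule closure_of_minimal[rotated])
  moreover have "U \<subseteq> D" using openin_subset[OF U(1)] by simp
  ultimately have "Z \<subset> D" using U(2) ZD by blast
  have irrZ: "irreducible_in (zariski_on D) Z"
    unfolding irreducible_in_def
  proof (intro conjI allI impI)
    show "Z \<subseteq> topspace (zariski_on D)" using ZD by simp
    show "Z \<noteq> {}" using sub P1 by blast
    fix A B assume AB: "closedin (zariski_on D) A \<and> closedin (zariski_on D) B \<and> Z \<subseteq> A \<union> B"
    have pre: "closedin zariski {x \<in> topspace (zariski_on C). \<phi> x \<in> S}" if "closedin (zariski_on D) S" for S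
      using closedin_continuous_map_preimage[OF cont that] Cc(1) by (rule closedin_trans_full)
    have "C \<subseteq> {x \<in> topspace (zariski_on C). \<phi> x \<in> A} \<union> {x \<in> topspace (zariski_on C). \<phi> x \<in> B}"
      using AB sub by auto
    then have "C \<subseteq> {x \<in> topspace (zariski_on C). \<phi> x \<in> A} \<or> C \<subseteq> {x \<in> topspace (zariski_on C). \<phi> x \<in> B}"
      using AB by (intro irreducible_inD[OF Cc(2)] pre) simp_all
    then have "\<phi> ` C \<subseteq> A \<or> \<phi> ` C \<subseteq> B" by blast
    then show "Z \<subseteq> A \<or> Z \<subseteq> B" unfolding Z_def using AB closure_of_minimal by blast
  qed
  have irrD: "irreducible_in (zariski_on D) D"
    using Dc(1,2) closedin_trans_full[of zariski D] unfolding irreducible_in_def by simp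
  have pt: "closedin (zariski_on D) {\<phi> P1}" "irreducible_in (zariski_on D) {\<phi> P1}"
    using closedin_subset_topspace[OF closedin_zariski_point, of "\<phi> P1" D] maps P1
    unfolding irreducible_in_def by auto
  define W where "W i = (if i = 0 then {\<phi> P1} else if i = 1 then Z else D)" for i :: nat
  have "enat 2 \<le> krull_dim (zariski_on D)"
  proof (rule krull_dim_geI[of 2 "zariski_on D" W])
    fix i :: nat assume "i < 2"
    then consider "i = 0" | "i = 1" by linarith
    then show "W i \<subset> W (Suc i)"
    proof cases
      case 1
      then show ?thesis using sub P1 P2 by (auto simp: W_def)
    next
      case 2
      then show ?thesis using \<open>Z \<subset> D\<close> by (simp add: W_def)
    qed
  next
    fix i :: nat
    have "closedin (zariski_on D) D" using closedin_topspace[of "zariski_on D"] by simp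
    then show "closedin (zariski_on D) (W i) \<and> irreducible_in (zariski_on D) (W i)"
      using pt Zc irrZ irrD by (simp add: W_def)
  qed
  then show False unfolding Dc(3) by (simp add: one_enat_def)
qed

text \<open>\<open>\<theta>\<close> is \<open>\<phi>\<close> read through the two birational maps;
  its domain is nonempty because \<open>\<phi>\<close> meets every nonempty open set. Were it
  constant on a nonempty open set, \<open>\<phi>\<close> would be constant on a nonempty open subset
  of \<open>C\<close>, and, as \<open>C\<close> is irreducible and points are closed, on all of
  \<open>C\<close>.\<close>

lemma birational_pullback:
  assumes C: "projective_curve C" and D: "projective_curve D" and CA: "birational C A"
    and DB: "birational D B" and \<phi>: "variety_morphism C D \<phi>" and nonconst: "\<not> (\<exists>Q. \<forall>P\<in>C. \<phi> P = Q)"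
  obtains W \<theta> where "openin (zariski_on A) W" "W \<noteq> {}" "\<theta> ` W \<subseteq> B"
    "\<And>f. regular_on B f \<Longrightarrow> regular_on W (f \<circ> \<theta>)"
    "\<And>\<Omega> R. openin (zariski_on A) \<Omega> \<Longrightarrow> \<Omega> \<noteq> {} \<Longrightarrow> \<Omega> \<subseteq> W \<Longrightarrow> (\<And>P. P \<in> \<Omega> \<Longrightarrow> \<theta> P = R) \<Longrightarrow> False"
proof -
  have Cc: "closedin zariski C" "irreducible_in zariski C" using C unfolding projective_curve_def by auto
  obtain U V where U: "openin (zariski_on C) U" "U \<noteq> {}" and V: "openin (zariski_on A) V" "V \<noteq> {}"
    and iso: "isomorphic_varieties U V"
    using CA unfolding birational_def by blast
  obtain \<alpha> \<beta> where \<alpha>: "variety_morphism U V \<alpha>" and \<beta>: "variety_morphism V U \<beta>"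
    and inv: "\<forall>P\<in>U. \<beta> (\<alpha> P) = P" "\<forall>Q\<in>V. \<alpha> (\<beta> Q) = Q"
    using iso unfolding isomorphic_varieties_def by blast
  have \<beta>\<alpha>: "\<beta> (\<alpha> P) = P" if "P \<in> U" for P using inv(1) that by blast
  have \<alpha>\<beta>: "\<alpha> (\<beta> Q) = Q" if "Q \<in> V" for Q using inv(2) that by blast
  obtain U' V' where U': "openin (zariski_on D) U'" "U' \<noteq> {}" and V': "openin (zariski_on B) V'" "V' \<noteq> {}"
    and iso': "isomorphic_varieties U' V'"
    using DB unfolding birational_def by blast
  obtain \<alpha>' \<beta>' where \<alpha>': "variety_morphism U' V' \<alpha>'" and \<beta>': "variety_morphism V' U' \<beta>'"
    and inv': "\<forall>P\<in>U'. \<beta>' (\<alpha>' P) = P" "\<forall>Q\<in>V'. \<alpha>' (\<beta>' Q) = Q"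
    using iso' unfolding isomorphic_varieties_def by blast
  have \<beta>\<alpha>': "\<beta>' (\<alpha>' P) = P" if "P \<in> U'" for P using inv'(1) that by blast
  have UC: "U \<subseteq> C" and VA: "V \<subseteq> A" and V'B: "V' \<subseteq> B" and U'D: "U' \<subseteq> D"
    using U(1) V(1) V'(1) U'(1) by (auto dest!: openin_subset)
  define W1 where "W1 = U \<inter> (C \<inter> \<phi> -` U')"
  define W where "W = V \<inter> \<beta> -` W1"
  define \<theta> where "\<theta> = \<alpha>' \<circ> \<phi> \<circ> \<beta>"
  have preC: "openin (zariski_on C) (C \<inter> \<phi> -` U')" by (rule morphism_preimage[OF \<phi> U'(1)])
  have W1C: "openin (zariski_on C) W1" unfolding W1_def using U(1) preC by (rule openin_Int)
  have W1ne: "W1 \<noteq> {}"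
    unfolding W1_def
    by (rule irreducible_open_meet[OF Cc(2) U(1) preC U(2)
        curve_image_meets_open[OF C D \<phi> nonconst U']])
  have W1U: "openin (zariski_on U) W1" by (rule zariski_on_mono[OF W1C _ UC]) (simp add: W1_def)
  have WV: "openin (zariski_on V) W" unfolding W_def by (rule morphism_preimage[OF \<beta> W1U])
  have WA: "openin (zariski_on A) W" using WV V(1) by (rule zariski_on_trans)
  have \<alpha>W: "\<alpha> P \<in> W" if "P \<in> W1" for P
    using that \<beta>\<alpha> morphism_maps[OF \<alpha>] unfolding W_def W1_def by auto
  have Wne: "W \<noteq> {}" using W1ne \<alpha>W by blast
  have \<theta>V': "\<theta> P \<in> V'" if "P \<in> W" for P
    using that morphism_maps[OF \<alpha>'] unfolding W_def W1_def \<theta>_def by auto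
  have reg: "regular_on W (f \<circ> \<theta>)" if "regular_on B f" for f
  proof -
    have "regular_on V' f" using that V'B by (rule regular_on_subset)
    moreover have "openin (zariski_on V') V'" using openin_topspace[of "zariski_on V'"] by simp
    ultimately have "regular_on (U' \<inter> \<alpha>' -` V') (f \<circ> \<alpha>')" by (intro morphism_regular[OF \<alpha>'])
    moreover have "U' \<inter> \<alpha>' -` V' = U'" using morphism_maps[OF \<alpha>'] by blast
    ultimately have "regular_on U' (f \<circ> \<alpha>')" by simp
    then have "regular_on (C \<inter> \<phi> -` U') (f \<circ> \<alpha>' \<circ> \<phi>)" by (rule morphism_regular[OF \<phi> U'(1)])
    then have "regular_on W1 (f \<circ> \<alpha>' \<circ> \<phi>)" by (rule regular_on_subset) (unfold W1_def, blast)
    then have "regular_on (V \<inter> \<beta> -` W1) (f \<circ> \<alpha>' \<circ> \<phi> \<circ> \<beta>)" by (rule morphism_regular[OF \<beta> W1U])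
    then show ?thesis unfolding W_def \<theta>_def by (simp only: comp_assoc)
  qed
  have nc: False if \<Omega>: "openin (zariski_on A) \<Omega>" "\<Omega> \<noteq> {}" "\<Omega> \<subseteq> W" and R: "\<And>P. P \<in> \<Omega> \<Longrightarrow> \<theta> P = R" for \<Omega> R
  proof -
    have \<Omega>V: "\<Omega> \<subseteq> V" using \<Omega>(3) unfolding W_def by blast
    have "openin (zariski_on V) \<Omega>" by (rule zariski_on_mono[OF \<Omega>(1) \<Omega>V VA])
    then have "openin (zariski_on U) (U \<inter> \<alpha> -` \<Omega>)" by (rule morphism_preimage[OF \<alpha>])
    then have \<Omega>1: "openin (zariski_on C) (U \<inter> \<alpha> -` \<Omega>)" using U(1) by (rule zariski_on_trans)
    obtain Q where Q: "Q \<in> \<Omega>" using \<Omega>(2) by blast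
    then have "\<beta> Q \<in> U \<inter> \<alpha> -` \<Omega>" using \<Omega>V \<alpha>\<beta> morphism_maps[OF \<beta>] by auto
    then have ne: "U \<inter> \<alpha> -` \<Omega> \<noteq> {}" by blast
    have val: "\<phi> P = \<beta>' R" "\<phi> P \<in> D" if P: "P \<in> U \<inter> \<alpha> -` \<Omega>" for P
    proof -
      have "\<alpha> P \<in> \<Omega>" "P \<in> U" using P by auto
      then have "P \<in> W1" using \<Omega>(3) \<beta>\<alpha> unfolding W_def by auto
      then have "\<phi> P \<in> U'" unfolding W1_def by blast
      moreover have "\<alpha>' (\<phi> P) = R" using R[OF \<open>\<alpha> P \<in> \<Omega>\<close>] \<beta>\<alpha>[OF \<open>P \<in> U\<close>] unfolding \<theta>_def by simp
      ultimately show "\<phi> P = \<beta>' R" "\<phi> P \<in> D" using \<beta>\<alpha>' U'D by auto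
    qed
    have R0D: "\<beta>' R \<in> D" using ne val by auto
    have "closedin (zariski_on D) {\<beta>' R}"
      using closedin_subset_topspace[OF closedin_zariski_point, of "\<beta>' R" D] R0D by simp
    then have "openin (zariski_on D) (D - {\<beta>' R})"
      using openin_diff[OF openin_topspace[of "zariski_on D"]] by simp
    then have op: "openin (zariski_on C) (C \<inter> \<phi> -` (D - {\<beta>' R}))" by (rule morphism_preimage[OF \<phi>])
    have "C \<inter> \<phi> -` (D - {\<beta>' R}) = {}"
    proof (rule ccontr)
      assume "C \<inter> \<phi> -` (D - {\<beta>' R}) \<noteq> {}"
      then have "(U \<inter> \<alpha> -` \<Omega>) \<inter> (C \<inter> \<phi> -` (D - {\<beta>' R})) \<noteq> {}"
        by (rule irreducible_open_meet[OF Cc(2) \<Omega>1 op ne])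
      then show False using val(1) by blast
    qed
    then have "\<forall>P\<in>C. \<phi> P = \<beta>' R" using morphism_maps[OF \<phi>] by blast
    then show False using nonconst by blast
  qed
  show ?thesis
  proof (rule that[OF WA Wne _ reg nc])
    show "\<theta> ` W \<subseteq> B" using \<theta>V' V'B by blast
  qed
qed

section \<open>Maps between the curves\<close>

context AS_curve_inf
begin

section \<open>Values at affine points and identities in the function field\<close>

lemma rhom_pt: "rhom (pt x y)"
  unfolding pt_def by (intro rhom_hev rhom_poly)

lemmas pt_simps = rhomD[OF rhom_pt]

lemma pt_eqn: "y ^ p + c * y = x ^ (q + 1) \<Longrightarrow> pt x y eqn = 0"
proof -
  assume xy: "y ^ p + c * y = x ^ (q + 1)"
  have "pt x y eqn = y ^ p + c * y - x ^ (q + 1)"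
    unfolding pt_def
    by (simp add: eqn_def rhomD[OF rhom_hev[OF rhom_poly]] hev_monom hev_pCons rhom_poly poly_monom)
  then show ?thesis using xy by simp
qed

lemma pt_zero:
  assumes "pl xi yi R = 0" "y ^ p + c * y = x ^ (q + 1)"
  shows "pt x y R = 0"
proof -
  have "eqn dvd R" using assms(1) by (simp only: eqn_dvd_iff)
  then have "pt x y eqn dvd pt x y R" by (rule rhom_dvd[OF rhom_pt])
  then show ?thesis using pt_eqn[OF assms(2)] by simp
qed

text \<open>A Nullstellensatz for the curve: by \<open>divide_linear\<close> the coefficients of the
  reduced remainder vanish at every element of \<open>K\<close>.\<close>

lemma vanishing:
  assumes "\<And>x y. y ^ p + c * y = x ^ (q + 1) \<Longrightarrow> pt x y R = 0"
  shows "pl xi yi R = 0"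
proof -
  obtain a where a: "degree a < p" "eqn dvd R - a" using ex_reduced by blast
  then have "pl xi yi (R - a) = 0" by (simp only: eqn_dvd_iff)
  then have Ra: "pl xi yi R = pl xi yi a" unfolding pl_simps by simp
  have pa: "pt x y a = 0" if "y ^ p + c * y = x ^ (q + 1)" for x y
    using pt_zero[OF \<open>pl xi yi (R - a) = 0\<close> that] assms[OF that] unfolding pt_simps by simp
  have "coeff a i = 0" for i
  proof -
    have root: "poly (coeff a i) x = 0" for x
    proof -
      obtain G where "a = smult [:-x, 1:] G" using divide_linear[OF a(1) pa] by blast
      then show ?thesis by simp
    qed
    \<comment> \<open>A polynomial without roots is constant; adding 1 makes this apply to one that
      vanishes everywhere.\<close>
    then have "\<nexists>x. poly (coeff a i + 1) x = 0" by simp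
    then have "degree (coeff a i + 1) = 0" using alg_closed_imp_poly_has_root by blast
    then obtain k where "coeff a i + 1 = [:k:]" by (metis degree_eq_zeroE)
    then have "coeff a i = [:k - 1:]" by (simp add: one_pCons eq_diff_eq[symmetric])
    then show ?thesis using root by simp
  qed
  then have "a = 0" by (simp add: poly_eq_iff)
  then show ?thesis using Ra by (simp add: pl_simps)
qed

text \<open>The fractions are the coordinates of a map defined where \<open>e\<close> does not
  vanish. Multiplying by \<open>e\<close> extends their relation to the whole curve, so it holds in
  the function field and \<open>no_solution\<close> applies.\<close>

lemma rational_map_constant:
  assumes p3: "p > 2" and r: "r = p ^ l" "l \<ge> 3" and q: "q = r ^ 2"
    and xy0: "y0 ^ p + c * y0 = x0 ^ (q + 1)" "pt x0 y0 e \<noteq> 0"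
    and map: "\<And>x y. y ^ p + c * y = x ^ (q + 1) \<Longrightarrow> pt x y e \<noteq> 0 \<Longrightarrow>
      pt x y h1 \<noteq> 0 \<and> pt x y h2 \<noteq> 0 \<and>
      (pt x y g2 / pt x y h2) ^ p + c * (pt x y g2 / pt x y h2) = (pt x y g1 / pt x y h1) ^ (r + 1)"
  shows "\<exists>a b. \<forall>x y. y ^ p + c * y = x ^ (q + 1) \<longrightarrow> pt x y e \<noteq> 0 \<longrightarrow>
    pt x y g1 / pt x y h1 = a \<and> pt x y g2 / pt x y h2 = b"
proof -
  have p0: "p > 0" by (rule prime_gt_0_nat[OF prime_p])
  have ne: "pl xi yi e \<noteq> 0" "pl xi yi h1 \<noteq> 0" "pl xi yi h2 \<noteq> 0"
    using pt_zero[OF _ xy0(1)] map[OF xy0] xy0(2) by blast+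
  define R where "R = g2 ^ p * h1 ^ (r + 1) + [:[:c:]:] * g2 * h2 ^ (p - 1) * h1 ^ (r + 1) - g1 ^ (r + 1) * h2 ^ p"
  have "pl xi yi (e * R) = 0"
  proof (rule vanishing)
    fix x y assume xy: "y ^ p + c * y = x ^ (q + 1)"
    show "pt x y (e * R) = 0"
    proof (cases "pt x y e = 0")
      case False
      have cc: "pt x y [:[:c:]:] = c" by (simp add: pt_def rhom_poly)
      note m = map[OF xy False]
      have "pt x y R = 0"
        unfolding R_def pt_simps cc
        using m fraction_relation[of "pt x y h1" "pt x y h2" p "pt x y g2" c "pt x y g1" "r + 1"] p0 by blast
      then show ?thesis by (simp add: pt_simps)
    qed (simp add: pt_simps)
  qed
  then have R0: "pl xi yi R = 0" unfolding pl_simps using ne by simp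
  define u where "u = pl xi yi g1 / pl xi yi h1"
  define v where "v = pl xi yi g2 / pl xi yi h2"
  have cc: "pl xi yi [:[:c:]:] = fls_const c" by (simp add: rhom_fls_const)
  have rel: "v ^ p + fls_const c * v = u ^ (r + 1)"
    unfolding u_def v_def fraction_relation[OF ne(2,3) p0] using R0 unfolding R_def pl_simps cc .
  have uL: "u \<in> LL" and vL: "v \<in> LL" unfolding u_def v_def by (intro LL_fraction ne)+
  obtain a where a: "u = fls_const a" using no_solution[OF p3 r q uL vL rel] by blast
  \<comment> \<open>A constant \<open>b0\<close> solves the equation with the now constant right
    side, so \<open>v - b0\<close> is a root of \<open>X^p + c X\<close> and hence constant.\<close>
  have "{b. b ^ p + c * b = a ^ (r + 1)} \<noteq> {}"
  proof
    assume "{b. b ^ p + c * b = a ^ (r + 1)} = {}"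
    then have "p = 0" using artin_schreier_roots(2)[OF prime_p char_p c_nz, of "a ^ (r + 1)"] by simp
    then show False using p0 by simp
  qed
  then obtain b0 where "b0 ^ p + c * b0 = a ^ (r + 1)" by blast
  then have b0: "fls_const b0 ^ p + fls_const c * fls_const b0 = fls_const a ^ (r + 1)"
    by (simp only: rhomD[OF rhom_fls_const, symmetric])
  have "v ^ p = (v - fls_const b0) ^ p + fls_const b0 ^ p" using frob(2)[of "v - fls_const b0" "fls_const b0"] by simp
  then have "(v - fls_const b0) ^ p + fls_const c * (v - fls_const b0) =
      (v ^ p + fls_const c * v) - (fls_const b0 ^ p + fls_const c * fls_const b0)"
    by (simp add: algebra_simps)
  then have "(v - fls_const b0) ^ p + fls_const c * (v - fls_const b0) = 0" unfolding rel b0 a by simp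
  then obtain d where "v - fls_const b0 = fls_const d" using artin_schreier_const by blast
  then have v: "v = fls_const (d + b0)" by (simp add: diff_eq_eq flip: fls_plus_const)
  have const: "pt x y g / pt x y h = k"
    if "pl xi yi g / pl xi yi h = fls_const k" "pl xi yi h \<noteq> 0" "pt x y h \<noteq> 0"
      "y ^ p + c * y = x ^ (q + 1)" for g h k x y
  proof -
    have "pl xi yi (g - [:[:k:]:] * h) = 0"
      unfolding pl_simps using that(1,2) by (simp add: rhom_fls_const divide_eq_eq)
    then have "pt x y (g - [:[:k:]:] * h) = 0" using that(4) by (rule pt_zero)
    then have "pt x y g = k * pt x y h" unfolding pt_simps by (simp add: pt_def rhom_poly)
    then show ?thesis using that(3) by simp
  qed
  show ?thesis
  proof (rule exI[of _ a], rule exI[of _ "d + b0"], intro allI impI conjI)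
    fix x y assume xy: "y ^ p + c * y = x ^ (q + 1)" "pt x y e \<noteq> 0"
    show "pt x y g1 / pt x y h1 = a"
      by (rule const[OF _ ne(2) _ xy(1)]) (use a u_def map[OF xy] in simp_all)
    show "pt x y g2 / pt x y h2 = d + b0"
      by (rule const[OF _ ne(3) _ xy(1)]) (use v v_def map[OF xy] in simp_all)
  qed
qed

end

text \<open>
  The dehomogenization at the third coordinate; \<open>x\<close> and \<open>y\<close> are the first and second coordinates.
\<close>

definition dehom :: "('k::field, 3) mpol \<Rightarrow> 'k poly poly" where
  "dehom F = (\<Sum>m\<in>Poly_Mapping.keys F.
     monom (monom (Poly_Mapping.lookup F m) (Poly_Mapping.lookup m 1)) (Poly_Mapping.lookup m 2))"

lemma hev_dehom: "hev (\<lambda>A. poly A x) y (dehom F) = mpol_eval F (vector [x, y, 1])"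
proof -
  have 3: "(1 :: 3) \<notin> {2, 3}" "(2 :: 3) \<notin> {3}" by auto
  have "(\<Prod>i\<in>UNIV. vec_nth (vector [x, y, 1] :: 'a ^ 3) i ^ Poly_Mapping.lookup m i) =
      x ^ Poly_Mapping.lookup m 1 * y ^ Poly_Mapping.lookup m 2" for m :: "3 \<Rightarrow>\<^sub>0 nat"
    unfolding UNIV_3
    by (simp only: prod.insert finite.emptyI finite.insertI 3 empty_iff not_False_eq_True prod.empty vector_3
        power_one mult_1_right)
  then show ?thesis
    unfolding dehom_def mpol_eval_def rhom_sum[OF rhom_hev[OF rhom_poly]] hev_monom[OF rhom_poly] poly_monom
    by (simp only: mult.assoc)
qed

lemma vector_nz: "vector [x, y, 1] \<noteq> (0 :: 'k::field ^ 3)"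
proof
  assume "vector [x, y, 1] = (0 :: 'k ^ 3)"
  then have "vec_nth (vector [x, y, 1] :: 'k ^ 3) 3 = 0" by (simp only: zero_index)
  then show False by (simp add: vector_3)
qed

text \<open>One scalar, relating the chosen representative to \<open>(x, y, 1)\<close>, serves all
  forms, so it cancels in quotients of forms of equal degree.\<close>

lemma form_at_affine:
  fixes x y :: "'k::field"
  shows "\<exists>a. a \<noteq> 0 \<and> (\<forall>d F. homogeneous d F \<longrightarrow>
    form_at F (abs_proj (vector [x, y, 1])) = a ^ d * hev (\<lambda>A. poly A x) y (dehom F))"
proof -
  obtain a where a: "a \<noteq> 0" "rep_proj (abs_proj (vector [x, y, 1])) = a *s (vector [x, y, 1] :: 'k ^ 3)"
    by (rule rep_abs_proj[OF vector_nz])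
  then show ?thesis unfolding form_at_def hev_dehom
    by (intro exI[of _ a]) (simp add: mpol_eval_scale)
qed

definition affine_coord :: "3 \<Rightarrow> ('k::field, 3) proj \<Rightarrow> 'k" where
  "affine_coord i Q = form_at (coord i) Q / form_at (coord 3) Q"

lemma affine_coord:
  "form_at (coord 3) (abs_proj (vector [x, y, 1]) :: ('k::field, 3) proj) \<noteq> 0"
  "affine_coord 1 (abs_proj (vector [x, y, 1])) = (x :: 'k)"
  "affine_coord 2 (abs_proj (vector [x, y, 1])) = (y :: 'k)"
proof -
  obtain a where a: "a \<noteq> 0" "rep_proj (abs_proj (vector [x, y, 1])) = a *s (vector [x, y, 1] :: 'k ^ 3)"
    by (rule rep_abs_proj[OF vector_nz])
  have "form_at (coord i) (abs_proj (vector [x, y, 1]) :: ('k, 3) proj) = a * vec_nth (vector [x, y, 1] :: 'k ^ 3) i" for i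
    unfolding form_at_def mpol_eval_coord a(2) by simp
  then show "form_at (coord 3) (abs_proj (vector [x, y, 1]) :: ('k, 3) proj) \<noteq> 0"
    "affine_coord 1 (abs_proj (vector [x, y, 1])) = x" "affine_coord 2 (abs_proj (vector [x, y, 1])) = y"
    using a(1) by (simp_all add: affine_coord_def vector_3)
qed

lemma regular_affine_coord: "regular_on (affine_B p c n) (affine_coord i)"
  unfolding regular_on_def
proof
  fix P assume "P \<in> affine_B p c n"
  then show "\<exists>V. openin (zariski_on (affine_B p c n)) V \<and> P \<in> V \<and>
      (\<exists>d G H. homogeneous d G \<and> homogeneous d H \<and>
        (\<forall>Q\<in>V. form_at H Q \<noteq> 0 \<and> affine_coord i Q = form_at G Q / form_at H Q))"
    using openin_topspace[of "zariski_on (affine_B p c n)"] homogeneous_coord[of i] homogeneous_coord[of 3]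
    by (intro exI[of _ "affine_B p c n"] exI[of _ 1] exI[of _ "coord i"] exI[of _ "coord 3"] conjI ballI)
      (auto simp: affine_B_def affine_coord(1) affine_coord_def[of i])
qed

text \<open>Among the forms defining the complement, one that does not vanish at the given point
  already cuts out a smaller neighbourhood, described by a single polynomial.\<close>

lemma affine_open_contains_principal:
  assumes "openin (zariski_on (affine_B p c n)) \<Omega>" "abs_proj (vector [x0, y0, 1]) \<in> \<Omega>"
  obtains \<Omega>' e where "openin (zariski_on (affine_B p c n)) \<Omega>'" "\<Omega>' \<subseteq> \<Omega>"
    "abs_proj (vector [x0, y0, 1]) \<in> \<Omega>'"
    "\<And>x y. y ^ p + c * y = x ^ (p ^ n + 1) \<Longrightarrow>
      abs_proj (vector [x, y, 1]) \<in> \<Omega>' \<longleftrightarrow> hev (\<lambda>A. poly A x) y e \<noteq> 0"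
proof -
  obtain O1 where O1: "openin zariski O1" "\<Omega> = O1 \<inter> affine_B p c n"
    using assms(1) unfolding openin_subtopology by blast
  obtain S where S: "\<forall>F\<in>S. \<exists>d. homogeneous d F" "- O1 = zero_locus S"
    using O1(1) unfolding openin_zariski zariski_closed_def by blast
  have mem: "Q \<in> O1 \<longleftrightarrow> (\<exists>F\<in>S. form_at F Q \<noteq> 0)" for Q
    using S(2) unfolding zero_locus_def by blast
  obtain F where F: "F \<in> S" "form_at F (abs_proj (vector [x0, y0, 1])) \<noteq> 0"
    using assms(2) O1(2) mem by blast
  obtain d where d: "homogeneous d F" using S(1) F(1) by blast
  have nz: "form_at F (abs_proj (vector [x, y, 1])) \<noteq> 0 \<longleftrightarrow> hev (\<lambda>A. poly A x) y (dehom F) \<noteq> 0" for x y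
  proof -
    obtain a where "a \<noteq> 0"
      "form_at F (abs_proj (vector [x, y, 1])) = a ^ d * hev (\<lambda>A. poly A x) y (dehom F)"
      using form_at_affine[of x y] d by blast
    then show ?thesis by simp
  qed
  define O2 where "O2 = {Q. form_at F Q \<noteq> 0}"
  have "- O2 = zero_locus {F}" by (auto simp: O2_def zero_locus_def)
  then have "openin zariski O2" unfolding openin_zariski zariski_closed_def using d by blast
  show ?thesis
  proof (rule that[of "O2 \<inter> affine_B p c n" "dehom F"])
    show "openin (zariski_on (affine_B p c n)) (O2 \<inter> affine_B p c n)"
      unfolding openin_subtopology using \<open>openin zariski O2\<close> by blast
    show "O2 \<inter> affine_B p c n \<subseteq> \<Omega>" unfolding O1(2) O2_def using mem F(1) by blast
    show "abs_proj (vector [x0, y0, 1]) \<in> O2 \<inter> affine_B p c n"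
      using F(2) assms(2) O1(2) unfolding O2_def by blast
    fix x y assume xy: "y ^ p + c * y = x ^ (p ^ n + 1)"
    then have "abs_proj (vector [x, y, 1]) \<in> affine_B p c n" unfolding affine_B_def by blast
    then show "abs_proj (vector [x, y, 1]) \<in> O2 \<inter> affine_B p c n \<longleftrightarrow>
        hev (\<lambda>A. poly A x) y (dehom F) \<noteq> 0"
      using nz unfolding O2_def by blast
  qed
qed

lemma regular_at_affine_point:
  fixes W :: "('k::field, 3) proj set"
  assumes "regular_on W f" "abs_proj (vector [x0, y0, 1]) \<in> W"
  obtains V g h where "openin (zariski_on W) V" "abs_proj (vector [x0, y0, 1]) \<in> V"
    "\<And>x y. abs_proj (vector [x, y, 1]) \<in> V \<Longrightarrow> hev (\<lambda>A. poly A x) y h \<noteq> 0 \<and>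
      f (abs_proj (vector [x, y, 1])) = hev (\<lambda>A. poly A x) y g / hev (\<lambda>A. poly A x) y h"
proof -
  obtain V d G H where V: "openin (zariski_on W) V" "abs_proj (vector [x0, y0, 1]) \<in> V"
    "homogeneous d G" "homogeneous d H" "\<forall>Q\<in>V. form_at H Q \<noteq> 0 \<and> f Q = form_at G Q / form_at H Q"
    using assms unfolding regular_on_def by metis
  show ?thesis
  proof (rule that[OF V(1,2), of "dehom H" "dehom G"])
    fix x y assume "abs_proj (vector [x, y, 1]) \<in> V"
    then have Q: "form_at H (abs_proj (vector [x, y, 1])) \<noteq> 0"
      "f (abs_proj (vector [x, y, 1])) = form_at G (abs_proj (vector [x, y, 1])) / form_at H (abs_proj (vector [x, y, 1]))"
      using V(5) by blast+
    obtain a where a: "a \<noteq> 0" "\<forall>d F. homogeneous d F \<longrightarrow>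
        form_at F (abs_proj (vector [x, y, 1])) = a ^ d * hev (\<lambda>A. poly A x) y (dehom F)"
      using form_at_affine[of x y] by blast
    have GH: "form_at G (abs_proj (vector [x, y, 1])) = a ^ d * hev (\<lambda>A. poly A x) y (dehom G)"
      "form_at H (abs_proj (vector [x, y, 1])) = a ^ d * hev (\<lambda>A. poly A x) y (dehom H)"
      using a(2) V(3,4) by blast+
    show "hev (\<lambda>A. poly A x) y (dehom H) \<noteq> 0 \<and> f (abs_proj (vector [x, y, 1])) =
        hev (\<lambda>A. poly A x) y (dehom G) / hev (\<lambda>A. poly A x) y (dehom H)"
      using Q a(1) unfolding GH by simp
  qed
qed

theorem theorem1p3:
  fixes p l :: nat and c :: "'k::alg_closed_field"
    and C :: "('k, 'm::finite) proj set" and D :: "('k, 'n::finite) proj set"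
  assumes "Factorial_Ring.prime p" and "odd p"
    and "alg_closure_of_Fp p TYPE('k)"
    and "c \<in> {1, -1}"
    and "l > 2"
    and "nonsingular_projective_model C (affine_B p c (2 * l))"
    and "nonsingular_projective_model D (affine_B p c l)"
  shows "\<not> (\<exists>\<phi>. galois_morphism C D \<phi>)"
proof
  assume "\<exists>\<phi>. galois_morphism C D \<phi>"
  then obtain \<phi> where \<phi>: "variety_morphism C D \<phi>" "\<not> (\<exists>Q. \<forall>P\<in>C. \<phi> P = Q)"
    unfolding galois_morphism_def by blast
  have char: "CHAR('k) = p" using assms(3) unfolding alg_closure_of_Fp_def by blast
  have p3: "p > 2" using assms(1,2) prime_ge_2_nat[of p] by (cases "p = 2") auto
  have "c \<noteq> 0" "c ^ p = c" using assms(2,4) by auto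
  then have AS: "AS_curve p (p ^ (2 * l)) c (2 * l)"
    using assms(1,5) char by unfold_locales simp_all
  obtain xi yi where "AS_curve_inf p (p ^ (2 * l)) c (2 * l) xi yi"
    using AS_curve.ex_infinite_place[OF AS] AS unfolding AS_curve_inf_def AS_curve_inf_axioms_def by blast
  then interpret AS_curve_inf p "p ^ (2 * l)" c "2 * l" xi yi .
  obtain W \<theta> where W: "openin (zariski_on (affine_B p c (2 * l))) W" "W \<noteq> {}" "\<theta> ` W \<subseteq> affine_B p c l"
    and reg: "\<And>f. regular_on (affine_B p c l) f \<Longrightarrow> regular_on W (f \<circ> \<theta>)"
    and nonconst: "\<And>\<Omega> R. openin (zariski_on (affine_B p c (2 * l))) \<Omega> \<Longrightarrow> \<Omega> \<noteq> {} \<Longrightarrow> \<Omega> \<subseteq> W \<Longrightarrow>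
      (\<And>P. P \<in> \<Omega> \<Longrightarrow> \<theta> P = R) \<Longrightarrow> False"
    using birational_pullback[of C D "affine_B p c (2 * l)" "affine_B p c l" \<phi>] assms(6,7) \<phi>
    unfolding nonsingular_projective_model_def by metis
  have WA: "W \<subseteq> affine_B p c (2 * l)" using openin_subset[OF W(1)] by simp
  obtain x0 y0 where P0: "abs_proj (vector [x0, y0, 1]) \<in> W" and xy0: "y0 ^ p + c * y0 = x0 ^ (p ^ (2 * l) + 1)"
    using W(2) WA unfolding affine_B_def by blast
  obtain V1 g1 h1 where V1: "openin (zariski_on W) V1" "abs_proj (vector [x0, y0, 1]) \<in> V1"
    "\<And>x y. abs_proj (vector [x, y, 1]) \<in> V1 \<Longrightarrow> pt x y h1 \<noteq> 0 \<and>
      (affine_coord 1 \<circ> \<theta>) (abs_proj (vector [x, y, 1])) = pt x y g1 / pt x y h1"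
    using regular_at_affine_point[OF reg[OF regular_affine_coord] P0] unfolding pt_def by metis
  obtain V2 g2 h2 where V2: "openin (zariski_on W) V2" "abs_proj (vector [x0, y0, 1]) \<in> V2"
    "\<And>x y. abs_proj (vector [x, y, 1]) \<in> V2 \<Longrightarrow> pt x y h2 \<noteq> 0 \<and>
      (affine_coord 2 \<circ> \<theta>) (abs_proj (vector [x, y, 1])) = pt x y g2 / pt x y h2"
    using regular_at_affine_point[OF reg[OF regular_affine_coord] P0] unfolding pt_def by metis
  \<comment> \<open>A common neighbourhood is needed, since each coordinate of
    \<open>\<theta>\<close> is a fraction of polynomials only locally.\<close>
  have "openin (zariski_on (affine_B p c (2 * l))) (V1 \<inter> V2)"
    by (rule zariski_on_trans[OF openin_Int[OF V1(1) V2(1)] W(1)])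
  then obtain \<Omega> e where \<Omega>: "openin (zariski_on (affine_B p c (2 * l))) \<Omega>" "\<Omega> \<subseteq> V1 \<inter> V2"
    "abs_proj (vector [x0, y0, 1]) \<in> \<Omega>"
    and e: "\<And>x y. y ^ p + c * y = x ^ (p ^ (2 * l) + 1) \<Longrightarrow>
      abs_proj (vector [x, y, 1]) \<in> \<Omega> \<longleftrightarrow> pt x y e \<noteq> 0"
    using affine_open_contains_principal[of p c "2 * l" "V1 \<inter> V2" x0 y0] V1(2) V2(2)
    unfolding pt_def by blast
  have \<Omega>W: "\<Omega> \<subseteq> W" using \<Omega>(2) openin_subset[OF V1(1)] by auto
  have image: "pt x y h1 \<noteq> 0 \<and> pt x y h2 \<noteq> 0 \<and>
      \<theta> (abs_proj (vector [x, y, 1])) = abs_proj (vector [pt x y g1 / pt x y h1, pt x y g2 / pt x y h2, 1]) \<and>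
      (pt x y g2 / pt x y h2) ^ p + c * (pt x y g2 / pt x y h2) = (pt x y g1 / pt x y h1) ^ (p ^ l + 1)"
    if xy: "abs_proj (vector [x, y, 1]) \<in> \<Omega>" for x y
  proof -
    have "\<theta> (abs_proj (vector [x, y, 1])) \<in> affine_B p c l" using xy \<Omega>W W(3) by blast
    then obtain x' y' where x'y': "\<theta> (abs_proj (vector [x, y, 1])) = abs_proj (vector [x', y', 1])"
      "y' ^ p + c * y' = x' ^ (p ^ l + 1)"
      unfolding affine_B_def by blast
    have "pt x y h1 \<noteq> 0 \<and> x' = pt x y g1 / pt x y h1"
      using V1(3)[of x y] xy \<Omega>(2) x'y'(1) affine_coord(2)[of x' y'] by auto
    moreover have "pt x y h2 \<noteq> 0 \<and> y' = pt x y g2 / pt x y h2"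
      using V2(3)[of x y] xy \<Omega>(2) x'y'(1) affine_coord(3)[of x' y'] by auto
    ultimately show ?thesis using x'y' by simp
  qed
  have "\<exists>a b. \<forall>x y. y ^ p + c * y = x ^ (p ^ (2 * l) + 1) \<longrightarrow> pt x y e \<noteq> 0 \<longrightarrow>
      pt x y g1 / pt x y h1 = a \<and> pt x y g2 / pt x y h2 = b"
  proof (rule rational_map_constant[OF p3 refl, of l y0 x0])
    show "l \<ge> 3" using assms(5) by simp
    show "p ^ (2 * l) = (p ^ l) ^ 2" by (simp add: power_mult mult.commute flip: power_mult)
    show "y0 ^ p + c * y0 = x0 ^ (p ^ (2 * l) + 1)" by (rule xy0)
    show "pt x0 y0 e \<noteq> 0" using e[OF xy0] \<Omega>(3) by blast
    fix x y assume "y ^ p + c * y = x ^ (p ^ (2 * l) + 1)" "pt x y e \<noteq> 0"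
    then have "abs_proj (vector [x, y, 1]) \<in> \<Omega>" using e by blast
    then show "pt x y h1 \<noteq> 0 \<and> pt x y h2 \<noteq> 0 \<and>
        (pt x y g2 / pt x y h2) ^ p + c * (pt x y g2 / pt x y h2) = (pt x y g1 / pt x y h1) ^ (p ^ l + 1)"
      using image by blast
  qed
  then obtain a b where ab: "\<And>x y. y ^ p + c * y = x ^ (p ^ (2 * l) + 1) \<Longrightarrow> pt x y e \<noteq> 0 \<Longrightarrow>
      pt x y g1 / pt x y h1 = a \<and> pt x y g2 / pt x y h2 = b" by blast
  have "\<theta> P = abs_proj (vector [a, b, 1])" if P: "P \<in> \<Omega>" for P
  proof -
    obtain x y where xy: "P = abs_proj (vector [x, y, 1])" "y ^ p + c * y = x ^ (p ^ (2 * l) + 1)"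
      using P \<Omega>W WA unfolding affine_B_def by blast
    then have "pt x y e \<noteq> 0" using e P by blast
    then show ?thesis using image[of x y] ab[OF xy(2)] P xy(1) by simp
  qed
  then show False using nonconst[OF \<Omega>(1) _ \<Omega>W] \<Omega>(3) by blast
qed

end
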